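(* Let $\rho>0$ and let $f_{\mathbb U,\rho}(z)=\sum_{n=0}^\infty\binom{-\rho}{n}^{1/2}a_nz^n$ with $\{a_n\}$ i.i.d. standard complex Gaussian random variables, with zero set $Z_{\mathbb U,\rho}$ in the unit disk $\mathbb U$. Let $\gamma=\lim_n(\sum_{k=1}^n\frac1k-\log n)$ be Euler's constant and $c_\rho=e^{(\rho-\gamma-\gamma\rho)/2}\rho^{-\rho/2}$. (i) Ordering $Z_{\mathbb U,\rho}$ in increasing absolute value as $\{z_k\}_{k\ge1}$, $$|f_{\mathbb U,\rho}(0)|=c_\rho\prod_{k=1}^\infty e^{\rho/(2k)}|z_k|\quad\text{a.s.}$$ (ii) More generally, for $\zeta\in\mathbb U$, ordering $Z_{\mathbb U,\rho}$ in increasing hyperbolic distance from $\zeta$ as $\{\zeta_k\}_{k\ge1}$, $$|f_{\mathbb U,\rho}(\zeta)|=c_\rho(1-|\zeta|^2)^{-\rho/2}\prod_{k=1}^\infty e^{\rho/(2k)}\Big|\frac{\zeta_k-\zeta}{1-\overline\zeta\zeta_k}\Big|\quad\text{a.s.}$$ Consequently the analytic function $f_{\mathbb U,\rho}$ is determined by its zero set up to multiplication by a constant of modulus $1$.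
   Context: A standard complex Gaussian has density $e^{-z\overline z}/\pi$ on $\mathbb C$. Here $\binom{-\rho}{n}=(-1)^n\rho(\rho+1)\cdots(\rho+n-1)/n!$ and any fixed choice of square root may be used (the law of $f_{\mathbb U,\rho}$ does not depend on it, since each $a_n$ is rotationally symmetric). Hyperbolic distance refers to the hyperbolic (Poincaré) metric on $\mathbb U$. *)

theory Defs
  imports "HOL-Probability.Probability" "HOL-Complex_Analysis.Complex_Analysis"
begin

definition std_cgauss_density :: "complex \<Rightarrow> ennreal" where
  "std_cgauss_density z = ennreal (exp (- (cmod z ^ 2)) / pi)"

definition gaf :: "(nat \<Rightarrow> complex) \<Rightarrow> (nat \<Rightarrow> 'w \<Rightarrow> complex) \<Rightarrow> 'w \<Rightarrow> complex \<Rightarrow> complex" where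
  "gaf s a \<omega> z = (\<Sum>n. s n * a n \<omega> * z ^ n)"

text \<open>Hyperbolic (Poincare) distance on the unit disk (curvature -1).\<close>
definition hyp_dist :: "complex \<Rightarrow> complex \<Rightarrow> real" where
  "hyp_dist z w = 2 * artanh (cmod (z - w) / cmod (1 - cnj z * w))"

definition zero_mult :: "(complex \<Rightarrow> complex) \<Rightarrow> complex \<Rightarrow> nat" where
  "zero_mult f w = (if cmod w < 1 \<and> f w = 0 then nat (zorder f w) else 0)"

definition zero_enum :: "(complex \<Rightarrow> complex) \<Rightarrow> (complex \<Rightarrow> real) \<Rightarrow> (nat \<Rightarrow> complex) \<Rightarrow> bool" where
  "zero_enum f d z \<longleftrightarrow>
     (\<forall>k. cmod (z k) < 1 \<and> f (z k) = 0) \<and>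
     (\<forall>w. cmod w < 1 \<and> f w = 0 \<longrightarrow> card {k. z k = w} = zero_mult f w) \<and>
     mono (\<lambda>k. d (z k))"

definition c_rho :: "real \<Rightarrow> real" where
  "c_rho \<rho> = exp ((\<rho> - euler_mascheroni - euler_mascheroni * \<rho>) / 2) * \<rho> powr (- \<rho> / 2)"

end

theory Submission
  imports Defs "HOL-Real_Asymp.Real_Asymp"
begin

text \<open>
  Jensen's formula on the hyperbolic disc of Euclidean radius \<open>r\<close> around \<open>\<zeta>\<close> reads
  \<open>J(r) = ln \<bar>f(\<zeta>)\<bar> + P(r)\<close>, where \<open>J\<close> is a circle mean of \<open>ln \<bar>f\<bar>\<close> and \<open>P(r)\<close> sums \<open>ln (r / \<bar>u\<bar>)\<close>
  over the zeros \<open>u\<close> (in the Moebius coordinate centred at \<open>\<zeta>\<close>) with \<open>\<bar>u\<bar> \<le> r\<close>. The normalised field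
  has unit variance, so \<open>J\<close> has an explicit mean involving Euler's constant, and its variance is at
  most a constant times the circle mean of the squared correlation, which decays like a power of
  \<open>1 - r\<^sup>2\<close>. Along \<open>1 - r\<^sub>j\<^sup>2 = (j + 2) powr (-p)\<close> summability of the variances gives
  \<open>P(r) + \<rho>/2 ln (1 - r\<^sup>2) \<rightarrow> const\<close> almost surely, and monotonicity of \<open>P\<close> extends this to all \<open>r \<rightarrow> 1\<close>.
  Since \<open>P\<close> is convex in \<open>ln r\<close> with slope the zero count \<open>n(r)\<close>, also \<open>n(r) (1 - r\<^sup>2) \<rightarrow> \<rho>\<close>;
  evaluating \<open>P\<close> at the moduli of the zeros turns these two limits into the product formula.

  The covariance bound comes from \<open>ln y + \<gamma> = \<integral> (1/(1+t) - exp(-t y))/t dt\<close>, because the joint Laplace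
  transform of \<open>\<bar>X\<bar>\<^sup>2, \<bar>Y\<bar>\<^sup>2\<close> for jointly Gaussian \<open>X, Y\<close> is rational in \<open>t, u\<close> and \<open>\<bar>E (X cnj Y)\<bar>\<^sup>2\<close>.
\<close>

section \<open>Zero counting from a logarithmic potential\<close>

text \<open>The factors of \<open>c_rho\<close> have separate origins.
  \<open>exp (- \<gamma> / 2)\<close> is the geometric mean of the modulus of a standard complex
  Gaussian, since \<open>\<bar>X\<bar>\<^sup>2\<close> is exponentially distributed with
  \<open>E (ln \<bar>X\<bar>\<^sup>2) = - \<gamma>\<close>.
  \<open>exp (- \<gamma> * \<rho> / 2)\<close> compensates the constant in
  \<open>(\<Sum>k\<le>n. 1 / k) = ln n + \<gamma> + o(1)\<close>. \<open>exp (\<rho> / 2)\<close>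
  and \<open>\<rho> powr (- \<rho> / 2)\<close> both come from the asymptotics of the zero count,
  through \<open>n * ln (u n) \<rightarrow> - \<rho> / 2\<close> and
  \<open>ln (n * (1 - (u n)\<^sup>2)) \<rightarrow> ln \<rho>\<close> for the ordered moduli
  \<open>u n\<close>. The obstacle on the probabilistic side is that the logarithm is unbounded at
  the zeros. The covariance is therefore computed for the integral cut off to a compact range of
  \<open>t\<close>, where every interchange of integrals concerns bounded functions. The bound does
  not depend on the cutoff, so Fatou's lemma removes it. A general centre costs nothing extra: the
  squared correlation is invariant under disc automorphisms, so its mean over a hyperbolic circle
  around \<open>\<zeta>\<close> is the mean over a Euclidean circle around 0.\<close>

lemma filterlim_at_right_0I:
  fixes e :: "nat \<Rightarrow> real"
  assumes "e \<longlonglongrightarrow> 0" "\<And>n. e n > 0" shows "filterlim e (at_right 0) sequentially"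
  using assms by (auto simp: filterlim_at intro!: always_eventually less_imp_neq[symmetric])

text \<open>As \<open>e n \<rightarrow> 0\<close> the left side of \<open>key\<close> behaves like
  \<open>y n * (1 - x) / 2\<close>. Hence \<open>x < 1\<close> bounds \<open>y n\<close> from above
  and \<open>x > 1\<close> from below by nearly \<open>- \<rho> * ln x / (1 - x)\<close>, and this
  quotient tends to \<open>\<rho>\<close> as \<open>x \<rightarrow> 1\<close> from either side. In
  the application \<open>e n = 1 - (u n)\<^sup>2\<close> and \<open>y n = n * e n\<close>.\<close>

lemma zero_count_squeeze:
  fixes y e :: "nat \<Rightarrow> real" and \<rho> :: real
  assumes rho: "\<rho> > 0" and e0: "e \<longlonglongrightarrow> 0" and epos: "\<And>n. 0 < e n \<and> e n < 1"
    and key: "\<And>x. x > 0 \<Longrightarrow> \<exists>d. d \<longlonglongrightarrow> 0 \<and>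
      (\<forall>\<^sub>F n in sequentially. y n / e n / 2 * ln (1 + (1 - x) * e n / (1 - e n)) \<le> - (\<rho>/2) * ln x + d n)"
  shows "y \<longlonglongrightarrow> \<rho>"
proof -
  have lim: "(\<lambda>n. ln (1 + (1 - x) * e n / (1 - e n)) / e n) \<longlonglongrightarrow> 1 - x" for x
  proof -
    have "((\<lambda>t::real. ln (1 + (1 - x) * t / (1 - t)) / t) \<longlongrightarrow> 1 - x) (at_right 0)"
      by real_asymp
    moreover have "filterlim e (at_right 0) sequentially"
      using e0 epos by (intro filterlim_at_right_0I) auto
    ultimately show ?thesis
      by (rule filterlim_compose)
  qed
  have upper: "\<forall>\<^sub>F n in sequentially. y n < b" if b: "b > \<rho>" for b
  proof -
    have "\<forall>\<^sub>F x in at_left (1::real). - \<rho> * ln x / (1 - x) < b"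
    proof -
      have "((\<lambda>x::real. - \<rho> * ln x / (1 - x)) \<longlongrightarrow> \<rho>) (at_left 1)" by real_asymp
      then show ?thesis using b by (rule order_tendstoD)
    qed
    moreover have "\<forall>\<^sub>F x in at_left (1::real). x > 0 \<and> x < 1"
      unfolding eventually_at_left_field by (intro exI[of _ 0]) auto
    ultimately obtain x :: real where x: "0 < x" "x < 1" "- \<rho> * ln x / (1 - x) < b"
      using eventually_happens[of _ "at_left (1::real)"]
      by (metis (mono_tags, lifting) eventually_conj trivial_limit_at_left_real)
    obtain d where d: "d \<longlonglongrightarrow> 0" and ev: "\<forall>\<^sub>F n in sequentially.
        y n / e n / 2 * ln (1 + (1 - x) * e n / (1 - e n)) \<le> - (\<rho>/2) * ln x + d n"
      using key[OF x(1)] by blast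
    let ?l = "\<lambda>n. ln (1 + (1 - x) * e n / (1 - e n)) / e n"
    have "(\<lambda>n. (- \<rho> * ln x + 2 * d n) / ?l n) \<longlonglongrightarrow> (- \<rho> * ln x + 2 * 0) / (1 - x)"
      using x by (intro tendsto_intros d lim) auto
    then have "\<forall>\<^sub>F n in sequentially. (- \<rho> * ln x + 2 * d n) / ?l n < b"
      using x by (intro order_tendstoD) auto
    moreover have "\<forall>\<^sub>F n in sequentially. ?l n > 0"
      using x by (intro order_tendstoD[OF lim]) auto
    ultimately show ?thesis using ev
    proof eventually_elim
      case (elim n)
      have "y n * ?l n \<le> - \<rho> * ln x + 2 * d n" using elim(3) by (simp add: field_simps)
      then have "y n \<le> (- \<rho> * ln x + 2 * d n) / ?l n" using elim(2) by (simp only: pos_le_divide_eq)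
      then show ?case using elim(1) by linarith
    qed
  qed
  have lower: "\<forall>\<^sub>F n in sequentially. y n > b" if b: "b < \<rho>" for b
  proof -
    have "\<forall>\<^sub>F x in at_right (1::real). \<rho> * ln x / (x - 1) > b"
    proof -
      have "((\<lambda>x::real. \<rho> * ln x / (x - 1)) \<longlongrightarrow> \<rho>) (at_right 1)" by real_asymp
      then show ?thesis using b by (rule order_tendstoD)
    qed
    moreover have "\<forall>\<^sub>F x in at_right (1::real). x > 1"
      by (rule eventually_at_right_less)
    ultimately obtain x :: real where x: "1 < x" "\<rho> * ln x / (x - 1) > b"
      using eventually_happens[of _ "at_right (1::real)"]
      by (metis (mono_tags, lifting) eventually_conj trivial_limit_at_right_real)
    obtain d where d: "d \<longlonglongrightarrow> 0" and ev: "\<forall>\<^sub>F n in sequentially.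
        y n / e n / 2 * ln (1 + (1 - x) * e n / (1 - e n)) \<le> - (\<rho>/2) * ln x + d n"
      using key[of x] x by auto
    \<comment> \<open>For \<open>x > 1\<close> the logarithm is eventually negative; with the sign
      reversed \<open>?l\<close> is a positive divisor and \<open>key\<close> becomes a lower
      bound.\<close>
    let ?l = "\<lambda>n. - (ln (1 + (1 - x) * e n / (1 - e n)) / e n)"
    have lim': "?l \<longlonglongrightarrow> x - 1" using tendsto_minus[OF lim[of x]] by simp
    have "(\<lambda>n. (\<rho> * ln x - 2 * d n) / ?l n) \<longlonglongrightarrow> (\<rho> * ln x - 2 * 0) / (x - 1)"
      using x by (intro tendsto_divide lim' tendsto_diff tendsto_mult d tendsto_const) auto
    then have "\<forall>\<^sub>F n in sequentially. (\<rho> * ln x - 2 * d n) / ?l n > b"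
      using x by (intro order_tendstoD) auto
    moreover have "\<forall>\<^sub>F n in sequentially. ?l n > 0"
      using x by (intro order_tendstoD[OF lim']) auto
    ultimately show ?thesis using ev
    proof eventually_elim
      case (elim n)
      have "y n * ?l n \<ge> \<rho> * ln x - 2 * d n" using elim(3) by (simp add: field_simps)
      then have "y n \<ge> (\<rho> * ln x - 2 * d n) / ?l n" using elim(2) by (simp only: pos_divide_le_eq)
      then show ?case using elim(1) by linarith
    qed
  qed
  show ?thesis by (rule order_tendstoI) (use upper lower in auto)
qed

text \<open>Here \<open>u\<close> lists the moduli of the zeros in the Moebius coordinate centred at
  \<open>\<zeta>\<close>, repeated by multiplicity. The constant \<open>c\<close> is the one left
  over in the asymptotics of the potential, and \<open>p\<close> fixes the sequence of radii on
  which these asymptotics are known.\<close>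

locale zero_moduli =
  fixes u :: "nat \<Rightarrow> real" and \<rho> c p :: real
  assumes u01: "\<And>k. 0 < u k \<and> u k < 1" and u_mono: "mono u"
    and fin: "\<And>r. r < 1 \<Longrightarrow> finite {k. u k \<le> r}"
    and rho: "\<rho> > 0" and p: "p > 0"
begin

definition P :: "real \<Rightarrow> real" where "P r = (\<Sum>k | u k \<le> r. ln (r / u k))"

text \<open>Zeros tied with \<open>u n\<close> contribute \<open>ln 1 = 0\<close>, so \<open>P (u n)\<close> is a sum over exactly the first \<open>n\<close> indices.\<close>
lemma P_ge:
  assumes r: "0 < r" "r < 1"
  shows "P r \<ge> P (u n) + n * ln (r / u n)" and "P (u n) = (\<Sum>k<n. ln (u n / u k))"
proof -
  have uu: "u k > 0" for k using u01 by blast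
  show *: "P (u n) = (\<Sum>k<n. ln (u n / u k))"
    unfolding P_def
  proof (rule sum.mono_neutral_right)
    show "finite {k. u k \<le> u n}" using fin u01 by blast
    show "{..<n} \<subseteq> {k. u k \<le> u n}" using u_mono by (auto simp: mono_def)
    show "\<forall>i\<in>{k. u k \<le> u n} - {..<n}. ln (u n / u i) = 0"
    proof
      fix i assume "i \<in> {k. u k \<le> u n} - {..<n}"
      then have "u i = u n" using u_mono by (auto simp: mono_def intro: antisym)
      then show "ln (u n / u i) = 0" using uu[of n] by simp
    qed
  qed
  have "P (u n) + n * ln (r / u n) = (\<Sum>k<n. ln (u n / u k) + ln (r / u n))"
    by (simp add: * sum.distrib)
  also have "\<dots> = (\<Sum>k<n. ln (r / u k))"
    using uu r by (intro sum.cong refl) (simp add: ln_div uu less_imp_neq[symmetric])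
  \<comment> \<open>Terms with \<open>u k > r\<close> are negative and are dropped here; the terms
    that are then added to reach \<open>P r\<close> have \<open>u k \<le> r\<close> and are
    nonnegative.\<close>
  also have "\<dots> \<le> (\<Sum>k\<in>{..<n} \<inter> {k. u k \<le> r}. ln (r / u k))"
  proof -
    have "(\<Sum>k<n. ln (r / u k)) = (\<Sum>k\<in>{..<n} \<inter> {k. u k \<le> r}. ln (r / u k))
        + (\<Sum>k\<in>{..<n} - {k. u k \<le> r}. ln (r / u k))"
      using sum.Int_Diff[of "{..<n}"] by blast
    moreover have "(\<Sum>k\<in>{..<n} - {k. u k \<le> r}. ln (r / u k)) \<le> 0"
      using uu r by (intro sum_nonpos) (auto simp: ln_div intro!: less_imp_le)
    ultimately show ?thesis by linarith
  qed
  also have "\<dots> \<le> P r"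
    unfolding P_def using fin r uu by (intro sum_mono2) (auto intro!: ln_ge_zero)
  finally show "P r \<ge> P (u n) + n * ln (r / u n)" .
qed

lemma P_mono:
  assumes "0 < r" "r \<le> r'" "r' < 1" shows "P r \<le> P r'"
proof -
  have uu: "u k > 0" for k using u01 by blast
  have "P r \<le> (\<Sum>k | u k \<le> r. ln (r' / u k))"
    unfolding P_def using assms uu by (intro sum_mono) (simp add: divide_right_mono divide_pos_pos less_imp_le)
  also have "\<dots> \<le> P r'"
    unfolding P_def using assms fin uu by (intro sum_mono2) (auto intro!: ln_ge_zero)
  finally show ?thesis .
qed

text \<open>The error in \<open>P r = - \<rho> / 2 * ln (1 - r\<^sup>2) - c\<close>, in the variable
  \<open>x = 1 - r\<^sup>2\<close>.\<close>

definition Q :: "real \<Rightarrow> real" where "Q x = P (sqrt (1 - x)) + \<rho> / 2 * ln x + c"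

text \<open>Between two consecutive sample points \<open>P\<close> is monotone and
  \<open>\<rho> / 2 * ln x\<close> varies by \<open>E n\<close>, which tends to 0 because the ratio
  of consecutive sample points tends to 1. Polynomial decay of the sample points is slow enough for
  this; geometric decay would not be.\<close>

lemma Q_tendsto:
  assumes lim: "(\<lambda>n. Q (real (Suc n) powr (-p))) \<longlonglongrightarrow> 0"
  shows "(Q \<longlongrightarrow> 0) (at_right 0)"
proof -
  \<comment> \<open>Chosen so that \<open>X (m x) \<le> x \<le> X (m x - 1)\<close> for small
    \<open>x\<close>.\<close>
  define m where "m = (\<lambda>x::real. nat \<lfloor>x powr (-1/p)\<rfloor>)"
  define X where "X = (\<lambda>n. real (Suc n) powr (-p))"
  define E where "E = (\<lambda>n. \<rho>/2 * p * (ln (real (Suc (Suc n))) - ln (real (Suc n))))"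
  have X_pos: "X n > 0" for n by (simp add: X_def)
  have limX: "(\<lambda>n. Q (X n)) \<longlonglongrightarrow> 0" using lim by (simp add: X_def)
  have E0: "E \<longlonglongrightarrow> 0" unfolding E_def by real_asymp
  have E_eq: "E n = \<rho>/2 * (ln (X n) - ln (X (Suc n)))" for n
    by (simp add: E_def X_def ln_powr algebra_simps)
  have mlim: "filterlim m at_top (at_right 0)"
    unfolding m_def using p
    by (intro filterlim_compose[OF filterlim_nat_sequentially]
        filterlim_compose[OF filterlim_floor_sequentially]) real_asymp
  have m1lim: "filterlim (\<lambda>x. m x - 1) at_top (at_right 0)"
    using mlim by (rule filterlim_compose[rotated]) (rule filterlim_minus_const_nat_at_top)
  have L1: "((\<lambda>x. Q (X (m x - 1)) - E (m x - 1)) \<longlongrightarrow> 0 - 0) (at_right 0)"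
    by (intro tendsto_diff filterlim_compose[OF E0 m1lim]
         filterlim_compose[OF limX m1lim])
  have L2: "((\<lambda>x. Q (X (m x)) + E (m x - 1)) \<longlongrightarrow> 0 + 0) (at_right 0)"
    by (intro tendsto_add filterlim_compose[OF E0 m1lim]
         filterlim_compose[OF limX mlim])
  \<comment> \<open>With \<open>m x \<ge> 2\<close> the point \<open>X (m x - 1)\<close> is below 1,
    so the smaller of the compared radii is positive.\<close>
  have "\<forall>\<^sub>F x in at_right 0. m x \<ge> 2" using mlim by (simp add: filterlim_at_top)
  moreover have "\<forall>\<^sub>F x in at_right (0::real). 0 < x \<and> x < 1"
    unfolding eventually_at_right_field by (intro exI[of _ 1]) auto
  ultimately have *: "\<forall>\<^sub>F x in at_right 0. Q (X (m x - 1)) - E (m x - 1) \<le> Q x \<and> Q x \<le> Q (X (m x)) + E (m x - 1)"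
  proof eventually_elim
    case (elim x)
    define v where "v = x powr (-1/p)"
    have v: "v > 0" using elim by (simp add: v_def)
    have vx: "v powr (-p) = x" using elim p by (simp add: v_def powr_powr)
    have mv: "real (m x) \<le> v" "v \<le> real (Suc (m x))" unfolding m_def v_def[symmetric] using v by linarith+
    have "v powr (-p) \<le> real (m x) powr (-p)"
      using mv elim p by (intro powr_mono2') auto
    then have a: "x \<le> X (m x - 1)" using elim unfolding vx by (simp add: X_def)
    have "real (Suc (m x)) powr (-p) \<le> v powr (-p)"
      using mv elim p v by (intro powr_mono2') auto
    then have b: "X (m x) \<le> x" unfolding vx by (simp add: X_def)
    have X1: "X (m x - 1) < 1" using elim p by (simp add: X_def powr_less_one)
    have P1: "P (sqrt (1 - X (m x - 1))) \<le> P (sqrt (1 - x))"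
      using a X1 elim by (intro P_mono) auto
    have P2: "P (sqrt (1 - x)) \<le> P (sqrt (1 - X (m x)))"
      using b X_pos elim by (intro P_mono) auto
    have "Suc (m x - 1) = m x" using elim by simp
    then have Ee: "E (m x - 1) = \<rho>/2 * ln (X (m x - 1)) - \<rho>/2 * ln (X (m x))"
      by (simp add: E_eq algebra_simps)
    have "\<rho>/2 * ln x \<le> \<rho>/2 * ln (X (m x - 1))" "\<rho>/2 * ln (X (m x)) \<le> \<rho>/2 * ln x"
      using a b X_pos elim rho by (auto intro!: mult_left_mono)
    then show ?case unfolding Q_def using P1 P2 Ee by linarith
  qed
  show ?thesis
    by (rule tendsto_sandwich[where f = "\<lambda>x. Q (X (m x - 1)) - E (m x - 1)"
          and h = "\<lambda>x. Q (X (m x)) + E (m x - 1)"])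
       (use * L1 L2 in \<open>auto elim: eventually_mono\<close>)
qed

text \<open>Solving \<open>P (u n) = n * ln (u n) - (\<Sum>k<n. ln (u k))\<close> for the sum
  reduces everything to the zero count: \<open>n * e n \<rightarrow> \<rho>\<close> with
  \<open>e n = 1 - (u n)\<^sup>2\<close> determines the limit of \<open>n * ln (u n)\<close> as well
  as the logarithmic term.\<close>

theorem product_limit:
  assumes lim: "(\<lambda>n. Q (real (Suc n) powr (-p))) \<longlonglongrightarrow> 0"
  shows "(\<lambda>n. \<Sum>k<n. \<rho> / (2 * real (Suc k)) + ln (u k))
    \<longlonglongrightarrow> c + \<rho> * euler_mascheroni / 2 - \<rho> / 2 + \<rho> / 2 * ln \<rho>"
proof -
  have Q0: "(Q \<longlongrightarrow> 0) (at_right 0)" by (rule Q_tendsto[OF lim])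
  define e where "e = (\<lambda>n. 1 - (u n)^2)"
  have e01: "0 < e n \<and> e n < 1" for n
    using u01[of n] by (auto simp: e_def power_less_one_iff abs_square_less_1)
  have u_lim: "u \<longlonglongrightarrow> 1"
  proof (rule order_tendstoI)
    fix b :: real assume "b < 1"
    then have "finite {k. u k \<le> b}" by (rule fin)
    then show "\<forall>\<^sub>F n in sequentially. b < u n"
      by (simp add: cofinite_eq_sequentially[symmetric] eventually_cofinite not_less)
  next
    fix b :: real assume "1 < b"
    then show "\<forall>\<^sub>F n in sequentially. u n < b" using u01 \<open>1 < b\<close> by (intro always_eventually allI) (metis less_trans)
  qed
  have e0: "e \<longlonglongrightarrow> 0"
    unfolding e_def using tendsto_diff[OF tendsto_const tendsto_power[OF u_lim, of 2], of 1] by simp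
  have e_right: "filterlim e (at_right 0) sequentially"
    using e0 e01 by (intro filterlim_at_right_0I) auto
  have sqrt_e: "sqrt (1 - e n) = u n" for n using u01[of n] by (simp add: e_def)
  have y: "(\<lambda>n. real n * e n) \<longlonglongrightarrow> \<rho>"
  proof (rule zero_count_squeeze[OF rho e0 e01])
    fix x :: real assume x: "x > 0"
    have xe: "filterlim (\<lambda>n. x * e n) (at_right 0) sequentially"
      using tendsto_mult[OF tendsto_const e0, of x] e01 x by (intro filterlim_at_right_0I) auto
    \<comment> \<open>In the variable \<open>ln r\<close> the potential lies above the line of slope
      \<open>n\<close> through its value at \<open>u n\<close>. This is evaluated at the radius with
      \<open>1 - r\<^sup>2 = x * e n\<close>; both potentials are known up to \<open>Q\<close>, so
      \<open>d\<close> collects the errors.\<close>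
    define d where "d = (\<lambda>n. Q (x * e n) - Q (e n))"
    have "d \<longlonglongrightarrow> 0 - 0" unfolding d_def
      by (intro tendsto_diff filterlim_compose[OF Q0 e_right] filterlim_compose[OF Q0 xe])
    moreover have "\<forall>\<^sub>F n in sequentially. x * e n < 1"
      using tendsto_mult[OF tendsto_const e0, of x] by (intro order_tendstoD) auto
    then have "\<forall>\<^sub>F n in sequentially. real n * e n / e n / 2 * ln (1 + (1 - x) * e n / (1 - e n))
          \<le> - (\<rho>/2) * ln x + d n"
    proof eventually_elim
      case (elim n)
      define r where "r = sqrt (1 - x * e n)"
      have r: "0 < r" "r < 1" using elim x e01[of n] by (auto simp: r_def)
      have "ln (r / u n) = 1/2 * ln ((1 - x * e n) / (1 - e n))"
        using elim e01[of n] by (simp add: r_def sqrt_e[symmetric] ln_div ln_sqrt)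
      also have "(1 - x * e n) / (1 - e n) = 1 + (1 - x) * e n / (1 - e n)"
        using e01[of n] by (simp add: field_simps)
      finally have l: "ln (r / u n) = 1/2 * ln (1 + (1 - x) * e n / (1 - e n))" .
      have "real n * ln (r / u n) \<le> P r - P (u n)" using P_ge(1)[OF r, of n] by linarith
      also have "\<dots> = Q (x * e n) - \<rho>/2 * ln (x * e n) - (Q (e n) - \<rho>/2 * ln (e n))"
        by (simp add: Q_def r_def sqrt_e)
      also have "\<dots> = - (\<rho>/2) * ln x + d n"
        using x e01[of n] by (simp add: d_def ln_mult algebra_simps)
      finally show ?case using e01[of n] by (simp add: l)
    qed
    ultimately show "\<exists>d. d \<longlonglongrightarrow> 0 \<and> (\<forall>\<^sub>F n in sequentially. real n * e n / e n / 2 * ln (1 + (1 - x) * e n / (1 - e n))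
          \<le> - (\<rho>/2) * ln x + d n)" by (intro exI[of _ d]) simp_all
  qed
  \<comment> \<open>Neither \<open>ln (e n)\<close> nor \<open>harm n\<close> converges; the term
    \<open>ln n\<close> is shifted between them so that each summand has a limit.\<close>
  have "(\<lambda>n. real n * e n * (ln (1 - e n) / e n / 2) + c - Q (e n)
      + \<rho>/2 * ln (real n * e n) + \<rho>/2 * (harm n - ln (real n)))
     \<longlonglongrightarrow> \<rho> * (-1/2) + c - 0 + \<rho>/2 * ln \<rho> + \<rho>/2 * euler_mascheroni"
  proof -
    have L: "(\<lambda>n. ln (1 - e n) / e n / 2) \<longlonglongrightarrow> -1/2"
    proof (rule filterlim_compose[OF _ e_right])
      show "((\<lambda>t::real. ln (1 - t) / t / 2) \<longlongrightarrow> -1/2) (at_right 0)" by real_asymp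
    qed
    have "\<rho> \<noteq> 0" using rho by simp
    then show ?thesis
      using tendsto_add[OF tendsto_add[OF tendsto_diff[OF tendsto_add[OF tendsto_mult[OF y L] tendsto_const]
          filterlim_compose[OF Q0 e_right]] tendsto_mult[OF tendsto_const tendsto_ln[OF y]]]
          tendsto_mult[OF tendsto_const euler_mascheroni_LIMSEQ]] by blast
  qed
  moreover have "\<forall>\<^sub>F n in sequentially. real n * e n * (ln (1 - e n) / e n / 2) + c - Q (e n)
      + \<rho>/2 * ln (real n * e n) + \<rho>/2 * (harm n - ln (real n)) = (\<Sum>k<n. \<rho> / (2 * real (Suc k)) + ln (u k))"
    using eventually_gt_at_top[of 0]
  proof eventually_elim
    case (elim n)
    have un: "u n > 0" "u n < 1" using u01 by auto
    have "P (u n) = (\<Sum>k<n. ln (u n) - ln (u k))"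
      unfolding P_ge(2)[OF un] using u01 un by (intro sum.cong refl ln_divide_pos) auto
    then have P: "P (u n) = n * ln (u n) - (\<Sum>k<n. ln (u k))" by (simp add: sum_subtractf)
    have lu: "ln (1 - e n) = 2 * ln (u n)" unfolding e_def using un by (simp add: ln_realpow)
    have h: "(\<Sum>k<n. \<rho> / (2 * real (Suc k))) = \<rho>/2 * harm n"
      unfolding harm_def sum_distrib_left
      by (rule sum.reindex_bij_witness[of _ "\<lambda>k. k - 1" Suc]) (auto simp: field_simps)
    have "Q (e n) = P (u n) + \<rho> / 2 * ln (e n) + c" by (simp add: Q_def sqrt_e)
    moreover have "real n * e n * (ln (1 - e n) / e n / 2) = n * ln (u n)"
      using e01[of n] by (simp add: lu)
    moreover have "ln (real n * e n) = ln n + ln (e n)" using elim e01[of n] by (simp add: ln_mult)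
    ultimately show ?case using elim P h by (simp add: sum.distrib algebra_simps)
  qed
  ultimately show ?thesis
    by (auto simp: tendsto_cong algebra_simps elim!: Lim_transform_eventually)
qed

end

section \<open>A truncated integral representation of the logarithm\<close>

abbreviation expo :: "real measure" where "expo \<equiv> density lborel (exponential_density 1)"

lemma expo_powr:
  fixes x :: real assumes x: "x > -1"
  shows "integrable expo (\<lambda>t. t powr x)" and "(LINT t|expo. t powr x) = Gamma (1 + x)"
proof -
  have eq: "exponential_density 1 t * t powr x = indicator {0..} t * t powr ((1 + x) - 1) / exp t" for t
    by (auto simp: exponential_density_def exp_minus field_simps)
  have nn: "(\<integral>\<^sup>+ t. ennreal (exponential_density 1 t * t powr x) \<partial>lborel) = ennreal (Gamma (1 + x))"
    unfolding eq using Gamma_conv_nn_integral_real[of "1 + x"] x by simp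
  have "has_bochner_integral lborel (\<lambda>t. exponential_density 1 t * t powr x) (Gamma (1 + x))"
    using x by (intro has_bochner_integral_nn_integral[OF _ _ _ nn])
      (auto simp: exponential_density_def intro!: Gamma_real_nonneg)
  then show "integrable expo (\<lambda>t. t powr x)" and "(LINT t|expo. t powr x) = Gamma (1 + x)"
    by (auto simp: integrable_density integral_density has_bochner_integral_iff exponential_density_nonneg)
qed

text \<open>\<open>E (ln T)\<close> is squeezed between the difference quotients \<open>(Gamma (1 + x) - 1) / x\<close> for \<open>x < 0\<close> and \<open>x > 0\<close>.\<close>
lemma expo_ln:
  shows "integrable expo ln" and "(LINT t|expo. ln t) = - euler_mascheroni"
proof -
  interpret prob_space expo by (rule prob_space_exponential_density) simp
  have pos: "AE t in expo. t > 0"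
    using AE_lborel_singleton[of "0::real"]
    by (auto simp: AE_density exponential_density_def elim!: eventually_mono split: if_splits)
  have up: "ln t \<le> (t powr x - 1) / x" if "t > 0" "x > 0" for t x :: real
    using ln_le_minus_one[of "t powr x"] that by (simp add: ln_powr field_simps)
  have lo: "ln t \<ge> (t powr x - 1) / x" if "t > 0" "x < 0" for t x :: real
    using ln_le_minus_one[of "t powr x"] that by (simp add: ln_powr field_simps)
  show int: "integrable expo ln"
  proof (rule Bochner_Integration.integrable_bound)
    show "integrable expo (\<lambda>t. 2 * (t powr (1/2) + t powr (-1/2)))"
      \<comment> \<open>The quotient bounds at the exponents 1/2 and -1/2 control \<open>ln\<close>
        from above and below by integrable powers.\<close>
      by (intro integrable_mult_right Bochner_Integration.integrable_add expo_powr) auto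
    show "AE t in expo. norm (ln t) \<le> norm (2 * (t powr (1/2) + t powr (-1/2)))"
      using pos
    proof eventually_elim
      case (elim t)
      define A B where "A = t powr (1/2)" and "B = t powr (-1/2)"
      have "ln t \<le> 2 * A" using up[OF elim, of "1/2"] by (simp add: A_def field_simps)
      moreover have "ln t \<ge> - 2 * B" using lo[OF elim, of "-1/2"] by (simp add: B_def field_simps)
      moreover have "A \<ge> 0" "B \<ge> 0" by (auto simp: A_def B_def)
      ultimately have "\<bar>ln t\<bar> \<le> 2 * (A + B)" by simp
      then show ?case by (simp add: A_def B_def)
    qed
  qed auto
  have intq: "integrable expo (\<lambda>t. (t powr x - 1) / x)" if "x > -1" for x
    using expo_powr[OF that] by auto
  have q: "(LINT t|expo. (t powr x - 1) / x) = (Gamma (1 + x) - Gamma 1) / x" if "x > -1" for x :: real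
    using expo_powr[OF that] prob_space by (simp add: Bochner_Integration.integral_diff)
  \<comment> \<open>The constant enters as the derivative of \<open>Gamma\<close> at 1.\<close>
  have D: "((\<lambda>x. (Gamma (1 + x) - Gamma 1) / x) \<longlongrightarrow> - euler_mascheroni) (at (0::real))"
    using has_field_derivative_Gamma[of "1::real" UNIV] by (simp add: DERIV_def)
  have u: "\<forall>\<^sub>F x in at_right (0::real). (LINT t|expo. ln t) \<le> (Gamma (1 + x) - Gamma 1) / x"
    unfolding eventually_at_right_field
  proof (intro exI[of _ 1] conjI allI impI)
    fix x :: real assume x: "0 < x" "x < 1"
    show "(LINT t|expo. ln t) \<le> (Gamma (1 + x) - Gamma 1) / x"
      unfolding q[of x, symmetric, OF order.strict_trans[OF _ x(1), of "-1", simplified]]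
      using x pos by (intro integral_mono_AE int intq) (auto elim!: eventually_mono intro!: up)
  qed simp
  have l: "\<forall>\<^sub>F x in at_left (0::real). (LINT t|expo. ln t) \<ge> (Gamma (1 + x) - Gamma 1) / x"
    unfolding eventually_at_left_field
  proof (intro exI[of _ "-1"] conjI allI impI)
    fix x :: real assume x: "-1 < x" "x < 0"
    show "(LINT t|expo. ln t) \<ge> (Gamma (1 + x) - Gamma 1) / x"
      unfolding q[OF x(1), symmetric]
      using x pos by (intro integral_mono_AE int intq) (auto elim!: eventually_mono intro!: lo)
  qed simp
  show "(LINT t|expo. ln t) = - euler_mascheroni"
  proof (rule antisym)
    show "(LINT t|expo. ln t) \<le> - euler_mascheroni"
      using D by (intro tendsto_lowerbound[OF _ u]) (auto simp: filterlim_at_split)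
    show "(LINT t|expo. ln t) \<ge> - euler_mascheroni"
      using D by (intro tendsto_upperbound[OF _ l]) (auto simp: filterlim_at_split)
  qed
qed

text \<open>Cutting off both ends makes the measure finite and the kernel below bounded uniformly in
  \<open>y \<ge> 0\<close>. Reciprocal endpoints make the errors at the two ends comparable.\<close>

definition trunc :: "nat \<Rightarrow> real measure" where
  "trunc n = restrict_space lborel {1 / real (Suc n) .. real (Suc n)}"

lemma space_trunc: "space (trunc n) = {1 / real (Suc n) .. real (Suc n)}"
  by (simp add: trunc_def space_restrict_space)

lemma sets_trunc_cong: "measurable (trunc n) N = measurable (restrict_space borel {1 / real (Suc n) .. real (Suc n)}) N"
  unfolding trunc_def by (rule measurable_cong_sets) (auto simp: sets_restrict_space)

lemma borel_measurable_trunc: "f \<in> borel_measurable borel \<Longrightarrow> f \<in> borel_measurable (trunc n)"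
  unfolding sets_trunc_cong by (rule measurable_restrict_space1)

lemma finite_measure_trunc: "finite_measure (trunc n)"
  unfolding trunc_def by (rule finite_measureI) (simp add: space_restrict_space emeasure_restrict_space emeasure_lborel_Icc_eq)

lemma trunc_integral:
  fixes f :: "real \<Rightarrow> real"
  assumes "continuous_on {1 / real (Suc n) .. real (Suc n)} f"
  shows "integrable (trunc n) f" and "(LINT t|trunc n. f t) = integral {1 / real (Suc n) .. real (Suc n)} f"
proof -
  have *: "set_integrable lborel {1 / real (Suc n) .. real (Suc n)} f"
    by (rule borel_integrable_atLeastAtMost'[OF assms])
  then show "integrable (trunc n) f" unfolding trunc_def set_integrable_def by (subst integrable_restrict_space) auto
  show "(LINT t|trunc n. f t) = integral {1 / real (Suc n) .. real (Suc n)} f"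
    unfolding set_borel_integral_eq_integral(2)[OF *, symmetric] trunc_def set_lebesgue_integral_def
    by (subst integral_restrict_space) auto
qed

text \<open>The term \<open>1 / (1 + t)\<close> is the mean of \<open>exp (- t * y)\<close> for
  exponentially distributed \<open>y\<close>. Hence the kernel is centred when \<open>y\<close> is
  the squared modulus of a standard complex Gaussian.\<close>

definition logker :: "real \<Rightarrow> real \<Rightarrow> real" where
  "logker t y = (1 / (1 + t) - exp (- t * y)) / t"

definition logapp :: "nat \<Rightarrow> real \<Rightarrow> real" where
  "logapp n y = (LINT t|trunc n. logker t y)"

text \<open>With \<open>e = 1 / (n + 1)\<close> and \<open>K = n + 1\<close> the derivative of
  \<open>logapp n\<close> is \<open>(exp (- e * x) - exp (- K * x)) / x\<close>, which lies between
  0 and \<open>1 / x\<close> and misses \<open>1 / x\<close> by at most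
  \<open>e + e / x\<^sup>2\<close>. Comparison from the base point 1 gives a majorant independent of
  \<open>n\<close> and the rate of convergence.\<close>

lemma logapp_diff:
  assumes y: "y > 0"
  shows "\<bar>logapp n y - logapp n 1\<bar> \<le> \<bar>ln y\<bar>"
    and "\<bar>ln y - (logapp n y - logapp n 1)\<bar> \<le> (\<bar>y - 1\<bar> + \<bar>1 - 1 / y\<bar>) / real (Suc n)"
proof -
  define e K where "e = 1 / real (Suc n)" and "K = real (Suc n)"
  have eK: "0 < e" "e \<le> K" "K > 0" "e = 1 / K" by (auto simp: e_def K_def field_simps)
  have cont: "continuous_on {e..K} (\<lambda>t. logker t y)" for y
    unfolding logker_def using eK
  proof (intro continuous_intros ballI)
    fix t assume "t \<in> {e..K}"
    moreover have "e > 0" by (fact eK(1))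
    ultimately have "t > 0" by auto
    then show "1 + t \<noteq> 0" "t \<noteq> 0" by auto
  qed
  have I: "logapp n y = integral (cbox e K) (\<lambda>t. logker t y)" for y
    unfolding logapp_def using trunc_integral(2)[OF cont[unfolded e_def K_def]] by (simp add: e_def K_def)
  have der0: "((\<lambda>y. logapp n y) has_field_derivative integral (cbox e K) (\<lambda>t. exp (- t * x))) (at x)"
    if "x > 0" for x
  proof -
    have "((\<lambda>y. integral (cbox e K) ((\<lambda>y t. logker t y) y)) has_field_derivative integral (cbox e K) ((\<lambda>y t. exp (- t * y)) x)) (at x within {0<..})"
    proof (rule leibniz_rule_field_derivative)
      fix x t :: real assume "x \<in> {0<..}" "t \<in> cbox e K"
      then show "((\<lambda>y. logker t y) has_field_derivative exp (- t * x)) (at x within {0<..})"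
        using eK unfolding logker_def by (auto intro!: derivative_eq_intros)
    next
      fix x :: real show "(\<lambda>t. logker t x) integrable_on cbox e K"
        using cont by (simp add: integrable_continuous_real)
    qed (use that in \<open>auto intro!: continuous_intros simp: split_beta\<close>)
    then show ?thesis using that by (simp add: I at_within_open[of _ "{0<..}"])
  qed
  have der: "(logapp n has_field_derivative (exp (- e * x) - exp (- K * x)) / x) (at x)" if x: "x > 0" for x
  proof -
    have "((\<lambda>t. exp (- t * x)) has_integral (- exp (- K * x) / x) - (- exp (- e * x) / x)) {e..K}"
      using eK x by (intro fundamental_theorem_of_calculus)
        (auto intro!: derivative_eq_intros simp: has_real_derivative_iff_has_vector_derivative[symmetric])
    then show ?thesis using der0[OF x] by (simp add: integral_unique diff_divide_distrib)
  qed
  have m1: "logapp n a \<le> logapp n b" if "0 < a" "a \<le> b" for a b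
  proof (rule DERIV_nonneg_imp_nondecreasing[OF that(2)])
    fix x assume "a \<le> x" "x \<le> b"
    then have x: "x > 0" using that by linarith
    have "e * x \<le> K * x" using x eK by (intro mult_right_mono) auto
    then show "\<exists>d. (logapp n has_real_derivative d) (at x) \<and> 0 \<le> d"
      using x by (intro exI[of _ "(exp (- e * x) - exp (- K * x)) / x"] conjI der) auto
  qed
  have m2: "ln a - logapp n a \<le> ln b - logapp n b" if "0 < a" "a \<le> b" for a b
  proof (rule DERIV_nonneg_imp_nondecreasing[OF that(2)])
    fix x assume "a \<le> x" "x \<le> b"
    then have x: "x > 0" using that by linarith
    show "\<exists>d. ((\<lambda>x. ln x - logapp n x) has_real_derivative d) (at x) \<and> 0 \<le> d"
    proof (intro exI conjI)
      show "((\<lambda>x. ln x - logapp n x) has_real_derivative 1 / x - (exp (- e * x) - exp (- K * x)) / x) (at x)"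
        using x by (auto intro!: derivative_eq_intros der)
      have "exp (- e * x) \<le> 1" using x eK by simp
      then have "exp (- e * x) - exp (- K * x) \<le> 1" using exp_gt_zero[of "-K * x"] by linarith
      then show "0 \<le> 1 / x - (exp (- e * x) - exp (- K * x)) / x" using x by (simp add: divide_right_mono)
    qed
  qed
  \<comment> \<open>The subtracted \<open>e * x - e / x\<close> is a primitive of the error bound
    \<open>e + e / x\<^sup>2\<close>. Its two parts come from the two endpoints:
    \<open>1 - exp (- e * x) \<le> e * x\<close> and
    \<open>exp (- K * x) \<le> 1 / (K * x)\<close>.\<close>
  have m3: "ln a - logapp n a - e * a + e / a \<ge> ln b - logapp n b - e * b + e / b" if "0 < a" "a \<le> b" for a b
  proof (rule DERIV_nonpos_imp_nonincreasing[OF that(2)])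
    fix x assume "a \<le> x" "x \<le> b"
    then have x: "x > 0" using that by linarith
    show "\<exists>d. ((\<lambda>x. ln x - logapp n x - e * x + e / x) has_real_derivative d) (at x) \<and> d \<le> 0"
    proof (intro exI conjI)
      show "((\<lambda>x. ln x - logapp n x - e * x + e / x) has_real_derivative
          1 / x - (exp (- e * x) - exp (- K * x)) / x - e - e / x^2) (at x)"
        using x by (auto intro!: derivative_eq_intros der simp: power2_eq_square)
      have 1: "1 - e * x \<le> exp (- e * x)" using exp_ge_add_one_self[of "- e * x"] by simp
      have "K * x \<le> exp (K * x)" using exp_ge_add_one_self[of "K * x"] by linarith
      then have "inverse (exp (K * x)) \<le> inverse (K * x)" using x eK by (intro le_imp_inverse_le) auto
      moreover have "inverse (K * x) = e / x" by (simp add: eK(4) divide_inverse)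
      ultimately have 2: "exp (- K * x) \<le> e / x" by (simp add: exp_minus)
      have "1 - (exp (- e * x) - exp (- K * x)) \<le> e * x + e / x" using 1 2 by linarith
      then have "(1 - (exp (- e * x) - exp (- K * x))) / x \<le> (e * x + e / x) / x"
        using x by (intro divide_right_mono) auto
      also have "\<dots> = e + e / x^2" using x by (simp add: field_simps power2_eq_square)
      finally show "1 / x - (exp (- e * x) - exp (- K * x)) / x - e - e / x^2 \<le> 0"
        by (simp add: diff_divide_distrib)
    qed
  qed
  show "\<bar>logapp n y - logapp n 1\<bar> \<le> \<bar>ln y\<bar>"
    using m1[of 1 y] m1[of y 1] m2[of 1 y] m2[of y 1] y by (cases "y \<ge> 1") auto
  have "\<bar>ln y - (logapp n y - logapp n 1)\<bar> \<le> e * (\<bar>y - 1\<bar> + \<bar>1 - 1 / y\<bar>)"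
  proof (cases "y \<ge> 1")
    case True
    have "1 / y \<le> 1" using True by simp
    then show ?thesis using True m2[of 1 y] m3[of 1 y] by (simp add: algebra_simps)
  next
    case False
    have "1 / y \<ge> 1" using False y by simp
    then show ?thesis using False y m2[of y 1] m3[of y 1] by (simp add: algebra_simps)
  qed
  then show "\<bar>ln y - (logapp n y - logapp n 1)\<bar> \<le> (\<bar>y - 1\<bar> + \<bar>1 - 1 / y\<bar>) / real (Suc n)"
    by (simp add: e_def)
qed

lemma logapp_diff_tendsto:
  assumes y: "y > 0" shows "(\<lambda>n. logapp n y - logapp n 1) \<longlonglongrightarrow> ln y"
proof -
  have "(\<lambda>n. ln y - (logapp n y - logapp n 1)) \<longlonglongrightarrow> 0"
  proof (rule Lim_null_comparison)
    show "\<forall>\<^sub>F n in sequentially. norm (ln y - (logapp n y - logapp n 1)) \<le> (\<bar>y - 1\<bar> + \<bar>1 - 1 / y\<bar>) / real (Suc n)"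
      using logapp_diff(2)[OF y] by auto
    show "(\<lambda>n. (\<bar>y - 1\<bar> + \<bar>1 - 1 / y\<bar>) / real (Suc n)) \<longlonglongrightarrow> 0" by real_asymp
  qed
  from tendsto_diff[OF tendsto_const this, of "ln y"] show ?thesis by simp
qed

lemma expo_exp: "t \<ge> 0 \<Longrightarrow> (LINT y|expo. exp (- t * y)) = 1 / (1 + t)"
proof -
  assume t: "t \<ge> 0"
  interpret E: prob_space "density lborel (exponential_density (1 + t))"
    using t by (intro prob_space_exponential_density) simp
  have "(LINT y|expo. exp (- t * y)) = (LINT y|lborel. 1 / (1 + t) * exponential_density (1 + t) y)"
  proof -
    have "exponential_density 1 y *\<^sub>R exp (- t * y) = 1 / (1 + t) * exponential_density (1 + t) y" for y
    proof -
      have "1 + t \<noteq> 0" using t by linarith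
      then show ?thesis by (auto simp: exponential_density_def mult_exp_exp field_simps)
    qed
    then show ?thesis by (subst integral_density) (auto simp: exponential_density_nonneg)
  qed
  also have "\<dots> = 1 / (1 + t) * (LINT y|density lborel (exponential_density (1 + t)). 1)"
    using t by (subst integral_density) (auto simp: exponential_density_nonneg)
  also have "\<dots> = 1 / (1 + t)" using E.prob_space by simp
  finally show ?thesis .
qed

lemma logker_measurable[measurable (raw)]:
  assumes [measurable]: "f \<in> borel_measurable N" "g \<in> borel_measurable N"
  shows "(\<lambda>x. logker (f x) (g x)) \<in> borel_measurable N"
  unfolding logker_def by measurable

lemma logker_bound: "t \<in> {1 / real (Suc n) .. real (Suc n)} \<Longrightarrow> y \<ge> 0 \<Longrightarrow> \<bar>logker t y\<bar> \<le> real (Suc n)"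
proof -
  assume t: "t \<in> {1 / real (Suc n) .. real (Suc n)}" and y: "y \<ge> 0"
  then have t0: "t > 0" by (auto intro: less_le_trans[of _ "1 / real (Suc n)"])
  have "\<bar>1 / (1 + t) - exp (- t * y)\<bar> \<le> 1"
  proof -
    have "1 / (1 + t) \<le> 1" "1 / (1 + t) \<ge> 0" using t0 by auto
    moreover have "exp (- t * y) \<le> 1" "exp (- t * y) \<ge> 0" using t0 y by auto
    ultimately show ?thesis by linarith
  qed
  then have "\<bar>logker t y\<bar> \<le> 1 / t" using t0 by (simp add: logker_def divide_right_mono)
  also have "1 / t \<le> real (Suc n)" using t t0 by (simp add: field_simps)
  finally show ?thesis .
qed

text \<open>\<open>logapp n\<close> has mean zero under the exponential law, so the constant is minus the limiting mean of \<open>ln\<close>.\<close>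
lemma logapp_one: "(\<lambda>n. logapp n 1) \<longlonglongrightarrow> euler_mascheroni"
proof -
  interpret E: prob_space expo by (rule prob_space_exponential_density) simp
  have pos: "AE t in expo. t > 0"
    using AE_lborel_singleton[of "0::real"]
    by (auto simp: AE_density exponential_density_def elim!: eventually_mono split: if_splits)
  have int0: "(LINT y|expo. logapp n y) = 0" for n
  proof -
    interpret T: finite_measure "trunc n" by (rule finite_measure_trunc)
    interpret P: pair_sigma_finite expo "trunc n" ..
    have fin: "finite_measure (expo \<Otimes>\<^sub>M trunc n)"
      by (rule finite_measure_pair_measure) unfold_locales
    have m[measurable]: "(\<lambda>t. t) \<in> borel_measurable (trunc n)" by (rule borel_measurable_trunc) simp
    \<comment> \<open>The kernel is bounded only for nonnegative second argument; the absolute value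
      makes the bound hold on the whole line and changes nothing almost everywhere.\<close>
    have "integrable (expo \<Otimes>\<^sub>M trunc n) (\<lambda>(y, t). logker t \<bar>y\<bar>)"
      by (intro finite_measure.integrable_const_bound[OF fin, of _ "real (Suc n)"])
         (auto simp: space_pair_measure space_trunc simp del: of_nat_Suc intro!: AE_I2 logker_bound)
    then have "(LINT y|expo. (LINT t|trunc n. logker t \<bar>y\<bar>)) = (LINT t|trunc n. (LINT y|expo. logker t \<bar>y\<bar>))"
      by (rule P.Fubini_integral[symmetric])
    also have "\<dots> = (LINT t|trunc n. 0)"
    proof (rule Bochner_Integration.integral_cong[OF refl])
      fix t assume "t \<in> space (trunc n)"
      then have t: "t > 0" by (auto simp: space_trunc intro: less_le_trans[of _ "1 / real (Suc n)"])
      have i: "integrable expo (\<lambda>y. exp (- t * \<bar>y\<bar>))"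
        by (rule E.integrable_const_bound[of _ 1]) (use t in auto)
      have "(LINT y|expo. exp (- t * \<bar>y\<bar>)) = (LINT y|expo. exp (- t * y))"
      proof (rule integral_cong_AE)
        show "AE y in expo. exp (- t * \<bar>y\<bar>) = exp (- t * y)" using pos by eventually_elim simp
      qed auto
      then show "(LINT y|expo. logker t \<bar>y\<bar>) = 0"
        using i expo_exp[of t] t E.prob_space by (simp add: logker_def)
    qed
    also have "(LINT y|expo. (LINT t|trunc n. logker t \<bar>y\<bar>)) = (LINT y|expo. logapp n y)"
      unfolding logapp_def using pos
      by (intro integral_cong_AE) (auto elim!: eventually_mono intro: T.borel_measurable_lebesgue_integral)
    finally show ?thesis by simp
  qed
  have meas: "(\<lambda>y. logapp n y) \<in> borel_measurable borel" for n
  proof -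
    interpret T: finite_measure "trunc n" by (rule finite_measure_trunc)
    have m[measurable]: "(\<lambda>t. t) \<in> borel_measurable (trunc n)" by (rule borel_measurable_trunc) simp
    show ?thesis unfolding logapp_def by measurable
  qed
  have "(\<lambda>n. LINT y|expo. logapp n y - logapp n 1) \<longlonglongrightarrow> (LINT y|expo. ln y)"
  proof (rule integral_dominated_convergence)
    show "integrable expo (\<lambda>y. \<bar>ln y\<bar>)" using expo_ln(1) by auto
    show "AE y in expo. (\<lambda>n. logapp n y - logapp n 1) \<longlonglongrightarrow> ln y"
      using pos by (auto elim!: eventually_mono intro: logapp_diff_tendsto)
    show "AE y in expo. norm (logapp n y - logapp n 1) \<le> \<bar>ln y\<bar>" for n
      using pos by (auto elim!: eventually_mono intro: logapp_diff(1))
  qed (use meas in auto)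
  moreover have "(LINT y|expo. logapp n y - logapp n 1) = - logapp n 1" for n
  proof -
    have "integrable expo (\<lambda>y. logapp n y - logapp n 1)"
    proof (rule Bochner_Integration.integrable_bound)
      show "integrable expo (\<lambda>y. \<bar>ln y\<bar>)" using expo_ln(1) by auto
      show "AE y in expo. norm (logapp n y - logapp n 1) \<le> norm \<bar>ln y\<bar>"
        using pos by (auto elim!: eventually_mono intro: logapp_diff(1))
    qed (use meas in auto)
    then have "integrable expo (\<lambda>y. (logapp n y - logapp n 1) + logapp n 1)"
      by (intro Bochner_Integration.integrable_add) auto
    then have "integrable expo (logapp n)" by simp
    then show ?thesis using int0[of n] E.prob_space by simp
  qed
  ultimately have "(\<lambda>n. - logapp n 1) \<longlonglongrightarrow> - euler_mascheroni" by (simp only: expo_ln(2))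
  then show ?thesis by (rule tendsto_minus_cancel)
qed

lemma logapp_tendsto:
  assumes y: "y > 0" shows "(\<lambda>n. logapp n y) \<longlonglongrightarrow> ln y + euler_mascheroni"
  using tendsto_add[OF logapp_diff_tendsto[OF y] logapp_one] by simp

text \<open>Supplies the majorant, uniform in \<open>n\<close>, for dominated convergence under
  circle means.\<close>

lemma logapp_bound: "\<exists>C. \<forall>n y. y > 0 \<longrightarrow> \<bar>logapp n y\<bar> \<le> C + \<bar>ln y\<bar>"
proof -
  have "Bseq (\<lambda>n. logapp n 1)" using logapp_one convergentI convergent_imp_Bseq by blast
  then obtain C where C: "\<And>n. \<bar>logapp n 1\<bar> \<le> C" by (auto simp: Bseq_def)
  show ?thesis
  proof (intro exI allI impI)
    fix n and y :: real assume "y > 0"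
    then show "\<bar>logapp n y\<bar> \<le> C + \<bar>ln y\<bar>" using logapp_diff(1)[of y n] C[of n] by linarith
  qed
qed

section \<open>Complex Gaussian integrals\<close>

lemma Complex_measurable[measurable]: "(\<lambda>(x, y). Complex x y) \<in> borel_measurable (lborel \<Otimes>\<^sub>M lborel)"
proof -
  have "(\<lambda>(x, y). Complex x y) = (\<lambda>p. complex_of_real (fst p) + \<i> * complex_of_real (snd p))"
    by (auto simp: fun_eq_iff complex_eq_iff)
  then show ?thesis by simp
qed

lemma lborel_complex: "(lborel :: complex measure) = distr (lborel \<Otimes>\<^sub>M lborel) borel (\<lambda>(x, y). Complex x y)"
proof (rule lborel_eqI)
  fix l u :: complex assume le: "\<And>b. b \<in> Basis \<Longrightarrow> l \<bullet> b \<le> u \<bullet> b"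
  then have le': "Re l \<le> Re u" "Im l \<le> Im u" using le[of 1] le[of \<i>] by (auto simp: Basis_complex_def)
  have "emeasure (distr (lborel \<Otimes>\<^sub>M lborel) borel (\<lambda>(x, y). Complex x y)) (box l u)
      = emeasure (lborel \<Otimes>\<^sub>M lborel) ({Re l<..<Re u} \<times> {Im l<..<Im u})"
    by (subst emeasure_distr) (auto intro!: arg_cong[where f="emeasure _"] simp: in_box_complex_iff space_pair_measure)
  also have "\<dots> = ennreal (Re u - Re l) * ennreal (Im u - Im l)"
    using le' by (subst lborel.emeasure_pair_measure_Times) auto
  also have "\<dots> = ennreal (\<Prod>b\<in>Basis. (u - l) \<bullet> b)"
    using le' by (simp add: Basis_complex_def ennreal_mult[symmetric])
  finally show "emeasure (distr (lborel \<Otimes>\<^sub>M lborel) borel (\<lambda>(x, y). Complex x y)) (box l u) = ennreal (\<Prod>b\<in>Basis. (u - l) \<bullet> b)" .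
qed auto

lemma has_bochner_integral_complex_product:
  fixes f g :: "real \<Rightarrow> 'a :: {banach, second_countable_topology, real_normed_field}"
  assumes f: "has_bochner_integral lborel f a" and g: "has_bochner_integral lborel g b"
  shows "has_bochner_integral lborel (\<lambda>z. f (Re z) * g (Im z)) (a * b)"
proof -
  have [measurable]: "f \<in> borel_measurable borel" "g \<in> borel_measurable borel"
    using f g by (auto simp: has_bochner_integral_iff)
  have i: "integrable lborel f" "integrable lborel g" "integral\<^sup>L lborel f = a" "integral\<^sup>L lborel g = b"
    using f g by (auto simp: has_bochner_integral_iff)
  have P: "integrable (lborel \<Otimes>\<^sub>M lborel) (\<lambda>(x, y). f x * g y)"
  proof (rule lborel_pair.Fubini_integrable)
    have "(\<lambda>x. LINT y|lborel. norm (f x * g y)) = (\<lambda>x. norm (f x) * (LINT y|lborel. norm (g y)))"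
      by (simp add: norm_mult)
    then show "integrable lborel (\<lambda>x. LINT y|lborel. norm (case (x, y) of (x, y) \<Rightarrow> f x * g y))"
      using i by simp
  qed (use i in auto)
  have "(LINT z|(lborel \<Otimes>\<^sub>M lborel). (case z of (x, y) \<Rightarrow> f x * g y)) = a * b"
    using lborel_pair.integral_fst'[OF P] i by simp
  with P have "has_bochner_integral (lborel \<Otimes>\<^sub>M lborel) (\<lambda>(x, y). f x * g y) (a * b)"
    by (simp add: has_bochner_integral_iff)
  then show ?thesis
    unfolding lborel_complex
    by (subst has_bochner_integral_distr) (auto simp: case_prod_beta')
qed

text \<open>The characteristic function of the standard normal law after rescaling by
  \<open>sqrt 2\<close>: the real and imaginary parts of a standard complex Gaussian have variance
  1/2.\<close>

lemma gauss_fourier_real: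
  "has_bochner_integral lborel (\<lambda>x. of_real (exp (- (x^2)) / sqrt pi) * exp (\<i> * of_real (2 * w * x))) (complex_of_real (exp (- (w^2))))"
proof -
  let ?f = "\<lambda>x. of_real (std_normal_density x) * iexp (sqrt 2 * w * x)"
  have "integrable std_normal_distribution (\<lambda>x. iexp (sqrt 2 * w * x))"
    by (intro prob_space.integrable_iexp prob_space_normal_density) auto
  then have i: "integrable lborel ?f"
    by (subst (asm) integrable_density) (auto simp: scaleR_conv_of_real)
  have "(CLINT x|std_normal_distribution. iexp (sqrt 2 * w * x)) = exp (- (w^2))"
    using fun_cong[OF char_std_normal_distribution, of "sqrt 2 * w"] by (simp add: char_def power_mult_distrib)
  then have v: "integral\<^sup>L lborel ?f = exp (- (w^2))"
    by (subst (asm) integral_density) (auto simp: scaleR_conv_of_real)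
  have n: "sqrt 2 * std_normal_density (sqrt 2 * x) = exp (- (x^2)) / sqrt pi" for x
    by (simp add: normal_density_def power_mult_distrib real_sqrt_mult)
  have "has_bochner_integral lborel ?f (of_real (exp (- (w^2))))" using i v by (simp add: has_bochner_integral_iff)
  then have "has_bochner_integral lborel (\<lambda>x. ?f (0 + sqrt 2 * x)) (of_real (exp (- (w^2))) /\<^sub>R \<bar>sqrt 2\<bar>)"
    by (rule lborel_has_bochner_integral_real_affine_iff[THEN iffD1, rotated]) auto
  then have "has_bochner_integral lborel (\<lambda>x. sqrt 2 *\<^sub>R ?f (0 + sqrt 2 * x)) (sqrt 2 *\<^sub>R (of_real (exp (- (w^2))) /\<^sub>R \<bar>sqrt 2\<bar>))"
    by (rule has_bochner_integral_scaleR_right)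
  moreover have "sqrt 2 *\<^sub>R ?f (0 + sqrt 2 * x) = of_real (exp (- (x^2)) / sqrt pi) * exp (\<i> * of_real (2 * w * x))" for x
    unfolding n[symmetric] by (simp add: scaleR_conv_of_real mult_ac flip: of_real_mult)
  moreover have "sqrt 2 *\<^sub>R (complex_of_real (exp (- (w^2))) /\<^sub>R \<bar>sqrt 2\<bar>) = complex_of_real (exp (- (w^2)))"
    by simp
  ultimately show ?thesis by (simp only:)
qed

lemma cgauss_fourier:
  "has_bochner_integral lborel (\<lambda>g. of_real (exp (- ((cmod g)^2)) / pi) * exp (\<i> * of_real (2 * Re (w * cnj g))))
     (complex_of_real (exp (- ((cmod w)^2))))"
proof -
  have "has_bochner_integral lborel
     (\<lambda>g. (of_real (exp (- ((Re g)^2)) / sqrt pi) * exp (\<i> * of_real (2 * Re w * Re g))) *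
          (of_real (exp (- ((Im g)^2)) / sqrt pi) * exp (\<i> * of_real (2 * Im w * Im g))))
     (complex_of_real (exp (- ((Re w)^2))) * complex_of_real (exp (- ((Im w)^2))))"
    by (rule has_bochner_integral_complex_product[OF gauss_fourier_real gauss_fourier_real])
  moreover have "(of_real (exp (- ((Re g)^2)) / sqrt pi) * exp (\<i> * of_real (2 * Re w * Re g))) *
          (of_real (exp (- ((Im g)^2)) / sqrt pi) * exp (\<i> * of_real (2 * Im w * Im g)))
     = of_real (exp (- ((cmod g)^2)) / pi) * exp (\<i> * of_real (2 * Re (w * cnj g)))" for g
  proof -
    have "of_real (exp (- ((Re g)^2)) / sqrt pi) * of_real (exp (- ((Im g)^2)) / sqrt pi) = complex_of_real (exp (- ((cmod g)^2)) / pi)"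
      by (simp add: cmod_power2 exp_diff exp_minus field_simps flip: of_real_mult of_real_divide of_real_inverse exp_add)
    moreover have "exp (\<i> * of_real (2 * Re w * Re g)) * exp (\<i> * of_real (2 * Im w * Im g)) = exp (\<i> * of_real (2 * Re (w * cnj g)))"
      unfolding exp_add[symmetric] by (rule arg_cong[where f=exp]) (simp add: algebra_simps)
    moreover have "(p * q) * (p' * q') = (p * p') * (q * q')" for p q p' q' :: complex by (simp only: mult_ac)
    ultimately show ?thesis by presburger
  qed
  moreover have "complex_of_real (exp (- ((Re w)^2))) * complex_of_real (exp (- ((Im w)^2))) = of_real (exp (- ((cmod w)^2)))"
    by (simp add: cmod_power2 flip: of_real_mult exp_add)
  ultimately show ?thesis by simp
qed

text \<open>Completing the square turns the integrand into a multiple of the normal density with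
  mean \<open>- b / A\<close> and variance \<open>1 / (2 * A)\<close>.\<close>

lemma gauss_laplace_real:
  assumes A: "A > 0"
  shows "has_bochner_integral lborel (\<lambda>x. exp (- A * x^2 - 2 * b * x)) (sqrt (pi / A) * exp (b^2 / A))"
proof -
  define \<sigma> where "\<sigma> = 1 / sqrt (2 * A)"
  have s: "\<sigma> > 0" "\<sigma>^2 = 1 / (2 * A)" using A by (auto simp: \<sigma>_def power_divide)
  have "has_bochner_integral lborel (\<lambda>x. (sqrt (pi / A) * exp (b^2 / A)) * normal_density (- b / A) \<sigma> x) ((sqrt (pi / A) * exp (b^2 / A)) * 1)"
    using s integral_normal_density[of \<sigma> "- b / A"] integrable_normal_density[of \<sigma> "- b / A"]
    by (intro has_bochner_integral_mult_right) (auto simp: has_bochner_integral_iff)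
  moreover have "(sqrt (pi / A) * exp (b^2 / A)) * normal_density (- b / A) \<sigma> x = exp (- A * x^2 - 2 * b * x)" for x
  proof -
    have "b^2 / A + - (x - - b / A)\<^sup>2 / (2 * \<sigma>\<^sup>2) = - A * x^2 - 2 * b * x"
    proof -
      have "(x - - b / A)\<^sup>2 / (2 * \<sigma>\<^sup>2) = A * (x + b / A)\<^sup>2" using A by (simp add: s(2))
      also have "\<dots> = A * x^2 + 2 * b * x + b^2 / A" using A by (simp add: power2_eq_square field_simps)
      finally show ?thesis by simp
    qed
    then have "exp (b^2 / A) * exp (- (x - - b / A)\<^sup>2 / (2 * \<sigma>\<^sup>2)) = exp (- A * x^2 - 2 * b * x)"
      by (simp only: exp_add[symmetric])
    moreover have "sqrt (2 * pi * \<sigma>\<^sup>2) = sqrt (pi / A)" by (simp add: s)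
    moreover have "sqrt (pi / A) \<noteq> 0" using A by simp
    ultimately show ?thesis by (simp add: normal_density_def)
  qed
  ultimately show ?thesis by simp
qed

lemma cgauss_laplace:
  assumes A: "A > 0"
  shows "has_bochner_integral lborel (\<lambda>g. exp (- A * (cmod g)^2 - 2 * Re (b * cnj g))) (pi / A * exp ((cmod b)^2 / A))"
proof -
  have "has_bochner_integral lborel
     (\<lambda>g. exp (- A * (Re g)^2 - 2 * Re b * Re g) * exp (- A * (Im g)^2 - 2 * Im b * Im g))
     ((sqrt (pi / A) * exp ((Re b)^2 / A)) * (sqrt (pi / A) * exp ((Im b)^2 / A)))"
    by (rule has_bochner_integral_complex_product[OF gauss_laplace_real[OF A] gauss_laplace_real[OF A]])
  moreover have "exp (- A * (Re g)^2 - 2 * Re b * Re g) * exp (- A * (Im g)^2 - 2 * Im b * Im g)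
     = exp (- A * (cmod g)^2 - 2 * Re (b * cnj g))" for g
    by (simp add: cmod_power2 algebra_simps flip: exp_add)
  moreover have "(sqrt (pi / A) * exp ((Re b)^2 / A)) * (sqrt (pi / A) * exp ((Im b)^2 / A)) = pi / A * exp ((cmod b)^2 / A)"
  proof -
    have "(sqrt (pi / A) * exp ((Re b)^2 / A)) * (sqrt (pi / A) * exp ((Im b)^2 / A))
        = (sqrt (pi / A) * sqrt (pi / A)) * (exp ((Re b)^2 / A) * exp ((Im b)^2 / A))" by (simp only: mult_ac)
    also have "sqrt (pi / A) * sqrt (pi / A) = pi / A" using A by (subst real_sqrt_mult_self) simp
    finally show ?thesis by (simp add: cmod_power2 add_divide_distrib exp_add)
  qed
  ultimately show ?thesis by simp
qed

abbreviation cgauss :: "complex measure" where "cgauss \<equiv> density lborel std_cgauss_density"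

lemma std_cgauss_measurable[measurable]: "std_cgauss_density \<in> borel_measurable borel"
  unfolding std_cgauss_density_def by measurable

lemma cgauss_alt: "cgauss = density lborel (\<lambda>z. ennreal (exp (- ((cmod z)^2)) / pi))"
  by (simp add: std_cgauss_density_def[abs_def])

lemma prob_space_cgauss: "prob_space cgauss"
proof
  have h: "has_bochner_integral lborel (\<lambda>z. exp (- ((cmod z)^2)) / pi) (pi / pi)"
    using cgauss_laplace[of 1 0] by (intro has_bochner_integral_divide) auto
  have "emeasure cgauss UNIV = (\<integral>\<^sup>+ z. ennreal (exp (- ((cmod z)^2)) / pi) \<partial>lborel)"
    unfolding cgauss_alt by (subst emeasure_density) auto
  also have "\<dots> = 1" using h by (subst nn_integral_eq_integral) (auto simp: has_bochner_integral_iff)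
  finally show "emeasure cgauss (space cgauss) = 1" by simp
qed

lemma cgauss_char: "(LINT g|cgauss. exp (\<i> * of_real (2 * Re (w * cnj g)))) = complex_of_real (exp (- ((cmod w)^2)))"
  using cgauss_fourier[of w] unfolding cgauss_alt
  by (subst integral_density) (auto simp: has_bochner_integral_iff scaleR_conv_of_real)

lemma cgauss_exp:
  assumes A: "A > -1"
  shows "(LINT g|cgauss. exp (- A * (cmod g)^2 - 2 * Re (b * cnj g))) = exp ((cmod b)^2 / (1 + A)) / (1 + A)"
proof -
  have "has_bochner_integral lborel (\<lambda>g. 1 / pi * exp (- (1 + A) * (cmod g)^2 - 2 * Re (b * cnj g))) (1 / pi * (pi / (1 + A) * exp ((cmod b)^2 / (1 + A))))"
    using A by (intro has_bochner_integral_mult_right cgauss_laplace) auto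
  moreover have "1 / pi * exp (- (1 + A) * (cmod g)^2 - 2 * Re (b * cnj g)) = exp (- ((cmod g)^2)) / pi * exp (- A * (cmod g)^2 - 2 * Re (b * cnj g))" for g
    by (simp add: algebra_simps flip: exp_add)
  ultimately show ?thesis unfolding cgauss_alt
    by (subst integral_density) (auto simp: has_bochner_integral_iff)
qed

text \<open>Integrating out \<open>h\<close> leaves \<open>exp (- D * \<bar>g\<bar>\<^sup>2)\<close>
  with the Schur complement \<open>D\<close> of the quadratic form, and
  \<open>(1 + D) * (1 + u * B)\<close> is the determinant in the denominator. The Cauchy-Schwarz
  condition on \<open>\<theta>\<close> makes \<open>D\<close> nonnegative.\<close>

lemma cgauss_double:
  fixes \<theta> :: complex
  assumes "t \<ge> 0" "u \<ge> 0" "A \<ge> 0" "B \<ge> 0" "(cmod \<theta>)^2 \<le> A * B"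
  shows "(LINT g|cgauss. LINT h|cgauss. exp (- (t * A * (cmod g)^2 + u * B * (cmod h)^2 + 2 * Re (sqrt t * sqrt u * \<theta> * cnj g * h))))
    = 1 / ((1 + t * A) * (1 + u * B) - t * u * (cmod \<theta>)^2)"
proof -
  define D where "D = t * A - t * u * (cmod \<theta>)^2 / (1 + u * B)"
  have p: "t * A \<ge> 0" "u * B \<ge> 0" using assms by auto
  have "t * u * (cmod \<theta>)^2 \<le> t * u * (A * B)" using assms by (intro mult_left_mono) auto
  also have "\<dots> \<le> t * A * (1 + u * B)" using p by (simp add: algebra_simps)
  finally have D: "D \<ge> 0" using p by (simp add: D_def field_simps)
  have "(LINT h|cgauss. exp (- (t * A * (cmod g)^2 + u * B * (cmod h)^2 + 2 * Re (sqrt t * sqrt u * \<theta> * cnj g * h))))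
      = exp (- D * (cmod g)^2) / (1 + u * B)" for g
  proof -
    define b where "b = sqrt t * sqrt u * cnj \<theta> * g"
    have re: "Re (sqrt t * sqrt u * \<theta> * cnj g * h) = Re (b * cnj h)" for h
      unfolding b_def by (subst cnj.simps(1)[of "_ * h", symmetric]) (simp add: mult_ac)
    have nb: "(cmod b)^2 = t * u * (cmod \<theta>)^2 * (cmod g)^2"
      using assms by (simp add: b_def norm_mult power_mult_distrib)
    have "(LINT h|cgauss. exp (- (t * A * (cmod g)^2 + u * B * (cmod h)^2 + 2 * Re (sqrt t * sqrt u * \<theta> * cnj g * h))))
        = (LINT h|cgauss. exp (- t * A * (cmod g)^2) * exp (- (u * B) * (cmod h)^2 - 2 * Re (b * cnj h)))"
      unfolding re exp_add[symmetric]
      by (intro Bochner_Integration.integral_cong refl arg_cong[where f=exp]) (simp add: algebra_simps)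
    also have "\<dots> = exp (- t * A * (cmod g)^2) * (exp ((cmod b)^2 / (1 + u * B)) / (1 + u * B))"
      using p by (subst integral_mult_right_zero, subst cgauss_exp) auto
    also have "\<dots> = exp (- D * (cmod g)^2) / (1 + u * B)"
      by (simp add: D_def nb algebra_simps flip: exp_add)
    finally show ?thesis .
  qed
  then have "(LINT g|cgauss. LINT h|cgauss. exp (- (t * A * (cmod g)^2 + u * B * (cmod h)^2 + 2 * Re (sqrt t * sqrt u * \<theta> * cnj g * h))))
     = (LINT g|cgauss. exp (- D * (cmod g)^2 - 2 * Re (0 * cnj g))) / (1 + u * B)" by simp
  also have "\<dots> = 1 / (1 + D) / (1 + u * B)" using D by (subst cgauss_exp) auto
  also have "(1 + D) * (1 + u * B) = (1 + t * A) * (1 + u * B) - t * u * (cmod \<theta>)^2"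
    using p by (simp add: D_def field_simps)
  then have "1 / (1 + D) / (1 + u * B) = 1 / ((1 + t * A) * (1 + u * B) - t * u * (cmod \<theta>)^2)" by simp
  finally show ?thesis .
qed

section \<open>Laplace transforms of Gaussian series\<close>

definition fourier_kernel :: "complex \<Rightarrow> complex \<Rightarrow> complex" where
  "fourier_kernel v z = exp (\<i> * of_real (2 * Re (v * cnj z)))"

lemma fourier_kernel_measurable[measurable (raw)]:
  assumes [measurable]: "f \<in> borel_measurable K" "g \<in> borel_measurable K"
  shows "(\<lambda>p. fourier_kernel (f p) (g p)) \<in> borel_measurable K"
  by (simp add: fourier_kernel_def)

locale gauss_seq = prob_space M for M :: "'w measure" +
  fixes a :: "nat \<Rightarrow> 'w \<Rightarrow> complex"
  assumes indep: "indep_vars (\<lambda>_. borel) a UNIV"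
    and dist: "\<And>n. distributed M lborel (a n) std_cgauss_density"
begin

lemma a_measurable[measurable]: "a n \<in> borel_measurable M"
  using distributed_measurable[OF dist[of n]] by simp

lemma a_integral:
  fixes f :: "complex \<Rightarrow> 'b::{banach, second_countable_topology}"
  assumes "f \<in> borel_measurable borel"
  shows "(LINT w|M. f (a n w)) = (LINT g|cgauss. f g)"
  unfolding distributed_distr_eq_density[OF dist[of n], symmetric]
  using assms by (subst integral_distr) auto

lemma finite_fourier:
  "(LINT w|M. exp (\<i> * of_real (2 * Re (\<Sum>n<N. c n * a n w)))) = complex_of_real (exp (- (\<Sum>n<N. (cmod (c n))\<^sup>2)))"
proof -
  define F where "F = (\<lambda>n z. exp (\<i> * complex_of_real (2 * Re (c n * z))))"
  have [measurable]: "F n \<in> borel_measurable borel" for n unfolding F_def by measurable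
  have "(LINT w|M. exp (\<i> * of_real (2 * Re (\<Sum>n<N. c n * a n w)))) = (LINT w|M. (\<Prod>n<N. F n (a n w)))"
    by (simp add: F_def sum_distrib_left flip: exp_sum)
  also have "\<dots> = (\<Prod>n<N. LINT w|M. F n (a n w))"
  proof (rule indep_vars_lebesgue_integral)
    show "indep_vars (\<lambda>_. borel) (\<lambda>n w. F n (a n w)) {..<N}"
      by (rule indep_vars_compose2[OF indep_vars_subset[OF indep]]) auto
    show "integrable M (\<lambda>w. F n (a n w))" for n
      by (rule integrable_const_bound[of _ 1]) (auto simp: F_def)
  qed simp
  also have "\<dots> = (\<Prod>n<N. complex_of_real (exp (- ((cmod (c n))\<^sup>2))))"
  proof (rule prod.cong[OF refl])
    fix n
    have "(LINT w|M. F n (a n w)) = (LINT g|cgauss. F n g)" by (rule a_integral) simp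
    also have "\<dots> = complex_of_real (exp (- ((cmod (c n))\<^sup>2)))"
      using cgauss_char[of "cnj (c n)"] by (simp add: F_def)
    finally show "(LINT w|M. F n (a n w)) = complex_of_real (exp (- ((cmod (c n))\<^sup>2)))" .
  qed
  also have "\<dots> = complex_of_real (exp (- (\<Sum>n<N. (cmod (c n))\<^sup>2)))"
    by (simp add: exp_sum sum_negf[symmetric] del: sum_negf)
  finally show ?thesis .
qed

text \<open>Each factor \<open>exp (- \<bar>w\<bar>\<^sup>2)\<close> is written as an average of characters \<open>exp (2 \<i> Re (w cnj g))\<close> over an auxiliary
  Gaussian \<open>g\<close>; this makes the expectation over \<open>a\<close> factorise.\<close>
lemma laplace_finite:
  fixes x y :: "nat \<Rightarrow> complex" and N :: nat
  assumes tu: "t \<ge> 0" "u \<ge> 0"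
  defines "A \<equiv> (\<Sum>n<N. (cmod (x n))\<^sup>2)" and "B \<equiv> (\<Sum>n<N. (cmod (y n))\<^sup>2)" and "\<theta> \<equiv> (\<Sum>n<N. x n * cnj (y n))"
  shows "(LINT w|M. exp (- t * (cmod (\<Sum>n<N. x n * a n w))\<^sup>2 - u * (cmod (\<Sum>n<N. y n * a n w))\<^sup>2))
    = 1 / ((1 + t * A) * (1 + u * B) - t * u * (cmod \<theta>)\<^sup>2)"
proof -
  interpret C: prob_space cgauss by (rule prob_space_cgauss)
  interpret CC: pair_prob_space cgauss cgauss ..
  interpret MQ: pair_prob_space M "cgauss \<Otimes>\<^sub>M cgauss" ..
  define X Y where "X = (\<lambda>w. \<Sum>n<N. x n * a n w)" and "Y = (\<lambda>w. \<Sum>n<N. y n * a n w)"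
  have [measurable]: "X \<in> borel_measurable M" "Y \<in> borel_measurable M" unfolding X_def Y_def by auto
  have nE: "norm (fourier_kernel v z) = 1" for v z by (simp add: fourier_kernel_def)
  have step1: "complex_of_real (exp (- t * (cmod (X w))\<^sup>2 - u * (cmod (Y w))\<^sup>2))
      = (LINT p|(cgauss \<Otimes>\<^sub>M cgauss). fourier_kernel (sqrt t * X w) (fst p) * fourier_kernel (sqrt u * Y w) (snd p))" for w
  proof -
    have i: "integrable (cgauss \<Otimes>\<^sub>M cgauss) (\<lambda>p. fourier_kernel (sqrt t * X w) (fst p) * fourier_kernel (sqrt u * Y w) (snd p))"
      by (rule CC.integrable_const_bound[of _ 1]) (auto simp: norm_mult nE)
    have "(LINT p|(cgauss \<Otimes>\<^sub>M cgauss). fourier_kernel (sqrt t * X w) (fst p) * fourier_kernel (sqrt u * Y w) (snd p))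
       = (LINT g|cgauss. LINT h|cgauss. fourier_kernel (sqrt t * X w) g * fourier_kernel (sqrt u * Y w) h)"
      using CC.integral_fst'[OF i] by simp
    also have "\<dots> = (LINT g|cgauss. fourier_kernel (sqrt t * X w) g) * (LINT h|cgauss. fourier_kernel (sqrt u * Y w) h)"
      by simp
    also have "\<dots> = complex_of_real (exp (- ((cmod (sqrt t * X w))^2))) * complex_of_real (exp (- ((cmod (sqrt u * Y w))^2)))"
      unfolding fourier_kernel_def cgauss_char ..
    also have "\<dots> = complex_of_real (exp (- t * (cmod (X w))\<^sup>2 - u * (cmod (Y w))\<^sup>2))"
      using tu by (simp add: norm_mult power_mult_distrib flip: of_real_mult exp_add)
    finally show ?thesis by simp
  qed
  have iMQ: "integrable (M \<Otimes>\<^sub>M (cgauss \<Otimes>\<^sub>M cgauss)) (\<lambda>(w, p). fourier_kernel (sqrt t * X w) (fst p) * fourier_kernel (sqrt u * Y w) (snd p))"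
    by (rule MQ.integrable_const_bound[of _ 1]) (auto simp: norm_mult nE)
  \<comment> \<open>For fixed \<open>g\<close> and \<open>h\<close> the phase is one linear form in
    the variables \<open>a n\<close>; the sum of its squared coefficients is a quadratic form in
    \<open>g\<close> and \<open>h\<close> that depends on \<open>x\<close> and \<open>y\<close> only
    through \<open>A\<close>, \<open>B\<close> and \<open>\<theta>\<close>.\<close>
  have step3: "(LINT w|M. fourier_kernel (sqrt t * X w) g * fourier_kernel (sqrt u * Y w) h)
     = complex_of_real (exp (- (t * A * (cmod g)^2 + u * B * (cmod h)^2 + 2 * Re (sqrt t * sqrt u * \<theta> * cnj g * h))))" for g h
  proof -
    define c where "c = (\<lambda>n. sqrt t * x n * cnj g + sqrt u * y n * cnj h)"
    have "fourier_kernel (sqrt t * X w) g * fourier_kernel (sqrt u * Y w) h = exp (\<i> * of_real (2 * Re (\<Sum>n<N. c n * a n w)))" for w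
    proof -
      have "(\<Sum>n<N. c n * a n w) = sqrt t * X w * cnj g + sqrt u * Y w * cnj h"
        by (simp add: c_def X_def Y_def sum_distrib_left sum_distrib_right sum.distrib algebra_simps)
      then show ?thesis unfolding fourier_kernel_def exp_add[symmetric] by (intro arg_cong[where f=exp]) (simp add: algebra_simps)
    qed
    then have "(LINT w|M. fourier_kernel (sqrt t * X w) g * fourier_kernel (sqrt u * Y w) h) = complex_of_real (exp (- (\<Sum>n<N. (cmod (c n))\<^sup>2)))"
      using finite_fourier[of c N] by simp
    also have "(\<Sum>n<N. (cmod (c n))\<^sup>2) = t * A * (cmod g)^2 + u * B * (cmod h)^2 + 2 * Re (sqrt t * sqrt u * \<theta> * cnj g * h)"
    proof -
      have "(cmod (c n))\<^sup>2 = t * (cmod g)^2 * (cmod (x n))^2 + u * (cmod h)^2 * (cmod (y n))^2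
          + 2 * Re (sqrt t * sqrt u * cnj g * h * (x n * cnj (y n)))" for n
      proof -
        have *: "(cmod (p + q))^2 = (cmod p)^2 + (cmod q)^2 + 2 * Re (p * cnj q)" for p q
          unfolding cmod_power2 by (simp add: power2_eq_square algebra_simps)
        have "2 * Re (sqrt t * x n * cnj g * cnj (sqrt u * y n * cnj h)) = 2 * Re (sqrt t * sqrt u * cnj g * h * (x n * cnj (y n)))"
          by (intro arg_cong[where f="\<lambda>z. 2 * Re z"]) simp
        then show ?thesis unfolding c_def * using tu by (simp add: norm_mult power_mult_distrib)
      qed
      then have "(\<Sum>n<N. (cmod (c n))\<^sup>2) = t * (cmod g)^2 * A + u * (cmod h)^2 * B
          + 2 * Re (sqrt t * sqrt u * cnj g * h * \<theta>)"
        unfolding A_def B_def \<theta>_def sum_distrib_left Re_sum by (simp only: sum.distrib)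
      then show ?thesis by (simp add: mult_ac)
    qed
    finally show ?thesis .
  qed
  have CS: "(cmod \<theta>)^2 \<le> A * B"
  proof -
    have "cmod \<theta> \<le> (\<Sum>n<N. cmod (x n) * cmod (y n))"
      unfolding \<theta>_def by (rule order_trans[OF norm_sum]) (simp add: norm_mult)
    then have "(cmod \<theta>)^2 \<le> (\<Sum>n<N. cmod (x n) * cmod (y n))^2" by (intro power_mono) auto
    also have "\<dots> \<le> A * B" unfolding A_def B_def by (rule Cauchy_Schwarz_ineq_sum)
    finally show ?thesis .
  qed
  have AB: "A \<ge> 0" "B \<ge> 0" unfolding A_def B_def by (auto intro: sum_nonneg)
  let ?R = "\<lambda>g h. exp (- (t * A * (cmod g)^2 + u * B * (cmod h)^2 + 2 * Re (sqrt t * sqrt u * \<theta> * cnj g * h)))"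
  \<comment> \<open>\<open>?R g h\<close> is a mean of unimodular numbers, which bounds it without
    any estimate of the quadratic form.\<close>
  have Rle: "\<bar>?R g h\<bar> \<le> 1" for g h
  proof -
    have "cmod (complex_of_real (?R g h)) \<le> (LINT w|M. norm (fourier_kernel (sqrt t * X w) g * fourier_kernel (sqrt u * Y w) h))"
      unfolding step3[symmetric] by (rule integral_norm_bound)
    also have "\<dots> = 1" by (simp add: norm_mult nE prob_space)
    finally show ?thesis by (simp only: norm_of_real)
  qed
  have iR: "integrable (cgauss \<Otimes>\<^sub>M cgauss) (\<lambda>p. ?R (fst p) (snd p))"
    using Rle by (intro CC.integrable_const_bound[of _ 1]) auto
  have "complex_of_real (LINT w|M. exp (- t * (cmod (X w))\<^sup>2 - u * (cmod (Y w))\<^sup>2))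
      = (LINT w|M. complex_of_real (exp (- t * (cmod (X w))\<^sup>2 - u * (cmod (Y w))\<^sup>2)))"
    by simp
  also have "\<dots> = (LINT w|M. LINT p|(cgauss \<Otimes>\<^sub>M cgauss). fourier_kernel (sqrt t * X w) (fst p) * fourier_kernel (sqrt u * Y w) (snd p))"
    unfolding step1 ..
  also have "\<dots> = (LINT p|(cgauss \<Otimes>\<^sub>M cgauss). LINT w|M. fourier_kernel (sqrt t * X w) (fst p) * fourier_kernel (sqrt u * Y w) (snd p))"
    by (rule MQ.Fubini_integral[OF iMQ, symmetric])
  also have "\<dots> = (LINT p|(cgauss \<Otimes>\<^sub>M cgauss). complex_of_real (?R (fst p) (snd p)))"
    unfolding step3 ..
  also have "\<dots> = complex_of_real (LINT p|(cgauss \<Otimes>\<^sub>M cgauss). ?R (fst p) (snd p))"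
    by simp
  also have "(LINT p|(cgauss \<Otimes>\<^sub>M cgauss). ?R (fst p) (snd p)) = (LINT g|cgauss. LINT h|cgauss. ?R g h)"
    using CC.integral_fst'[OF iR] by simp
  also have "\<dots> = 1 / ((1 + t * A) * (1 + u * B) - t * u * (cmod \<theta>)\<^sup>2)"
    by (rule cgauss_double[OF tu AB CS])
  finally show ?thesis unfolding X_def Y_def of_real_eq_iff .
qed

text \<open>The exponentials are bounded by 1, so almost sure convergence of the partial sums
  suffices to pass to the limit in the finite formula.\<close>

lemma laplace_limit:
  fixes x y :: "nat \<Rightarrow> complex"
  assumes tu: "t \<ge> 0" "u \<ge> 0"
    and x: "(\<lambda>n. (cmod (x n))\<^sup>2) sums 1" and y: "(\<lambda>n. (cmod (y n))\<^sup>2) sums 1"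
    and th: "(\<lambda>n. x n * cnj (y n)) sums \<theta>"
    and X: "AE w in M. (\<lambda>n. x n * a n w) sums X w" and Y: "AE w in M. (\<lambda>n. y n * a n w) sums Y w"
    and XM[measurable]: "X \<in> borel_measurable M" "Y \<in> borel_measurable M"
  shows "(LINT w|M. exp (- t * (cmod (X w))\<^sup>2 - u * (cmod (Y w))\<^sup>2)) = 1 / ((1 + t) * (1 + u) - t * u * (cmod \<theta>)\<^sup>2)"
    and "cmod \<theta> \<le> 1"
proof -
  have AB: "A_N \<le> 1" if "A_N = (\<Sum>n<N. (cmod (z n))\<^sup>2)" "(\<lambda>n. (cmod (z n))\<^sup>2) sums 1" for A_N N and z :: "nat \<Rightarrow> complex"
    using that sum_le_suminf[of "\<lambda>n. (cmod (z n))\<^sup>2" "{..<N}"] by (auto simp: sums_iff)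
  have "cmod (\<Sum>n<N. x n * cnj (y n)) \<le> 1" for N
  proof -
    have "cmod (\<Sum>n<N. x n * cnj (y n)) \<le> (\<Sum>n<N. cmod (x n) * cmod (y n))"
      by (rule order_trans[OF norm_sum]) (simp add: norm_mult)
    also have "\<dots> \<le> (\<Sum>n<N. ((cmod (x n))\<^sup>2 + (cmod (y n))\<^sup>2) / 2)"
    proof (rule sum_mono)
      fix n show "cmod (x n) * cmod (y n) \<le> ((cmod (x n))\<^sup>2 + (cmod (y n))\<^sup>2) / 2"
        using sum_squares_bound[of "cmod (x n)" "cmod (y n)"] by simp
    qed
    also have "\<dots> \<le> 1"
      using AB[OF refl x, of N] AB[OF refl y, of N] by (simp add: sum.distrib flip: sum_divide_distrib)
    finally show ?thesis .
  qed
  moreover have "(\<lambda>N. cmod (\<Sum>n<N. x n * cnj (y n))) \<longlonglongrightarrow> cmod \<theta>"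
    using th by (intro tendsto_norm) (simp add: sums_def)
  ultimately show th1: "cmod \<theta> \<le> 1" by (intro LIMSEQ_le_const2) auto
  have th2: "(cmod \<theta>)\<^sup>2 \<le> 1" using th1 by (simp add: power_le_one)
  have "t * u * (cmod \<theta>)\<^sup>2 \<le> t * u * 1" using tu th2 by (intro mult_left_mono) auto
  \<comment> \<open>Since \<open>\<bar>\<theta>\<bar> \<le> 1\<close>, the denominator is at least
    \<open>1 + t + u\<close>.\<close>
  then have ne: "(1 + t * 1) * (1 + u * 1) - t * u * (cmod \<theta>)\<^sup>2 \<noteq> 0" using tu by (simp add: algebra_simps)
  have "(\<lambda>N. LINT w|M. exp (- t * (cmod (\<Sum>n<N. x n * a n w))\<^sup>2 - u * (cmod (\<Sum>n<N. y n * a n w))\<^sup>2))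
     \<longlonglongrightarrow> (LINT w|M. exp (- t * (cmod (X w))\<^sup>2 - u * (cmod (Y w))\<^sup>2))"
  proof (rule integral_dominated_convergence)
    show "integrable M (\<lambda>_. 1::real)" by simp
    show "AE w in M. (\<lambda>N. exp (- t * (cmod (\<Sum>n<N. x n * a n w))\<^sup>2 - u * (cmod (\<Sum>n<N. y n * a n w))\<^sup>2))
        \<longlonglongrightarrow> exp (- t * (cmod (X w))\<^sup>2 - u * (cmod (Y w))\<^sup>2)"
      using X Y by eventually_elim (auto simp: sums_def intro!: tendsto_intros)
    have "- t * p\<^sup>2 - u * q\<^sup>2 \<le> 0" for p q :: real
    proof -
      have "0 \<le> t * p\<^sup>2" "0 \<le> u * q\<^sup>2" using tu by simp_all
      then show ?thesis unfolding mult_minus_left by linarith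
    qed
    then show "AE w in M. norm (exp (- t * (cmod (\<Sum>n<N. x n * a n w))\<^sup>2 - u * (cmod (\<Sum>n<N. y n * a n w))\<^sup>2)) \<le> 1" for N
      by simp
  qed simp_all
  moreover have "(\<lambda>N. 1 / ((1 + t * (\<Sum>n<N. (cmod (x n))\<^sup>2)) * (1 + u * (\<Sum>n<N. (cmod (y n))\<^sup>2)) - t * u * (cmod (\<Sum>n<N. x n * cnj (y n)))\<^sup>2))
     \<longlonglongrightarrow> 1 / ((1 + t * 1) * (1 + u * 1) - t * u * (cmod \<theta>)\<^sup>2)"
    by (intro tendsto_divide tendsto_diff tendsto_mult tendsto_add tendsto_const tendsto_power tendsto_norm
        x[unfolded sums_def] y[unfolded sums_def] th[unfolded sums_def] ne)
  ultimately show "(LINT w|M. exp (- t * (cmod (X w))\<^sup>2 - u * (cmod (Y w))\<^sup>2)) = 1 / ((1 + t) * (1 + u) - t * u * (cmod \<theta>)\<^sup>2)"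
    unfolding laplace_finite[OF tu] mult_1_right by (rule LIMSEQ_unique)
qed

text \<open>Both kernels are centred, so only \<open>1 / W - 1 / Z = t * u *
  \<bar>\<theta>\<bar>\<^sup>2 / (Z * W)\<close> survives, and its factor \<open>t * u\<close>
  cancels the divisions by \<open>t\<close> and \<open>u\<close> in the kernels. The bound
  \<open>W \<ge> sqrt Z\<close> then separates the variables and produces the exponent 3/2.\<close>

lemma logker_cov:
  fixes x y :: "nat \<Rightarrow> complex"
  assumes tu: "t > 0" "u > 0"
    and x: "(\<lambda>n. (cmod (x n))\<^sup>2) sums 1" and y: "(\<lambda>n. (cmod (y n))\<^sup>2) sums 1"
    and th: "(\<lambda>n. x n * cnj (y n)) sums \<theta>"
    and X: "AE w in M. (\<lambda>n. x n * a n w) sums X w" and Y: "AE w in M. (\<lambda>n. y n * a n w) sums Y w"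
    and XM[measurable]: "X \<in> borel_measurable M" "Y \<in> borel_measurable M"
  shows "(LINT w|M. logker t ((cmod (X w))\<^sup>2) * logker u ((cmod (Y w))\<^sup>2))
     \<le> (cmod \<theta>)\<^sup>2 * ((1 + t) powr (- (3/2)) * (1 + u) powr (- (3/2)))"
proof -
  define e1 e2 where "e1 = (\<lambda>w. exp (- t * (cmod (X w))\<^sup>2))" and "e2 = (\<lambda>w. exp (- u * (cmod (Y w))\<^sup>2))"
  have [measurable]: "e1 \<in> borel_measurable M" "e2 \<in> borel_measurable M" unfolding e1_def e2_def by auto
  have b: "\<bar>e1 w\<bar> \<le> 1" "\<bar>e2 w\<bar> \<le> 1" for w using tu by (auto simp: e1_def e2_def)
  have i: "integrable M e1" "integrable M e2" "integrable M (\<lambda>w. e1 w * e2 w)"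
  proof -
    have "\<bar>e1 w * e2 w\<bar> \<le> 1" for w unfolding abs_mult using b by (intro mult_le_one) auto
    then show "integrable M e1" "integrable M e2" "integrable M (\<lambda>w. e1 w * e2 w)"
      using b by (auto intro!: integrable_const_bound[of _ 1])
  qed
  have L: "(LINT w|M. exp (- t' * (cmod (X w))\<^sup>2 - u' * (cmod (Y w))\<^sup>2)) = 1 / ((1 + t') * (1 + u') - t' * u' * (cmod \<theta>)\<^sup>2)"
    if "t' \<ge> 0" "u' \<ge> 0" for t' u'
    by (rule laplace_limit(1)[OF that x y th X Y XM])
  have I1: "integral\<^sup>L M e1 = 1 / (1 + t)" using L[of t 0] tu by (simp add: e1_def)
  have I2: "integral\<^sup>L M e2 = 1 / (1 + u)" using L[of 0 u] tu by (simp add: e2_def)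
  define Z where "Z = (1 + t) * (1 + u)"
  define W where "W = Z - t * u * (cmod \<theta>)\<^sup>2"
  have I12: "(LINT w|M. e1 w * e2 w) = 1 / W"
    using L[of t u] tu by (simp add: e1_def e2_def exp_diff exp_minus divide_inverse W_def Z_def)
  have "(LINT w|M. logker t ((cmod (X w))\<^sup>2) * logker u ((cmod (Y w))\<^sup>2))
      = (LINT w|M. (1 / (t * u)) * (1 / ((1 + t) * (1 + u)) - e2 w / (1 + t) - e1 w / (1 + u) + e1 w * e2 w))"
    by (intro Bochner_Integration.integral_cong refl)
       (simp add: logker_def e1_def e2_def diff_divide_distrib add_divide_distrib algebra_simps)
  also have "\<dots> = (1 / (t * u)) * (1 / W - 1 / Z)"
    using i tu by (simp add: I1 I2 I12 prob_space Z_def)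
  also have "\<dots> \<le> (cmod \<theta>)\<^sup>2 * (1 / (Z * sqrt Z))"
  proof -
    have "(cmod \<theta>)\<^sup>2 \<le> 1" using laplace_limit(2)[OF _ _ x y th X Y XM, of 0 0] by (simp add: power_le_one)
    then have "t * u * (cmod \<theta>)\<^sup>2 \<le> t * u * 1" using tu by (intro mult_left_mono) auto
    then have W1: "W \<ge> 1 + t + u" by (simp add: W_def Z_def algebra_simps)
    have Z0: "Z > 0" using tu by (simp add: Z_def)
    \<comment> \<open>Compares the coupled lower bound \<open>1 + t + u\<close> for \<open>W\<close>
      with the product \<open>Z = (1 + t) * (1 + u)\<close>.\<close>
    have "Z \<le> (1 + t + u)^2" using tu by (simp add: Z_def power2_eq_square algebra_simps)
    then have "sqrt Z \<le> 1 + t + u" using tu by (intro real_le_lsqrt) auto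
    then have W2: "W \<ge> sqrt Z" "W > 0" using W1 tu by auto
    have "(1 / (t * u)) * (1 / W - 1 / Z) = (cmod \<theta>)\<^sup>2 / (Z * W)"
      using tu W2 Z0 by (simp add: field_simps) (simp add: W_def algebra_simps)
    also have "\<dots> \<le> (cmod \<theta>)\<^sup>2 / (Z * sqrt Z)" using W2 Z0 by (intro divide_left_mono mult_left_mono) auto
    finally show ?thesis by simp
  qed
  also have "1 / (Z * sqrt Z) = (1 + t) powr (- (3/2)) * (1 + u) powr (- (3/2))"
  proof -
    have Z0: "Z > 0" using tu by (simp add: Z_def)
    have "1 / (Z * sqrt Z) = Z powr (- (3/2))"
    proof -
      have "Z powr (3/2) = Z powr (1 + 1/2)" by simp
      also have "\<dots> = Z powr 1 * Z powr (1/2)" by (rule powr_add)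
      also have "\<dots> = Z * sqrt Z" using Z0 by (simp only: powr_one powr_half_sqrt less_imp_le)
      finally have "Z powr (3/2) = Z * sqrt Z" .
      then show ?thesis by (simp only: powr_minus divide_inverse mult_1_left)
    qed
    then show ?thesis using tu by (simp add: Z_def powr_mult)
  qed
  finally show ?thesis .
qed

end

section \<open>Second moments of circle means\<close>

text \<open>Normalised arc length, with angles measured in turns. It lives on the whole line, so
  that measurability is that of \<open>borel\<close>.\<close>

definition circ :: "real measure" where "circ = uniform_measure lborel {0..1}"

lemma prob_space_circ: "prob_space circ"
  unfolding circ_def by (rule prob_space_uniform_measure) auto

lemma sets_circ[measurable_cong, simp]: "sets circ = sets borel" by (simp add: circ_def)
lemma space_circ[simp]: "space circ = UNIV" by (simp add: circ_def)

text \<open>The exponent exceeds 1, so the bound is uniform in \<open>n\<close>; this is what lets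
  the second-moment bound outlive the truncation.\<close>

lemma trunc_decay: "(LINT t|trunc n. (1 + t) powr (- (3/2))) \<le> 2"
proof -
  define e K where "e = 1 / real (Suc n)" and "K = real (Suc n)"
  have eK: "0 < e" "e \<le> K" by (auto simp: e_def K_def field_simps)
  have "((\<lambda>t. (1 + t) powr (- (3/2))) has_integral (- 2 * (1 + K) powr (- (1/2)) - (- 2 * (1 + e) powr (- (1/2))))) {e..K}"
  proof (rule fundamental_theorem_of_calculus[OF eK(2)])
    fix t assume "t \<in> {e..K}"
    then have t: "1 + t > 0" using eK by auto
    have "((\<lambda>t. - 2 * (1 + t) powr (- (1/2))) has_real_derivative (1 + t) powr (- (3/2))) (at t within {e..K})"
      using t by (auto intro!: derivative_eq_intros simp: powr_diff[symmetric])
    then show "((\<lambda>t. - 2 * (1 + t) powr (- (1/2))) has_vector_derivative (1 + t) powr (- (3/2))) (at t within {e..K})"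
      by (simp only: has_real_derivative_iff_has_vector_derivative)
  qed
  moreover have "continuous_on {e..K} (\<lambda>t. (1 + t) powr (- (3/2)))"
  proof (intro continuous_intros ballI)
    fix t assume "t \<in> {e..K}"
    then show "1 + t \<noteq> 0" using eK by auto
  qed
  ultimately have "(LINT t|trunc n. (1 + t) powr (- (3/2))) = - 2 * (1 + K) powr (- (1/2)) + 2 * (1 + e) powr (- (1/2))"
    using trunc_integral(2)[of n "\<lambda>t. (1 + t) powr (- (3/2))"] by (simp add: e_def K_def integral_unique)
  moreover have "(1 + e) powr (- (1/2)) \<le> 1" using eK powr_mono_both[of "-(1/2)" 0 1 "1+e"]
    by (simp add: powr_minus powr_half_sqrt) (simp add: inverse_le_1_iff)
  moreover have "(1 + K) powr (- (1/2)) \<ge> 0" by simp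
  ultimately show ?thesis by linarith
qed

context gauss_seq
begin

text \<open>The square of the mean is a double integral over pairs of an angle and a parameter
  \<open>t\<close>. After taking expectations inside, the covariance bound factors into
  \<open>T \<alpha> \<beta>\<close> and two decaying functions of the parameters. Each of these
  integrates to at most 2, and the angles contribute \<open>K\<close>.\<close>

lemma circle_second_moment:
  fixes x :: "real \<Rightarrow> nat \<Rightarrow> complex" and X :: "real \<Rightarrow> 'w \<Rightarrow> complex" and T :: "real \<Rightarrow> real \<Rightarrow> real"
  assumes x: "\<And>\<alpha>. (\<lambda>n. (cmod (x \<alpha> n))\<^sup>2) sums 1"
    and th: "\<And>\<alpha> \<beta>. (\<lambda>n. x \<alpha> n * cnj (x \<beta> n)) sums \<theta> \<alpha> \<beta>"
    and X: "\<And>\<alpha>. AE w in M. (\<lambda>n. x \<alpha> n * a n w) sums X \<alpha> w"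
    and XM: "(\<lambda>(w, \<alpha>). X \<alpha> w) \<in> borel_measurable (M \<Otimes>\<^sub>M borel)"
    and TM: "(\<lambda>(\<alpha>, \<beta>). T \<alpha> \<beta>) \<in> borel_measurable (borel \<Otimes>\<^sub>M borel)"
    and thT: "\<And>\<alpha> \<beta>. (cmod (\<theta> \<alpha> \<beta>))\<^sup>2 \<le> T \<alpha> \<beta>" and T1: "\<And>\<alpha> \<beta>. T \<alpha> \<beta> \<le> 1"
    and K: "\<And>\<alpha>. (LINT \<beta>|circ. T \<alpha> \<beta>) \<le> K"
  shows "(\<integral>\<^sup>+ w. ennreal ((LINT \<alpha>|circ. logapp n ((cmod (X \<alpha> w))\<^sup>2))\<^sup>2) \<partial>M) \<le> ennreal (4 * K)"
    and "(\<lambda>w. LINT \<alpha>|circ. logapp n ((cmod (X \<alpha> w))\<^sup>2)) \<in> borel_measurable M"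
proof -
  interpret N: prob_space circ by (rule prob_space_circ)
  interpret R: finite_measure "trunc n" by (rule finite_measure_trunc)
  interpret NR: pair_sigma_finite circ "trunc n" ..
  \<comment> \<open>Angle and parameter are bundled into one finite measure; every later use of
    Fubini concerns bounded functions on products of finite measures.\<close>
  define \<kappa> where "\<kappa> = circ \<Otimes>\<^sub>M trunc n"
  interpret k: finite_measure \<kappa> unfolding \<kappa>_def by (rule finite_measure_pair_measure) unfold_locales
  interpret kk: pair_sigma_finite \<kappa> \<kappa> ..
  interpret kkf: finite_measure "\<kappa> \<Otimes>\<^sub>M \<kappa>" by (rule finite_measure_pair_measure) unfold_locales
  interpret Mk: pair_sigma_finite M "\<kappa> \<Otimes>\<^sub>M \<kappa>" ..
  interpret Mkf: finite_measure "M \<Otimes>\<^sub>M (\<kappa> \<Otimes>\<^sub>M \<kappa>)" by (rule finite_measure_pair_measure) unfold_locales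
  note [measurable] = XM
  have tm[measurable]: "(\<lambda>t. t) \<in> borel_measurable (trunc n)" by (rule borel_measurable_trunc) simp
  have "snd \<in> measurable \<kappa> (trunc n)" unfolding \<kappa>_def by simp
  then have sm[measurable]: "snd \<in> borel_measurable \<kappa>" using measurable_comp[OF _ tm, of snd \<kappa>] by (simp add: comp_def)
  have fm[measurable]: "fst \<in> borel_measurable \<kappa>"
    using measurable_fst[of circ "trunc n"] by (simp add: \<kappa>_def measurable_cong_sets[OF refl sets_circ])
  have XM': "(\<lambda>p. X (f p) (g p)) \<in> borel_measurable L"
    if "f \<in> borel_measurable L" "g \<in> measurable L M" for f g and L :: "'x measure"
  proof -
    have "(\<lambda>p. (g p, f p)) \<in> measurable L (M \<Otimes>\<^sub>M borel)" using that by simp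
    from measurable_comp[OF this XM] show ?thesis by (simp add: comp_def)
  qed
  have XMa: "(\<lambda>w. X \<alpha> w) \<in> borel_measurable M" for \<alpha>
  proof -
    have "(\<lambda>p. (p, \<alpha>)) \<in> measurable M (M \<Otimes>\<^sub>M borel)" by simp
    from measurable_comp[OF this XM] show ?thesis by (simp add: comp_def)
  qed
  define G where "G = (\<lambda>w p. logker (snd p) ((cmod (X (fst p) w))\<^sup>2))"
  define F where "F = (\<lambda>w. LINT \<alpha>|circ. logapp n ((cmod (X \<alpha> w))\<^sup>2))"
  define h where "h = (\<lambda>t::real. (1 + t) powr (- (3/2)))"
  have h01: "0 \<le> h t" for t by (simp add: h_def)
  have h1: "h t \<le> 1" if "t \<in> space (trunc n)" for t
  proof -
    have "t > 0" using that by (auto simp: space_trunc intro: less_le_trans[of _ "1 / real (Suc n)"])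
    then have "(1 + t) powr (- (3/2)) \<le> (1 + t) powr 0" by (intro powr_mono) auto
    then show ?thesis using \<open>t > 0\<close> by (simp add: h_def)
  qed
  have hm[measurable]: "h \<in> borel_measurable borel" unfolding h_def by measurable
  have T0: "T \<alpha> \<beta> \<ge> 0" for \<alpha> \<beta> using thT[of \<alpha> \<beta>] by (meson order_trans zero_le_power2)
  have Gb: "\<bar>G w p\<bar> \<le> real (Suc n)" if "p \<in> space \<kappa>" for w p
    using that unfolding G_def \<kappa>_def by (intro logker_bound) (auto simp: space_pair_measure space_trunc)
  have Gm: "(\<lambda>(w, p). G w p) \<in> borel_measurable (M \<Otimes>\<^sub>M \<kappa>)"
    unfolding G_def case_prod_beta by (intro logker_measurable borel_measurable_power borel_measurable_norm XM') measurable
  have Gmw: "G w \<in> borel_measurable \<kappa>" if "w \<in> space M" for w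
  proof -
    have "(\<lambda>p. (w, p)) \<in> measurable \<kappa> (M \<Otimes>\<^sub>M \<kappa>)" using that by simp
    from measurable_comp[OF this Gm] show ?thesis by (simp add: comp_def)
  qed
  have Gi: "integrable \<kappa> (G w)" if "w \<in> space M" for w
    using Gb Gmw[OF that] by (intro k.integrable_const_bound[of _ "real (Suc n)"] AE_I2) auto
  have FG: "F w = (LINT p|\<kappa>. G w p)" if "w \<in> space M" for w
    using NR.integral_fst'[OF Gi[OF that, unfolded \<kappa>_def]] unfolding F_def \<kappa>_def logapp_def G_def by simp
  have "(\<lambda>w. LINT p|\<kappa>. G w p) \<in> borel_measurable M"
    by (rule k.borel_measurable_lebesgue_integral[OF Gm])
  then show Fm: "(\<lambda>w. LINT \<alpha>|circ. logapp n ((cmod (X \<alpha> w))\<^sup>2)) \<in> borel_measurable M"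
    unfolding F_def[symmetric] by (subst measurable_cong[OF FG])
  define G2 where "G2 = (\<lambda>w q. G w (fst q) * G w (snd q))"
  have G2b: "\<bar>G2 w q\<bar> \<le> real (Suc n) * real (Suc n)" if "q \<in> space (\<kappa> \<Otimes>\<^sub>M \<kappa>)" for w q
    using that Gb[of "fst q" w] Gb[of "snd q" w] unfolding G2_def abs_mult by (intro mult_mono) (auto simp: space_pair_measure)
  have G2m: "(\<lambda>(w, q). G2 w q) \<in> borel_measurable (M \<Otimes>\<^sub>M (\<kappa> \<Otimes>\<^sub>M \<kappa>))"
  proof -
    have 1: "(\<lambda>z. (fst z, fst (snd z))) \<in> measurable (M \<Otimes>\<^sub>M (\<kappa> \<Otimes>\<^sub>M \<kappa>)) (M \<Otimes>\<^sub>M \<kappa>)"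
      and 2: "(\<lambda>z. (fst z, snd (snd z))) \<in> measurable (M \<Otimes>\<^sub>M (\<kappa> \<Otimes>\<^sub>M \<kappa>)) (M \<Otimes>\<^sub>M \<kappa>)" by simp_all
    show ?thesis using borel_measurable_times[OF measurable_comp[OF 1 Gm] measurable_comp[OF 2 Gm]]
      by (simp add: comp_def G2_def case_prod_beta)
  qed
  have G2i: "integrable (M \<Otimes>\<^sub>M (\<kappa> \<Otimes>\<^sub>M \<kappa>)) (\<lambda>(w, q). G2 w q)"
    using G2b G2m by (intro Mkf.integrable_const_bound[of _ "real (Suc n) * real (Suc n)"] AE_I2) (auto simp: space_pair_measure)
  have F2: "(F w)\<^sup>2 = (LINT q|(\<kappa> \<Otimes>\<^sub>M \<kappa>). G2 w q)" if w: "w \<in> space M" for w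
  proof -
    have "(\<lambda>q. (w, q)) \<in> measurable (\<kappa> \<Otimes>\<^sub>M \<kappa>) (M \<Otimes>\<^sub>M (\<kappa> \<Otimes>\<^sub>M \<kappa>))" using w by simp
    from measurable_comp[OF this G2m] have "G2 w \<in> borel_measurable (\<kappa> \<Otimes>\<^sub>M \<kappa>)" by (simp add: comp_def)
    then have i: "integrable (\<kappa> \<Otimes>\<^sub>M \<kappa>) (G2 w)"
      using G2b by (intro kkf.integrable_const_bound[of _ "real (Suc n) * real (Suc n)"] AE_I2) auto
    have "(LINT q|(\<kappa> \<Otimes>\<^sub>M \<kappa>). G2 w q) = (LINT p|\<kappa>. LINT q|\<kappa>. G w p * G w q)"
      using kk.integral_fst'[OF i] by (simp add: G2_def)
    then show ?thesis by (simp add: FG[OF w] power2_eq_square)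
  qed
  have cov: "(LINT w|M. G2 w q) \<le> T (fst (fst q)) (fst (snd q)) * (h (snd (fst q)) * h (snd (snd q)))"
    if q: "q \<in> space (\<kappa> \<Otimes>\<^sub>M \<kappa>)" for q
  proof -
    have t: "snd (fst q) > 0" "snd (snd q) > 0"
      using q by (auto simp: \<kappa>_def space_pair_measure space_trunc intro: less_le_trans[of _ "1 / real (Suc n)"])
    have "(LINT w|M. G2 w q) \<le> (cmod (\<theta> (fst (fst q)) (fst (snd q))))\<^sup>2 * (h (snd (fst q)) * h (snd (snd q)))"
      unfolding G2_def G_def h_def by (rule logker_cov[OF t x x th X X XMa XMa])
    also have "\<dots> \<le> T (fst (fst q)) (fst (snd q)) * (h (snd (fst q)) * h (snd (snd q)))"
      using thT h01 by (intro mult_right_mono) auto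
    finally show ?thesis .
  qed
  define B where "B = (\<lambda>q. T (fst (fst q)) (fst (snd q)) * (h (snd (fst q)) * h (snd (snd q))))"
  have TMs: "(\<lambda>q. T (fst (fst q)) (fst (snd q))) \<in> borel_measurable (\<kappa> \<Otimes>\<^sub>M \<kappa>)"
  proof -
    have "(\<lambda>q. (fst (fst q), fst (snd q))) \<in> measurable (\<kappa> \<Otimes>\<^sub>M \<kappa>) (borel \<Otimes>\<^sub>M borel)" by measurable
    from measurable_comp[OF this TM] show ?thesis by (simp add: comp_def)
  qed
  have Bb: "\<bar>B q\<bar> \<le> 1" if "q \<in> space (\<kappa> \<Otimes>\<^sub>M \<kappa>)" for q
  proof -
    have "h (snd (fst q)) \<le> 1" "h (snd (snd q)) \<le> 1"
      using that by (auto simp: \<kappa>_def space_pair_measure intro!: h1)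
    then show ?thesis unfolding B_def abs_mult using T0 T1 h01 by (intro mult_le_one) (auto intro: mult_le_one)
  qed
  have Bm: "B \<in> borel_measurable (\<kappa> \<Otimes>\<^sub>M \<kappa>)"
    unfolding B_def by (intro borel_measurable_times TMs) measurable
  have Bi: "integrable (\<kappa> \<Otimes>\<^sub>M \<kappa>) B"
    using Bb Bm by (intro kkf.integrable_const_bound[of _ 1] AE_I2) auto
  have H: "(LINT t|trunc n. h t) \<le> 2" "0 \<le> (LINT t|trunc n. h t)"
    using trunc_decay[of n] h01 by (auto simp: h_def)
  have K0: "K \<ge> 0" using order_trans[OF Bochner_Integration.integral_nonneg K[of 0]] T0 by auto
  have inner: "(LINT q|\<kappa>. B (p, q)) \<le> h (snd p) * (2 * K)" for p
  proof -
    have i: "integrable \<kappa> (\<lambda>q. T (fst p) (fst q) * h (snd q))"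
    proof (rule k.integrable_const_bound[of _ 1])
      have "(\<lambda>q. (fst p, fst q)) \<in> measurable \<kappa> (borel \<Otimes>\<^sub>M borel)" by measurable
      from measurable_comp[OF this TM] show "(\<lambda>q. T (fst p) (fst q) * h (snd q)) \<in> borel_measurable \<kappa>"
        by (simp add: comp_def)
      show "AE q in \<kappa>. norm (T (fst p) (fst q) * h (snd q)) \<le> 1"
      proof (rule AE_I2)
        fix q assume "q \<in> space \<kappa>"
        then have "h (snd q) \<le> 1" by (intro h1) (auto simp: \<kappa>_def space_pair_measure)
        then show "norm (T (fst p) (fst q) * h (snd q)) \<le> 1"
          using T0 T1 h01 by (auto simp: abs_mult intro!: mult_le_one)
      qed
    qed
    have "(LINT q|\<kappa>. T (fst p) (fst q) * h (snd q)) = (LINT \<beta>|circ. LINT u|trunc n. T (fst p) \<beta> * h u)"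
      using NR.integral_fst'[OF i[unfolded \<kappa>_def]] by (simp add: \<kappa>_def)
    also have "\<dots> = (LINT \<beta>|circ. T (fst p) \<beta>) * (LINT u|trunc n. h u)" by simp
    also have "\<dots> \<le> K * 2" using K H K0 by (intro mult_mono) auto
    finally have "h (snd p) * (LINT q|\<kappa>. T (fst p) (fst q) * h (snd q)) \<le> h (snd p) * (2 * K)"
      using h01 by (intro mult_left_mono) auto
    moreover have "(LINT q|\<kappa>. B (p, q)) = (LINT q|\<kappa>. h (snd p) * (T (fst p) (fst q) * h (snd q)))"
      by (simp add: B_def mult_ac)
    ultimately show ?thesis by simp
  qed
  have hki: "integrable \<kappa> (\<lambda>p. h (snd p))"
    by (rule k.integrable_const_bound[of _ 1]) (use h1 h01 in \<open>auto intro!: AE_I2 simp: \<kappa>_def space_pair_measure\<close>)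
  have "(LINT w|M. (F w)\<^sup>2) = (LINT w|M. LINT q|(\<kappa> \<Otimes>\<^sub>M \<kappa>). G2 w q)"
    using F2 by (intro Bochner_Integration.integral_cong) auto
  also have "\<dots> = (LINT q|(\<kappa> \<Otimes>\<^sub>M \<kappa>). LINT w|M. G2 w q)"
    by (rule Mk.Fubini_integral[OF G2i, symmetric])
  also have "\<dots> \<le> (LINT q|(\<kappa> \<Otimes>\<^sub>M \<kappa>). B q)"
    using Mk.integrable_snd[OF G2i] Bi cov unfolding B_def by (intro integral_mono) auto
  also have "\<dots> = (LINT p|\<kappa>. LINT q|\<kappa>. B (p, q))" using kk.integral_fst'[OF Bi] by simp
  also have "\<dots> \<le> (LINT p|\<kappa>. h (snd p) * (2 * K))"
    using kk.integrable_fst'[OF Bi] hki inner by (intro integral_mono) auto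
  also have "\<dots> = (LINT p|\<kappa>. h (snd p)) * (2 * K)" by simp
  also have "(LINT p|\<kappa>. h (snd p)) = (LINT t|trunc n. h t)"
    using NR.integral_fst'[OF hki[unfolded \<kappa>_def]] by (simp add: \<kappa>_def N.prob_space[simplified])
  also have "\<dots> * (2 * K) \<le> 2 * (2 * K)" using H K0 by (intro mult_right_mono) auto
  finally have fin: "(LINT w|M. (F w)\<^sup>2) \<le> 4 * K" by simp
  \<comment> \<open>This crude bound depends on \<open>n\<close> and serves only for integrability,
    in order to restate the estimate for the nonnegative integral needed by Fatou's lemma.\<close>
  have Fb: "\<bar>(F w)\<^sup>2\<bar> \<le> (real (Suc n) * measure \<kappa> (space \<kappa>))\<^sup>2" if "w \<in> space M" for w
  proof -
    have "\<bar>F w\<bar> \<le> (LINT p|\<kappa>. \<bar>G w p\<bar>)" unfolding FG[OF that] by (rule integral_abs_bound)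
    also have "\<dots> \<le> (LINT p|\<kappa>. real (Suc n))"
      using Gb Gi[OF that] by (intro integral_mono) (auto simp del: of_nat_Suc)
    also have "\<dots> = real (Suc n) * measure \<kappa> (space \<kappa>)" by (simp add: mult.commute)
    finally show ?thesis by (metis abs_ge_zero abs_power2 power2_abs power_mono)
  qed
  have "integrable M (\<lambda>w. (F w)\<^sup>2)"
    using Fb Fm unfolding F_def[symmetric] by (intro integrable_const_bound[of _ "(real (Suc n) * measure \<kappa> (space \<kappa>))\<^sup>2"] AE_I2) auto
  then have "(\<integral>\<^sup>+ w. ennreal ((F w)\<^sup>2) \<partial>M) = ennreal (LINT w|M. (F w)\<^sup>2)"
    by (rule nn_integral_eq_integral) auto
  also have "\<dots> \<le> ennreal (4 * K)" using fin by (rule ennreal_leI)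
  finally show "(\<integral>\<^sup>+ w. ennreal ((LINT \<alpha>|circ. logapp n ((cmod (X \<alpha> w))\<^sup>2))\<^sup>2) \<partial>M) \<le> ennreal (4 * K)"
    unfolding F_def .
qed

end

section \<open>Logarithmic means on circles\<close>

definition cpt :: "real \<Rightarrow> real \<Rightarrow> complex" where
  "cpt r t = of_real r * exp (2 * of_real pi * \<i> * of_real t)"

lemma norm_cpt[simp]: "cmod (cpt r t) = \<bar>r\<bar>"
proof -
  have "cmod (exp (2 * of_real pi * \<i> * of_real t)) = 1" by simp
  then show ?thesis by (simp add: cpt_def norm_mult del: norm_exp_eq_Re)
qed

lemma continuous_cpt: "continuous_on A (cpt r)"
  unfolding cpt_def by (intro continuous_intros)

lemma cpt_measurable[measurable]: "cpt r \<in> borel_measurable borel"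
  by (intro borel_measurable_continuous_onI continuous_cpt)

lemma circ_alt: "circ = density lborel (\<lambda>x. ennreal (indicator {0..1} x))"
  unfolding circ_def uniform_measure_def by (intro arg_cong2[where f=density] refl ext) (simp add: indicator_def)

lemma circ_integrable_iff:
  fixes f :: "real \<Rightarrow> 'a::{banach, second_countable_topology}"
  assumes "f \<in> borel_measurable borel"
  shows "integrable circ f \<longleftrightarrow> set_integrable lborel {0..1} f"
  unfolding circ_alt set_integrable_def using assms by (subst integrable_density) auto

lemma circ_integral:
  fixes f :: "real \<Rightarrow> 'a::{banach, second_countable_topology}"
  assumes "f \<in> borel_measurable borel"
  shows "(LINT t|circ. f t) = (LINT t:{0..1}|lborel. f t)"
  unfolding circ_alt set_lebesgue_integral_def using assms by (subst integral_density) auto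

lemma circ_integrable_continuous:
  fixes f :: "real \<Rightarrow> 'a::{banach, second_countable_topology}"
  assumes "continuous_on UNIV f"
  shows "integrable circ f"
proof -
  have "set_integrable lborel {0..1} f" by (intro borel_integrable_atLeastAtMost' continuous_on_subset[OF assms]) auto
  then show ?thesis using assms by (subst circ_integrable_iff) (auto intro: borel_measurable_continuous_onI)
qed

lemma holomorphic_cpt_continuous:
  assumes "g holomorphic_on ball 0 R" "0 < r" "r < R"
  shows "continuous_on UNIV (\<lambda>t. g (cpt r t))"
  using assms by (intro continuous_on_compose2[OF holomorphic_on_imp_continuous_on[OF assms(1)] continuous_cpt]) auto

lemma holomorphic_mean_value:
  assumes g: "g holomorphic_on ball 0 R" and r: "0 < r" "r < R"
  shows "(LINT t|circ. g (cpt r t)) = g 0"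
proof -
  have c: "continuous_on UNIV (\<lambda>t. g (cpt r t))" by (rule holomorphic_cpt_continuous[OF g r])
  then have m: "(\<lambda>t. g (cpt r t)) \<in> borel_measurable borel" by (rule borel_measurable_continuous_onI)
  have s: "set_integrable lborel {0..1} (\<lambda>t. g (cpt r t))"
    by (intro borel_integrable_atLeastAtMost' continuous_on_subset[OF c]) auto
  have "((\<lambda>u. g u / (u - 0)) has_contour_integral (2 * of_real pi * \<i> * g 0)) (circlepath 0 r)"
    using r by (intro Cauchy_integral_circlepath_simple holomorphic_on_subset[OF g]) auto
  then have "((\<lambda>t. g (circlepath 0 r t) / circlepath 0 r t * vector_derivative (circlepath 0 r) (at t within {0..1})) has_integral (2 * of_real pi * \<i> * g 0)) {0..1}"
    by (simp add: has_contour_integral_def)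
  then have "((\<lambda>t. 2 * of_real pi * \<i> * g (cpt r t)) has_integral (2 * of_real pi * \<i> * g 0)) {0..1}"
  proof (rule has_integral_eq[rotated])
    fix t :: real assume t: "t \<in> {0..1}"
    have "vector_derivative (circlepath 0 r) (at t within {0..1}) = 2 * pi * \<i> * r * exp (2 * of_real pi * \<i> * t)"
      using t by (intro vector_derivative_within_cbox[of 0 1, unfolded cbox_interval] has_vector_derivative_circlepath) auto
    then show "g (circlepath 0 r t) / circlepath 0 r t * vector_derivative (circlepath 0 r) (at t within {0..1}) = 2 * of_real pi * \<i> * g (cpt r t)"
      using r by (simp add: circlepath cpt_def)
  qed
  from has_integral_mult_right[OF this, of "1 / (2 * of_real pi * \<i>)"]
  have "((\<lambda>t. g (cpt r t)) has_integral g 0) {0..1}" by simp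
  then have "integral {0..1} (\<lambda>t. g (cpt r t)) = g 0" by (rule integral_unique)
  then show ?thesis using set_borel_integral_eq_integral(2)[OF s] circ_integral[OF m] by simp
qed

text \<open>A holomorphic logarithm \<open>g\<close> exists on the disc, and
  \<open>ln \<bar>h\<bar> = Re g\<close> has the mean value property.\<close>

lemma nonvanishing_log_mean:
  assumes h: "h holomorphic_on ball 0 R" "\<And>z. z \<in> ball 0 R \<Longrightarrow> h z \<noteq> 0" and r: "0 < r" "r < R"
  shows "integrable circ (\<lambda>t. ln (cmod (h (cpt r t))))" and "(LINT t|circ. ln (cmod (h (cpt r t)))) = ln (cmod (h 0))"
proof -
  obtain g where g: "g holomorphic_on ball 0 R" "\<And>z. z \<in> ball 0 R \<Longrightarrow> exp (g z) = h z"
    using holomorphic_logarithm_exists[of "ball 0 R" h 0] h r by (auto simp: order.strict_trans)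
  have *: "ln (cmod (h z)) = Re (g z)" if "z \<in> ball 0 R" for z
    using g(2)[OF that, symmetric] by simp
  have i: "integrable circ (\<lambda>t. g (cpt r t))"
    by (intro circ_integrable_continuous holomorphic_cpt_continuous[OF g(1) r])
  have eq: "(\<lambda>t. ln (cmod (h (cpt r t)))) = (\<lambda>t. Re (g (cpt r t)))"
    using r by (intro ext *) auto
  show "integrable circ (\<lambda>t. ln (cmod (h (cpt r t))))" unfolding eq using i by (rule integrable_Re)
  have "(LINT t|circ. Re (g (cpt r t))) = Re (g 0)"
    using integral_Re[OF i] holomorphic_mean_value[OF g(1) r] by simp
  then show "(LINT t|circ. ln (cmod (h (cpt r t)))) = ln (cmod (h 0))" unfolding eq using * r by simp
qed

text \<open>Two parameters of the same point differ by an integer, so at most three candidates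
  remain in the unit interval.\<close>

lemma AE_cpt_neq: "AE t in circ. cpt r t \<noteq> w" if "r > 0"
proof -
  have "finite {t \<in> {0..1}. cpt r t = w}"
  proof (rule finite_subset)
    let ?t = "SOME t. t \<in> {0..1} \<and> cpt r t = w"
    show "{t \<in> {0..1}. cpt r t = w} \<subseteq> {?t, ?t - 1, ?t + 1}"
    proof
      fix t assume t: "t \<in> {t \<in> {0..1}. cpt r t = w}"
      then have s: "?t \<in> {0..1} \<and> cpt r ?t = w" by (intro someI[of "\<lambda>t. t \<in> {0..1} \<and> cpt r t = w" t]) auto
      have "exp (2 * of_real pi * \<i> * of_real t) = exp (2 * of_real pi * \<i> * of_real ?t)"
        using t s \<open>r > 0\<close> unfolding cpt_def by auto
      then obtain n :: int where "2 * of_real pi * \<i> * complex_of_real t = 2 * of_real pi * \<i> * of_real ?t + of_int (2 * n) * of_real pi * \<i>"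
        unfolding exp_eq by (auto simp: mult_ac)
      then have "2 * of_real pi * \<i> * complex_of_real t = 2 * of_real pi * \<i> * complex_of_real (?t + of_int n)"
        by (simp add: algebra_simps)
      then have tn: "t = ?t + of_int n" unfolding mult_cancel_left of_real_eq_iff by simp
      moreover have "\<bar>t - ?t\<bar> \<le> 1" using t s by auto
      ultimately have "\<bar>n\<bar> \<le> 1" by linarith
      then have "n = -1 \<or> n = 0 \<or> n = 1" by linarith
      then show "t \<in> {?t, ?t - 1, ?t + 1}" using tn by auto
    qed
  qed auto
  then have "AE t in lborel. t \<notin> {t \<in> {0..1}. cpt r t = w}"
    by (intro AE_not_in finite_imp_null_set_lborel)
  then show ?thesis unfolding circ_alt
    by (subst AE_density) (auto elim!: eventually_mono simp: indicator_def)
qed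

text \<open>On the circle \<open>\<bar>z\<bar> = r\<close> one has
  \<open>\<bar>z - w\<bar> = \<bar>r - cnj w * z / r\<bar>\<close>. Reflection in the circle moves
  the zero \<open>w\<close> outside, so the right side is the modulus of a nonvanishing function
  with value \<open>r\<close> at 0.\<close>

lemma log_mean_circle_lt:
  assumes "cmod w < r" "0 < r"
  shows "integrable circ (\<lambda>t. ln (cmod (cpt r t - w)))" and "(LINT t|circ. ln (cmod (cpt r t - w))) = ln r"
proof -
  define h where "h = (\<lambda>z. of_real r - cnj w / of_real r * z)"
  \<comment> \<open>For \<open>w \<noteq> 0\<close> the radius \<open>R\<close> stays below the
    modulus \<open>r\<^sup>2 / \<bar>w\<bar>\<close> of the reflected zero.\<close>
  obtain R where R: "r < R" "cmod w * R < r^2"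
  proof (cases "w = 0")
    case True then show ?thesis using that[of "r + 1"] assms by simp
  next
    case False
    then have "r < r^2 / cmod w" using assms by (simp add: field_simps power2_eq_square)
    then obtain R where "r < R" "R < r^2 / cmod w" using dense by blast
    then show ?thesis using that[of R] False by (simp add: field_simps)
  qed
  have nz: "h z \<noteq> 0" if "z \<in> ball 0 R" for z
  proof
    assume "h z = 0"
    then have "of_real r = cnj w / of_real r * z" by (simp add: h_def)
    then have "of_real (r^2) = cnj w * z" using assms by (simp add: field_simps power2_eq_square)
    then have "cmod (of_real (r^2)) = cmod (cnj w * z)" by (rule arg_cong)
    then have "r^2 = cmod w * cmod z" by (simp add: norm_mult del: of_real_power)
    also have "\<dots> \<le> cmod w * R" using that by (intro mult_left_mono) auto
    finally show False using R by simp
  qed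
  have hol: "h holomorphic_on ball 0 R" unfolding h_def by (intro holomorphic_intros) (use assms in auto)
  have eq: "cmod (cpt r t - w) = cmod (h (cpt r t))" for t
  proof -
    define e where "e = exp (2 * of_real pi * \<i> * complex_of_real t)"
    have e: "cmod e = 1" unfolding e_def by simp
    have "e * cnj e = 1" using complex_norm_square[of e] e by simp
    have c: "cpt r t = of_real r * e" by (simp add: cpt_def e_def)
    have "e * cnj (h (cpt r t)) = of_real r * e - w * (e * cnj e)"
      using assms by (simp add: h_def c algebra_simps)
    then have "cpt r t - w = e * cnj (h (cpt r t))"
      unfolding c \<open>e * cnj e = 1\<close> by simp
    then show ?thesis by (simp add: norm_mult e)
  qed
  have h0: "ln (cmod (h 0)) = ln r" using assms by (simp add: h_def)
  show "integrable circ (\<lambda>t. ln (cmod (cpt r t - w)))" "(LINT t|circ. ln (cmod (cpt r t - w))) = ln r"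
    unfolding eq using nonvanishing_log_mean[OF hol nz assms(2) R(1)] h0 by auto
qed

text \<open>The point \<open>w\<close> may lie on the circle; it is then approximated by \<open>q w\<close> with \<open>q \<rightarrow> 1\<close>, and Fatou's lemma gives the
  integrability needed for dominated convergence.\<close>
lemma log_mean_circle:
  assumes w: "cmod w \<le> r" and r: "0 < r"
  shows "integrable circ (\<lambda>t. ln (cmod (cpt r t - w)))" and "(LINT t|circ. ln (cmod (cpt r t - w))) = ln r"
proof -
  interpret C: prob_space circ by (rule prob_space_circ)
  define f where "f = (\<lambda>t. ln (cmod (cpt r t - w)))"
  define q where "q = (\<lambda>k. 1 - 1 / real (k + 2))"
  have q: "0 < q k" "q k < 1" for k by (auto simp: q_def field_simps)
  have qlim: "q \<longlonglongrightarrow> 1" unfolding q_def by real_asymp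
  define F where "F = (\<lambda>k t. ln (cmod (cpt r t - of_real (q k) * w)))"
  have "q k * cmod w < r" for k
  proof (cases "w = 0")
    case False
    then have "q k * cmod w < 1 * cmod w" using q by (intro mult_strict_right_mono) auto
    then show ?thesis using w by simp
  qed (use r in simp)
  then have qw: "cmod (of_real (q k) * w) < r" for k using q[of k] by (simp add: norm_mult)
  have Fi: "integrable circ (F k)" and Fv: "(LINT t|circ. F k t) = ln r" for k
    unfolding F_def using log_mean_circle_lt[OF qw r] by auto
  have meas[measurable]: "f \<in> borel_measurable circ" "F k \<in> borel_measurable circ" for k
    unfolding f_def F_def by (simp_all add: measurable_cong_sets[OF sets_circ refl])
  have pos: "cmod (cpt r t - of_real (q k) * w) > 0" for k t
  proof -
    have "cpt r t \<noteq> of_real (q k) * w" using qw[of k] norm_cpt[of r t] r by (metis abs_of_pos less_irrefl)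
    then show ?thesis by simp
  qed
  have up: "F k t \<le> ln (2 * r)" for k t
  proof -
    have "cmod (cpt r t - of_real (q k) * w) \<le> cmod (cpt r t) + cmod (of_real (q k) * w)" by (rule norm_triangle_ineq4)
    also have "\<dots> \<le> 2 * r" using qw[of k] r by simp
    finally show ?thesis unfolding F_def using pos r by simp
  qed
  have lim: "AE t in circ. (\<lambda>k. F k t) \<longlonglongrightarrow> f t"
    using AE_cpt_neq[OF r, of w]
  proof eventually_elim
    case (elim t)
    have "(\<lambda>k. cpt r t - of_real (q k) * w) \<longlonglongrightarrow> cpt r t - of_real 1 * w"
      by (intro tendsto_intros qlim)
    then show ?case unfolding F_def f_def using elim by (intro tendsto_ln tendsto_norm) auto
  qed
  \<comment> \<open>Pulling \<open>w\<close> towards 0 shrinks its distance to a point of the circle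
    by at most the factor 2. Together with \<open>up\<close> this dominates all \<open>F k\<close>
    by \<open>\<bar>f\<bar>\<close> and constants.\<close>
  have low: "AE t in circ. \<forall>k. f t - ln 2 \<le> F k t"
    using AE_cpt_neq[OF r, of w]
  proof eventually_elim
    case (elim t)
    show ?case
    proof
      fix k
      have "cmod (cpt r t - w) = cmod ((cpt r t - of_real (q k) * w) - of_real (1 - q k) * w)" by (simp add: algebra_simps)
      also have "\<dots> \<le> cmod (cpt r t - of_real (q k) * w) + cmod (of_real (1 - q k) * w)" by (rule norm_triangle_ineq4)
      also have "cmod (of_real (1 - q k) * w) = (1 - q k) * cmod w" using q[of k] by (simp only: norm_mult norm_of_real abs_of_pos diff_gt_0_iff_gt)
      also have "\<dots> \<le> (1 - q k) * r" using w q[of k] by (intro mult_left_mono) auto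
      also have "\<dots> \<le> cmod (cpt r t - of_real (q k) * w)"
      proof -
        have "r - q k * r \<le> r - q k * cmod w" using w q[of k] by (intro diff_left_mono mult_left_mono) auto
        also have "\<dots> = cmod (cpt r t) - cmod (of_real (q k) * w)" using r q[of k] by (simp add: norm_mult)
        also have "\<dots> \<le> cmod (cpt r t - of_real (q k) * w)" by (rule norm_triangle_ineq2)
        finally show ?thesis by (simp add: algebra_simps)
      qed
      finally have "cmod (cpt r t - w) \<le> 2 * cmod (cpt r t - of_real (q k) * w)" by simp
      then have "f t \<le> ln (2 * cmod (cpt r t - of_real (q k) * w))"
        unfolding f_def using elim pos[of t k] by (intro ln_mono) auto
      also have "\<dots> = ln 2 + F k t" unfolding F_def using pos[of t k] by (subst ln_mult) auto
      finally show "f t - ln 2 \<le> F k t" by simp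
    qed
  qed
  have fup: "AE t in circ. f t \<le> ln (2 * r)"
    using lim by eventually_elim (use up in \<open>auto intro: LIMSEQ_le_const2\<close>)
  have "(\<integral>\<^sup>+ t. ennreal (ln (2 * r) - f t) \<partial>circ) = (\<integral>\<^sup>+ t. liminf (\<lambda>k. ennreal (ln (2 * r) - F k t)) \<partial>circ)"
  proof (rule nn_integral_cong_AE)
    show "AE t in circ. ennreal (ln (2 * r) - f t) = liminf (\<lambda>k. ennreal (ln (2 * r) - F k t))"
      using lim
    proof eventually_elim
      case (elim t)
      then have "(\<lambda>k. ennreal (ln (2 * r) - F k t)) \<longlonglongrightarrow> ennreal (ln (2 * r) - f t)"
        by (intro tendsto_ennrealI tendsto_intros)
      then show ?case using lim_imp_Liminf[OF sequentially_bot] by metis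
    qed
  qed
  also have "\<dots> \<le> liminf (\<lambda>k. \<integral>\<^sup>+ t. ennreal (ln (2 * r) - F k t) \<partial>circ)"
    by (rule nn_integral_liminf) auto
  also have "(\<lambda>k. \<integral>\<^sup>+ t. ennreal (ln (2 * r) - F k t) \<partial>circ) = (\<lambda>k. ennreal (ln (2 * r) - ln r))"
  proof
    fix k
    have "(\<integral>\<^sup>+ t. ennreal (ln (2 * r) - F k t) \<partial>circ) = ennreal (LINT t|circ. ln (2 * r) - F k t)"
      using up Fi by (intro nn_integral_eq_integral) auto
    also have "(LINT t|circ. ln (2 * r) - F k t) = ln (2 * r) - ln r"
      using Fi Fv[of k] C.prob_space by simp
    finally show "(\<integral>\<^sup>+ t. ennreal (ln (2 * r) - F k t) \<partial>circ) = ennreal (ln (2 * r) - ln r)" .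
  qed
  finally have fat: "(\<integral>\<^sup>+ t. ennreal (ln (2 * r) - f t) \<partial>circ) \<le> ennreal (ln (2 * r) - ln r)"
    by (simp add: Liminf_const)
  have "integrable circ (\<lambda>t. ln (2 * r) - f t)"
  proof (rule integrableI_nonneg)
    show "AE t in circ. 0 \<le> ln (2 * r) - f t" using fup by eventually_elim simp
    show "(\<integral>\<^sup>+ t. ennreal (ln (2 * r) - f t) \<partial>circ) < \<infinity>" using fat by (rule order.strict_trans1) auto
  qed simp
  then have fd: "integrable circ (\<lambda>t. ln (2 * r) - (ln (2 * r) - f t))"
    by (rule Bochner_Integration.integrable_diff[rotated]) simp
  have feq: "f = (\<lambda>t. ln (2 * r) - (ln (2 * r) - f t))" by auto
  have fi: "integrable circ f" by (subst feq) (rule fd)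
  have "(\<lambda>k. LINT t|circ. F k t) \<longlonglongrightarrow> (LINT t|circ. f t)"
  proof (rule integral_dominated_convergence)
    show "integrable circ (\<lambda>t. \<bar>f t\<bar> + ln 2 + \<bar>ln (2 * r)\<bar>)" using fi by auto
    show "AE t in circ. norm (F k t) \<le> \<bar>f t\<bar> + ln 2 + \<bar>ln (2 * r)\<bar>" for k
      using low
    proof eventually_elim
      case (elim t)
      have "f t - ln 2 \<le> F k t" using elim by blast
      moreover have "0 \<le> ln (2::real)" by simp
      ultimately show ?case using up[of k t] unfolding real_norm_def by linarith
    qed
  qed (use lim in auto)
  then have "(LINT t|circ. f t) = ln r" unfolding Fv by (simp add: LIMSEQ_const_iff)
  then show "integrable circ (\<lambda>t. ln (cmod (cpt r t - w)))" "(LINT t|circ. ln (cmod (cpt r t - w))) = ln r"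
    using fi unfolding f_def by auto
qed

section \<open>Jensen's formula on hyperbolic discs\<close>

text \<open>The disc automorphism that sends \<open>\<zeta>\<close> to 0, with inverse
  \<open>mob (- \<zeta>)\<close>. Hyperbolic circles around \<open>\<zeta>\<close> are the images
  under \<open>mob (- \<zeta>)\<close> of Euclidean circles around 0.\<close>

definition mob :: "complex \<Rightarrow> complex \<Rightarrow> complex" where
  "mob \<zeta> z = (z - \<zeta>) / (1 - cnj \<zeta> * z)"

lemma mob_Moebius: "mob \<zeta> = Moebius_function 0 \<zeta>"
  by (auto simp: mob_def Moebius_function_simple)

lemma mob_denom:
  assumes "cmod \<zeta> < 1" "cmod z < 1"
  shows "1 - cnj \<zeta> * z \<noteq> 0" "1 + cnj \<zeta> * z \<noteq> 0"
proof -
  have "cmod (cnj \<zeta> * z) < 1"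
    using mult_strict_mono'[OF assms] assms by (simp add: norm_mult)
  then have "cnj \<zeta> * z \<noteq> 1" "cnj \<zeta> * z \<noteq> -1" by (metis less_irrefl norm_one, metis less_irrefl norm_minus_cancel norm_one)
  then show "1 - cnj \<zeta> * z \<noteq> 0" "1 + cnj \<zeta> * z \<noteq> 0"
    by (simp, metis add.commute eq_neg_iff_add_eq_0)
qed

lemma mob_lt_1: "cmod \<zeta> < 1 \<Longrightarrow> cmod z < 1 \<Longrightarrow> cmod (mob \<zeta> z) < 1"
  unfolding mob_Moebius by (rule Moebius_function_norm_lt_1)

lemma mob_inverse:
  assumes "cmod \<zeta> < 1" "cmod z < 1"
  shows "mob \<zeta> (mob (- \<zeta>) z) = z" "mob (- \<zeta>) (mob \<zeta> z) = z"
  unfolding mob_Moebius using assms by (auto intro: Moebius_function_compose)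

lemma mob_holomorphic: "cmod \<zeta> < 1 \<Longrightarrow> mob \<zeta> holomorphic_on ball 0 1"
  unfolding mob_Moebius by (rule Moebius_function_holomorphic)

text \<open>Used to turn a linear factor pulled back to the coordinate centred at
  \<open>\<zeta>\<close> into a linear factor divided by nonvanishing ones, all of whose log means
  are known.\<close>

lemma mob_diff:
  assumes "cmod \<zeta> < 1" "cmod z < 1" "cmod u < 1"
  shows "mob (- \<zeta>) z - mob (- \<zeta>) u = of_real (1 - (cmod \<zeta>)\<^sup>2) * (z - u) / ((1 + cnj \<zeta> * z) * (1 + cnj \<zeta> * u))"
proof -
  have d: "1 + cnj \<zeta> * z \<noteq> 0" "1 + cnj \<zeta> * u \<noteq> 0" using mob_denom assms by auto
  have "(z + \<zeta>) * (1 + cnj \<zeta> * u) - (u + \<zeta>) * (1 + cnj \<zeta> * z) = (1 - \<zeta> * cnj \<zeta>) * (z - u)"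
    by (simp add: algebra_simps)
  also have "1 - \<zeta> * cnj \<zeta> = of_real (1 - (cmod \<zeta>)\<^sup>2)" using complex_norm_square[of \<zeta>] by simp
  finally show ?thesis using d by (simp add: mob_def diff_frac_eq)
qed

lemma mob_norm:
  assumes "cmod \<zeta> < 1" "cmod z < 1"
  shows "1 - (cmod (mob (- \<zeta>) z))\<^sup>2 = (1 - (cmod \<zeta>)\<^sup>2) * (1 - (cmod z)\<^sup>2) / (cmod (1 + cnj \<zeta> * z))\<^sup>2"
proof -
  have d: "1 + cnj \<zeta> * z \<noteq> 0" using mob_denom assms by auto
  have "complex_of_real ((cmod (1 + cnj \<zeta> * z))\<^sup>2 - (cmod (z + \<zeta>))\<^sup>2) = of_real ((1 - (cmod \<zeta>)\<^sup>2) * (1 - (cmod z)\<^sup>2))"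
    unfolding of_real_diff of_real_mult complex_norm_square by (simp add: algebra_simps)
  then have "(cmod (1 + cnj \<zeta> * z))\<^sup>2 - (cmod (z + \<zeta>))\<^sup>2 = (1 - (cmod \<zeta>)\<^sup>2) * (1 - (cmod z)\<^sup>2)"
    unfolding of_real_eq_iff .
  then show ?thesis using d by (simp add: mob_def norm_divide power_divide diff_divide_eq_iff)
qed

text \<open>Polarised form of \<open>mob_norm\<close>: the factors
  \<open>1 + cnj \<zeta> * z\<close> agree, and therefore cancel in the normalised
  covariance.\<close>

lemma mob_cross:
  assumes "cmod \<zeta> < 1" "cmod z < 1" "cmod u < 1"
  shows "1 - mob (- \<zeta>) z * cnj (mob (- \<zeta>) u) =
     of_real (1 - (cmod \<zeta>)\<^sup>2) * (1 - z * cnj u) / ((1 + cnj \<zeta> * z) * cnj (1 + cnj \<zeta> * u))"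
proof -
  have d: "1 + cnj \<zeta> * z \<noteq> 0" "cnj (1 + cnj \<zeta> * u) \<noteq> 0"
    using mob_denom[of \<zeta> z] mob_denom[of \<zeta> u] assms by (auto simp del: complex_cnj_add complex_cnj_mult)
  have "(1 + cnj \<zeta> * z) * cnj (1 + cnj \<zeta> * u) - (z + \<zeta>) * cnj (u + \<zeta>) = (1 - \<zeta> * cnj \<zeta>) * (1 - z * cnj u)"
    by (simp add: algebra_simps)
  also have "1 - \<zeta> * cnj \<zeta> = of_real (1 - (cmod \<zeta>)\<^sup>2)" using complex_norm_square[of \<zeta>] by simp
  finally have *: "(1 + cnj \<zeta> * z) * cnj (1 + cnj \<zeta> * u) - (z + \<zeta>) * cnj (u + \<zeta>) = of_real (1 - (cmod \<zeta>)\<^sup>2) * (1 - z * cnj u)" .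
  have "mob (- \<zeta>) z * cnj (mob (- \<zeta>) u) = ((z + \<zeta>) * cnj (u + \<zeta>)) / ((1 + cnj \<zeta> * z) * cnj (1 + cnj \<zeta> * u))"
    by (simp add: mob_def)
  then show ?thesis unfolding *[symmetric] using d by (simp only: diff_divide_distrib mult_eq_0_iff divide_self) simp
qed

lemma log_mean_denom:
  assumes z: "cmod \<zeta> < 1" and r: "0 < r" "r < 1"
  shows "integrable circ (\<lambda>t. ln (cmod (1 + cnj \<zeta> * cpt r t)))" and "(LINT t|circ. ln (cmod (1 + cnj \<zeta> * cpt r t))) = 0"
proof -
  have "(\<lambda>z. 1 + cnj \<zeta> * z) holomorphic_on ball 0 1" by (intro holomorphic_intros)
  from nonvanishing_log_mean[OF this _ r]
  show "integrable circ (\<lambda>t. ln (cmod (1 + cnj \<zeta> * cpt r t)))" "(LINT t|circ. ln (cmod (1 + cnj \<zeta> * cpt r t))) = 0"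
    using mob_denom[OF z] by auto
qed

lemma log_mean_mob:
  assumes z: "cmod \<zeta> < 1" and r: "0 < r" "r < 1" and a: "cmod a < 1" "cmod (mob \<zeta> a) \<le> r" "a \<noteq> \<zeta>"
  shows "integrable circ (\<lambda>t. ln (cmod (mob (- \<zeta>) (cpt r t) - a)))"
    and "(LINT t|circ. ln (cmod (mob (- \<zeta>) (cpt r t) - a))) = ln (cmod (\<zeta> - a)) + ln (r / cmod (mob \<zeta> a))"
proof -
  interpret C: prob_space circ by (rule prob_space_circ)
  define u where "u = mob \<zeta> a"
  have u: "cmod u < 1" "mob (- \<zeta>) u = a" "cmod u \<le> r" unfolding u_def using mob_lt_1[OF z a(1)] mob_inverse[OF z a(1)] a by auto
  have "mob (- \<zeta>) 0 = \<zeta>" by (simp add: mob_def)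
  then have u0: "u \<noteq> 0" using u a by auto
  define k where "k = 1 - (cmod \<zeta>)\<^sup>2"
  have k: "k > 0" using z by (simp add: k_def power_less_one_iff abs_square_less_1)
  have eq: "ln (cmod (mob (- \<zeta>) w - a)) = ln k + ln (cmod (w - u)) - ln (cmod (1 + cnj \<zeta> * w)) - ln (cmod (1 + cnj \<zeta> * u))"
    if "cmod w < 1" "w \<noteq> u" for w
  proof -
    have "cmod (mob (- \<zeta>) w - a) = k * cmod (w - u) / (cmod (1 + cnj \<zeta> * w) * cmod (1 + cnj \<zeta> * u))"
      using k unfolding u(2)[symmetric] mob_diff[OF z that(1) u(1)] k_def[symmetric] by (simp only: norm_mult norm_divide norm_of_real abs_of_pos)
    moreover have "cmod (1 + cnj \<zeta> * w) > 0" "cmod (1 + cnj \<zeta> * u) > 0" "cmod (w - u) > 0"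
      using mob_denom[OF z] that u by auto
    ultimately show ?thesis using k by (simp add: ln_divide_pos ln_mult)
  qed
  have ae: "AE t in circ. ln k + ln (cmod (cpt r t - u)) - ln (cmod (1 + cnj \<zeta> * cpt r t)) - ln (cmod (1 + cnj \<zeta> * u)) = ln (cmod (mob (- \<zeta>) (cpt r t) - a))"
    using AE_cpt_neq[OF r(1), of u] by eventually_elim (use eq r in auto)
  have m: "(\<lambda>t. ln (cmod (mob (- \<zeta>) (cpt r t) - a))) \<in> borel_measurable circ"
    unfolding mob_def by (simp add: measurable_cong_sets[OF sets_circ refl])
  let ?G = "\<lambda>t. ln k + ln (cmod (cpt r t - u)) - ln (cmod (1 + cnj \<zeta> * cpt r t)) - ln (cmod (1 + cnj \<zeta> * u))"
  have i: "integrable circ ?G"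
    using log_mean_circle(1)[OF u(3) r(1)] log_mean_denom(1)[OF z r] by simp
  show "integrable circ (\<lambda>t. ln (cmod (mob (- \<zeta>) (cpt r t) - a)))"
    by (rule iffD1[OF integrable_cong_AE[OF borel_measurable_integrable[OF i] m ae] i])
  have "(LINT t|circ. ln (cmod (mob (- \<zeta>) (cpt r t) - a))) = (LINT t|circ. ?G t)"
    using ae by (intro integral_cong_AE m borel_measurable_integrable[OF i]) (auto elim!: eventually_mono)
  also have "\<dots> = ln k + ln r - ln (cmod (1 + cnj \<zeta> * u))"
    using log_mean_circle[OF u(3) r(1)] log_mean_denom[OF z r] C.prob_space by simp
  also have "\<dots> = ln (cmod (\<zeta> - a)) + ln (r / cmod (mob \<zeta> a))"
    \<comment> \<open>The same identity at the centre \<open>w = 0\<close> rewrites the remaining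
      constants through \<open>ln \<bar>\<zeta> - a\<bar>\<close>.\<close>
    using eq[of 0] u0 r \<open>mob (- \<zeta>) 0 = \<zeta>\<close> by (simp add: u_def[symmetric] ln_divide_pos)
  finally show "(LINT t|circ. ln (cmod (mob (- \<zeta>) (cpt r t) - a))) = ln (cmod (\<zeta> - a)) + ln (r / cmod (mob \<zeta> a))" .
qed

section \<open>Zeros in hyperbolic discs and Jensen's formula\<close>

definition hzeros :: "(complex \<Rightarrow> complex) \<Rightarrow> complex \<Rightarrow> real \<Rightarrow> complex set" where
  "hzeros f \<zeta> r = {w. cmod w < 1 \<and> f w = 0 \<and> cmod (mob \<zeta> w) \<le> r}"

lemma hzeros_image:
  assumes "cmod \<zeta> < 1" "r < 1"
  shows "hzeros f \<zeta> r = {w \<in> mob (- \<zeta>) ` cball 0 r. f w = 0}"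
proof (intro set_eqI iffI)
  fix w assume w: "w \<in> hzeros f \<zeta> r"
  then have "w = mob (- \<zeta>) (mob \<zeta> w)" "mob \<zeta> w \<in> cball 0 r" using mob_inverse assms by (auto simp: hzeros_def)
  then have "w \<in> mob (- \<zeta>) ` cball 0 r" by (rule image_eqI)
  then show "w \<in> {w \<in> mob (- \<zeta>) ` cball 0 r. f w = 0}" using w by (simp add: hzeros_def)
next
  fix w assume "w \<in> {w \<in> mob (- \<zeta>) ` cball 0 r. f w = 0}"
  then obtain v where v: "w = mob (- \<zeta>) v" "cmod v \<le> r" "f w = 0" by auto
  then show "w \<in> hzeros f \<zeta> r"
    using assms mob_inverse[of \<zeta> v] mob_lt_1[of "- \<zeta>" v] by (auto simp: hzeros_def)
qed

lemma finite_hzeros: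
  assumes z: "cmod \<zeta> < 1" and r: "r < 1" and f: "f holomorphic_on ball 0 1" "f w \<noteq> 0" "cmod w < 1"
  shows "finite (hzeros f \<zeta> r)"
proof (cases "\<exists>w. cmod w < 1 \<and> f w = 0")
  case False
  then have "hzeros f \<zeta> r = {}" by (auto simp: hzeros_def)
  then show ?thesis by simp
next
  case True
  then have nc: "\<not> f constant_on ball 0 1" using f unfolding constant_on_def by (metis mem_ball_0)
  have "continuous_on (cball 0 r) (mob (- \<zeta>))"
    by (rule holomorphic_on_imp_continuous_on[OF holomorphic_on_subset[OF mob_holomorphic]]) (use z r in auto)
  then have "compact (mob (- \<zeta>) ` cball 0 r)" by (intro compact_continuous_image) auto
  moreover have "mob (- \<zeta>) ` cball 0 r \<subseteq> ball 0 1" using mob_lt_1[of "- \<zeta>"] z r by auto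
  ultimately show ?thesis unfolding hzeros_image[OF z r]
    by (intro holomorphic_compact_finite_zeros[OF f(1) _ _ _ _ nc]) auto
qed

text \<open>On a slightly larger hyperbolic disc \<open>f = h * p\<close> with \<open>h\<close>
  nonvanishing and \<open>p\<close> a polynomial that carries the zeros with multiplicity, so the
  log mean splits into known ones. Zeros on the circle itself are allowed; they contribute
  \<open>ln 1 = 0\<close>.\<close>

theorem jensen_mob:
  assumes z: "cmod \<zeta> < 1" and r: "0 < r" "r < 1" and f: "f holomorphic_on ball 0 1" "f \<zeta> \<noteq> 0"
  shows "integrable circ (\<lambda>t. ln (cmod (f (mob (- \<zeta>) (cpt r t)))))"
    and "(LINT t|circ. ln (cmod (f (mob (- \<zeta>) (cpt r t))))) =
      ln (cmod (f \<zeta>)) + (\<Sum>a\<in>hzeros f \<zeta> r. real (zero_mult f a) * ln (r / cmod (mob \<zeta> a)))"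
    and "AE t in circ. f (mob (- \<zeta>) (cpt r t)) \<noteq> 0"
proof -
  interpret C: prob_space circ by (rule prob_space_circ)
  define A where "A = hzeros f \<zeta> r"
  have finA: "finite A" unfolding A_def by (rule finite_hzeros[OF z r(2) f z])
  \<comment> \<open>There are finitely many zeros up to the intermediate radius \<open>s\<close>, so
    the disc can be enlarged without catching a new one. Including \<open>s\<close> in
    \<open>B\<close> keeps the minimum meaningful when no zero lies between.\<close>
  obtain R where R: "r < R" "R < 1" "hzeros f \<zeta> R = A"
  proof -
    define s where "s = (1 + r) / 2"
    have s: "r < s" "s < 1" using r by (auto simp: s_def)
    define B where "B = insert s {cmod (mob \<zeta> a) |a. a \<in> hzeros f \<zeta> s \<and> cmod (mob \<zeta> a) > r}"
    have finB: "finite B" unfolding B_def using finite_hzeros[OF z s(2) f z] by auto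
    have "Min B \<in> B" using finB by (intro Min_in) (auto simp: B_def)
    then have "Min B > r" using s by (auto simp: B_def)
    then obtain R where R: "r < R" "R < Min B" using dense by blast
    have "Min B \<le> s" using finB by (intro Min_le) (auto simp: B_def)
    have "hzeros f \<zeta> R = A"
    proof
      show "A \<subseteq> hzeros f \<zeta> R" using R by (auto simp: A_def hzeros_def)
      show "hzeros f \<zeta> R \<subseteq> A"
      proof
        fix a assume a: "a \<in> hzeros f \<zeta> R"
        show "a \<in> A"
        proof (rule ccontr)
          assume "a \<notin> A"
          then have "cmod (mob \<zeta> a) > r" using a by (auto simp: A_def hzeros_def)
          moreover have "a \<in> hzeros f \<zeta> s" using a R \<open>Min B \<le> s\<close> by (auto simp: hzeros_def)
          ultimately have "cmod (mob \<zeta> a) \<in> B" by (auto simp: B_def)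
          then have "Min B \<le> cmod (mob \<zeta> a)" using finB by (intro Min_le)
          then show False using a R by (auto simp: hzeros_def)
        qed
      qed
    qed
    then show ?thesis using that R \<open>Min B \<le> s\<close> s by auto
  qed
  define U where "U = mob (- \<zeta>) ` ball 0 R"
  have T: "mob (- \<zeta>) holomorphic_on ball 0 1" using mob_holomorphic[of "- \<zeta>"] z by simp
  have Uin: "U \<subseteq> ball 0 1" unfolding U_def using mob_lt_1[of "- \<zeta>"] z R by auto
  have Ueq: "U = ball 0 1 \<inter> mob \<zeta> -` ball 0 R"
  proof
    show "U \<subseteq> ball 0 1 \<inter> mob \<zeta> -` ball 0 R" using Uin mob_inverse(1)[OF z] R by (auto simp: U_def)
    show "ball 0 1 \<inter> mob \<zeta> -` ball 0 R \<subseteq> U"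
      unfolding U_def using mob_inverse(2)[OF z] by (auto intro!: image_eqI[where x = "mob \<zeta> _"])
  qed
  have "open U" unfolding Ueq
    by (intro continuous_open_preimage holomorphic_on_imp_continuous_on mob_holomorphic z) auto
  have "connected U" unfolding U_def using R
    by (intro connected_continuous_image holomorphic_on_imp_continuous_on holomorphic_on_subset[OF T]) auto
  have \<zeta>U: "\<zeta> \<in> U" unfolding U_def using r R by (intro image_eqI[of _ _ 0]) (auto simp: mob_def)
  define m where "m = zero_mult f"
  define p where "p = (\<lambda>w. \<Prod>a\<in>A. (w - a) ^ m a)"
  have fU: "f holomorphic_on U" using f(1) Uin by (rule holomorphic_on_subset)
  have zo: "(if f w = 0 then zorder f w > 0 else zorder f w = 0)" if "w \<in> U" for w
    using zorder_exist_zero[OF fU \<open>open U\<close> \<open>connected U\<close> that] \<zeta>U f(2) by blast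
  have AU: "w \<in> A \<longleftrightarrow> f w = 0" if "w \<in> U" for w
    using that R(3) unfolding Ueq by (auto simp: hzeros_def)
  have mA: "int (m w) = zorder f w" "m w > 0" if "w \<in> A" for w
  proof -
    have w: "w \<in> U" "f w = 0" using that R(1,2) unfolding A_def Ueq by (auto simp: hzeros_def)
    then show "int (m w) = zorder f w" "m w > 0" using zo[OF w(1)] Uin by (auto simp: m_def zero_mult_def)
  qed
  have p0: "p w = 0 \<longleftrightarrow> w \<in> A" for w unfolding p_def using finA mA by auto
  have pz: "zorder p w = zorder f w" if w: "w \<in> U" for w
  proof (cases "w \<in> A")
    case True
    have "zorder p w = int (m w)"
    proof (rule zorder_eqI[where S = UNIV and g = "\<lambda>v. \<Prod>a\<in>A - {w}. (v - a) ^ m a"])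
      show "p v = (\<Prod>a\<in>A - {w}. (v - a) ^ m a) * (v - w) powi int (m w)" for v
        unfolding p_def using finA True by (subst prod.remove[of A w]) (auto simp: mult.commute)
    qed (use finA in \<open>auto intro!: holomorphic_intros\<close>)
    then show ?thesis using mA True by simp
  next
    case False
    have "zorder p w = 0"
      using False p0 by (intro zorder_eqI[where S = UNIV and g = p]) (auto simp: p_def intro!: holomorphic_intros)
    then show ?thesis using zo[OF w] AU[OF w] False by auto
  qed
  obtain h where h: "h holomorphic_on U" "\<And>w. w \<in> U \<Longrightarrow> h w \<noteq> 0" "\<And>w. w \<in> U \<Longrightarrow> f w = h w * p w"
  proof (rule holomorphic_zorder_factorization[OF fU \<open>open U\<close> \<open>connected U\<close>, of p])
    show "p holomorphic_on U" unfolding p_def by (intro holomorphic_intros)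
    show "p w = 0 \<longleftrightarrow> f w = 0" if "w \<in> U" for w using p0 AU[OF that] by simp
    show "zorder p w = zorder f w" if "w \<in> U" for w by (rule pz[OF that])
  qed blast
  define H where "H = h \<circ> mob (- \<zeta>)"
  have Hhol: "H holomorphic_on ball 0 R" unfolding H_def
    by (intro holomorphic_on_compose holomorphic_on_subset[OF T] holomorphic_on_subset[OF h(1)]) (use R in \<open>auto simp: U_def\<close>)
  have Hnz: "H w \<noteq> 0" if "w \<in> ball 0 R" for w using that h(2) by (auto simp: H_def U_def)
  note HM = nonvanishing_log_mean[OF Hhol Hnz r(1) R(1)]
  have pU: "mob (- \<zeta>) (cpt r t) \<in> U" for t unfolding U_def using r R by auto
  have aA: "cmod a < 1" "cmod (mob \<zeta> a) \<le> r" "a \<noteq> \<zeta>" if "a \<in> A" for a using that f(2) by (auto simp: A_def hzeros_def)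
  note LM = log_mean_mob[OF z r aA]
  have "AE t in circ. \<forall>a\<in>A. cpt r t \<noteq> mob \<zeta> a"
    using finA AE_cpt_neq[OF r(1)] by (intro AE_finite_allI) auto
  then have ne: "AE t in circ. \<forall>a\<in>A. mob (- \<zeta>) (cpt r t) \<noteq> a"
  proof eventually_elim
    case (elim t)
    show ?case
    proof
      fix a assume "a \<in> A"
      then show "mob (- \<zeta>) (cpt r t) \<noteq> a" using elim mob_inverse(1)[OF z, of "cpt r t"] r by auto
    qed
  qed
  show "AE t in circ. f (mob (- \<zeta>) (cpt r t)) \<noteq> 0"
    using ne by eventually_elim (use AU[OF pU] in auto)
  have lnf: "ln (cmod (f w)) = ln (cmod (h w)) + (\<Sum>a\<in>A. real (m a) * ln (cmod (w - a)))"
    if "w \<in> U" "w \<notin> A" for w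
  proof -
    have "cmod (f w) = cmod (h w) * (\<Prod>a\<in>A. cmod (w - a) ^ m a)"
      using h(3)[OF that(1)] by (simp add: norm_mult p_def prod_norm[symmetric] norm_power)
    moreover have "(\<Prod>a\<in>A. cmod (w - a) ^ m a) > 0" using that by (intro prod_pos ballI zero_less_power) auto
    ultimately have "ln (cmod (f w)) = ln (cmod (h w)) + ln (\<Prod>a\<in>A. cmod (w - a) ^ m a)"
      using h(2)[OF that(1)] by (simp add: ln_mult)
    also have "ln (\<Prod>a\<in>A. cmod (w - a) ^ m a) = (\<Sum>a\<in>A. ln (cmod (w - a) ^ m a))"
      using that finA by (intro ln_prod) auto
    also have "\<dots> = (\<Sum>a\<in>A. real (m a) * ln (cmod (w - a)))" by (intro sum.cong refl ln_realpow)
    finally show ?thesis .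
  qed
  let ?G = "\<lambda>t. ln (cmod (H (cpt r t))) + (\<Sum>a\<in>A. real (m a) * ln (cmod (mob (- \<zeta>) (cpt r t) - a)))"
  have ae: "AE t in circ. ?G t = ln (cmod (f (mob (- \<zeta>) (cpt r t))))"
    using ne
  proof eventually_elim
    case (elim t)
    then have "mob (- \<zeta>) (cpt r t) \<notin> A" by blast
    then show ?case using lnf[OF pU] by (simp add: H_def)
  qed
  have "continuous_on UNIV (\<lambda>t. (f \<circ> mob (- \<zeta>)) (cpt r t))"
    using Uin R by (intro holomorphic_cpt_continuous[OF _ r(1) R(1)] holomorphic_on_compose holomorphic_on_subset[OF T] holomorphic_on_subset[OF fU])
      (auto simp: U_def)
  then have "(\<lambda>t. f (mob (- \<zeta>) (cpt r t))) \<in> borel_measurable borel" by (intro borel_measurable_continuous_onI) simp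
  then have m: "(\<lambda>t. ln (cmod (f (mob (- \<zeta>) (cpt r t))))) \<in> borel_measurable circ"
    by (simp add: measurable_cong_sets[OF sets_circ refl])
  have i: "integrable circ ?G" using HM LM by auto
  show "integrable circ (\<lambda>t. ln (cmod (f (mob (- \<zeta>) (cpt r t)))))"
    by (rule iffD1[OF integrable_cong_AE[OF borel_measurable_integrable[OF i] m ae] i])
  have "(LINT t|circ. ln (cmod (f (mob (- \<zeta>) (cpt r t))))) = (LINT t|circ. ?G t)"
    using ae by (intro integral_cong_AE m borel_measurable_integrable[OF i]) (auto elim!: eventually_mono)
  also have "\<dots> = ln (cmod (H 0)) + (\<Sum>a\<in>A. real (m a) * (ln (cmod (\<zeta> - a)) + ln (r / cmod (mob \<zeta> a))))"
    using HM LM by simp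
  also have "\<dots> = (ln (cmod (h \<zeta>)) + (\<Sum>a\<in>A. real (m a) * ln (cmod (\<zeta> - a)))) + (\<Sum>a\<in>A. real (m a) * ln (r / cmod (mob \<zeta> a)))"
    by (simp add: H_def mob_def distrib_left sum.distrib)
  also have "ln (cmod (h \<zeta>)) + (\<Sum>a\<in>A. real (m a) * ln (cmod (\<zeta> - a))) = ln (cmod (f \<zeta>))"
  proof -
    have "\<zeta> \<notin> A" using aA by blast
    then show ?thesis using lnf[OF \<zeta>U] by simp
  qed
  finally show "(LINT t|circ. ln (cmod (f (mob (- \<zeta>) (cpt r t))))) =
      ln (cmod (f \<zeta>)) + (\<Sum>a\<in>hzeros f \<zeta> r. real (zero_mult f a) * ln (r / cmod (mob \<zeta> a)))"
    by (simp add: A_def m_def)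
qed

section \<open>From Jensen means to zeros\<close>

text \<open>A greedy choice: points are replaced by pairs of a point and an index below its
  multiplicity, and each step takes a remaining pair with minimal \<open>d\<close>. Local finiteness
  makes the minima exist.\<close>

lemma enumerate_with_multiplicity:
  fixes Z :: "'a set" and m :: "'a \<Rightarrow> nat" and d :: "'a \<Rightarrow> real"
  assumes inf: "infinite Z" and m: "\<And>a. a \<in> Z \<Longrightarrow> m a > 0"
    and fin: "\<And>a. a \<in> Z \<Longrightarrow> finite {b \<in> Z. d b \<le> d a}"
  shows "\<exists>z :: nat \<Rightarrow> 'a. (\<forall>k. z k \<in> Z) \<and> (\<forall>a\<in>Z. card {k. z k = a} = m a) \<and> mono (\<lambda>k. d (z k))"
proof -
  define P where "P = (SIGMA a:Z. {..<m a})"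
  have finP: "finite {q \<in> P. d (fst q) \<le> d (fst p)}" if "p \<in> P" for p
  proof (rule finite_subset)
    show "{q \<in> P. d (fst q) \<le> d (fst p)} \<subseteq> (SIGMA a:{b \<in> Z. d b \<le> d (fst p)}. {..<m a})"
      by (auto simp: P_def)
    show "finite (SIGMA a:{b \<in> Z. d b \<le> d (fst p)}. {..<m a})"
      using that fin by (intro finite_SigmaI) (auto simp: P_def)
  qed
  have infP: "infinite P"
  proof
    assume "finite P"
    moreover have "Z \<subseteq> fst ` P" using m by (force simp: P_def image_iff)
    ultimately show False using inf finite_surj by blast
  qed
  define ch where "ch = (\<lambda>A. SOME p. p \<in> P - A \<and> (\<forall>q\<in>P - A. d (fst p) \<le> d (fst q)))"
  have ch: "ch A \<in> P - A \<and> (\<forall>q\<in>P - A. d (fst (ch A)) \<le> d (fst q))" if A: "finite A" for A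
  proof -
    obtain p0 where p0: "p0 \<in> P - A" using infP A by (metis finite_Diff2 finite.emptyI ex_in_conv)
    define B where "B = {q \<in> P - A. d (fst q) \<le> d (fst p0)}"
    have B: "finite B" "p0 \<in> B" using finP[of p0] p0 by (auto simp: B_def elim: rev_finite_subset)
    obtain p where p: "p \<in> B" "\<forall>q\<in>B. d (fst p) \<le> d (fst q)"
    proof -
      have "\<exists>x\<in>(\<lambda>q. d (fst q)) ` B. \<forall>y\<in>(\<lambda>q. d (fst q)) ` B. x \<le> y"
        using B by (intro bexI[of _ "Min ((\<lambda>q. d (fst q)) ` B)"] ballI Min_le Min_in) auto
      then show ?thesis using that by auto
    qed
    have "p \<in> P - A \<and> (\<forall>q\<in>P - A. d (fst p) \<le> d (fst q))"
    proof (intro conjI ballI)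
      show "p \<in> P - A" using p by (simp add: B_def)
      fix q assume q: "q \<in> P - A"
      show "d (fst p) \<le> d (fst q)"
      proof (cases "q \<in> B")
        case False
        then have "d (fst p0) \<le> d (fst q)" using q by (simp add: B_def)
        moreover have "d (fst p) \<le> d (fst p0)" using p(2) B(2) by blast
        ultimately show ?thesis by linarith
      qed (use p(2) in blast)
    qed
    then show ?thesis unfolding ch_def by (rule someI)
  qed
  define S where "S = rec_nat {} (\<lambda>n A. insert (ch A) A)"
  have S0: "S 0 = {}" and S1: "S (Suc n) = insert (ch (S n)) (S n)" for n by (simp_all add: S_def)
  have finS: "finite (S n)" for n by (induction n) (auto simp: S0 S1)
  define e where "e = (\<lambda>n. ch (S n))"
  have Se: "S n = e ` {..<n}" for n by (induction n) (auto simp: S0 S1 e_def lessThan_Suc)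
  have eP: "e n \<in> P" "e n \<notin> S n" "\<And>q. q \<in> P \<Longrightarrow> q \<notin> S n \<Longrightarrow> d (fst (e n)) \<le> d (fst q)" for n
    using ch[OF finS] unfolding e_def by auto
  have inj: "inj e"
  proof (rule linorder_injI)
    fix x y :: nat assume "x < y"
    then have "e x \<in> S y" by (auto simp: Se)
    then show "e x \<noteq> e y" using eP(2)[of y] by metis
  qed
  have mono: "mono (\<lambda>k. d (fst (e k)))"
  proof (rule monoI)
    fix x y :: nat assume "x \<le> y"
    then have "S x \<subseteq> S y" by (auto simp: Se)
    then show "d (fst (e x)) \<le> d (fst (e y))" using eP(1,2)[of y] by (intro eP(3)) auto
  qed
  \<comment> \<open>A pair that is never chosen would bound the \<open>d\<close>-values of the
    infinitely many chosen pairs, against local finiteness.\<close>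
  have surj: "q \<in> range e" if q: "q \<in> P" for q
  proof (rule ccontr)
    assume "q \<notin> range e"
    then have "d (fst (e n)) \<le> d (fst q)" for n using q by (intro eP(3)) (auto simp: Se)
    then have "range e \<subseteq> {p \<in> P. d (fst p) \<le> d (fst q)}" using eP(1) by auto
    then have "finite (range e)" using finP[OF q] finite_subset by blast
    then show False using inj finite_imageD[of e UNIV] by simp
  qed
  show ?thesis
  proof (intro exI[of _ "\<lambda>k. fst (e k)"] conjI allI ballI mono)
    show "fst (e k) \<in> Z" for k using eP(1)[of k] by (auto simp: P_def)
    fix a assume a: "a \<in> Z"
    have "{k. fst (e k) = a} = e -` ({a} \<times> {..<m a})"
    proof (intro set_eqI iffI)
      fix k assume "k \<in> {k. fst (e k) = a}"
      then show "k \<in> e -` ({a} \<times> {..<m a})" using eP(1)[of k] by (auto simp: P_def mem_Times_iff)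
    qed auto
    also have "card \<dots> = card ({a} \<times> {..<m a})"
      using a surj by (intro card_vimage_inj inj) (auto simp: P_def)
    finally show "card {k. fst (e k) = a} = m a" by simp
  qed
qed

lemma zero_mult_pos:
  assumes f: "f holomorphic_on ball 0 1" and "f v \<noteq> 0" "cmod v < 1" and w: "cmod w < 1" "f w = 0"
  shows "zero_mult f w > 0"
proof -
  have "\<exists>w\<in>ball 0 1. f w \<noteq> 0" using assms(2,3) by auto
  then show ?thesis using zorder_exist_zero[OF f, of w] w by (simp add: zero_mult_def)
qed

text \<open>The deterministic half of the argument, for a single holomorphic function whose
  potential has the right asymptotics along the chosen radii. Through \<open>ord\<close> it serves
  \<open>cmod\<close> with \<open>\<zeta> = 0\<close> and \<open>hyp_dist \<zeta>\<close>
  alike.\<close>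

theorem zeros_from_jensen:
  fixes f :: "complex \<Rightarrow> complex" and d :: "complex \<Rightarrow> real"
  assumes z: "cmod \<zeta> < 1" and f: "f holomorphic_on ball 0 1" "f \<zeta> \<noteq> 0" and rho: "\<rho> > 0" and p: "p > 0"
    and ord: "\<And>v w. cmod v < 1 \<Longrightarrow> cmod w < 1 \<Longrightarrow> d v \<le> d w \<longleftrightarrow> cmod (mob \<zeta> v) \<le> cmod (mob \<zeta> w)"
    and lim: "(\<lambda>j. (\<Sum>a\<in>hzeros f \<zeta> (sqrt (1 - real (j + 2) powr (-p))). real (zero_mult f a) * ln (sqrt (1 - real (j + 2) powr (-p)) / cmod (mob \<zeta> a)))
        + \<rho> / 2 * ln (real (j + 2) powr (-p))
        + (ln (cmod (f \<zeta>)) + \<rho> / 2 * ln (1 - (cmod \<zeta>)\<^sup>2) + euler_mascheroni / 2)) \<longlonglongrightarrow> 0"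
  shows "\<exists>z. zero_enum f d z"
    and "zero_enum f d z \<Longrightarrow> (\<lambda>n. c_rho \<rho> * (1 - (cmod \<zeta>)\<^sup>2) powr (- \<rho> / 2) *
           (\<Prod>k<n. exp (\<rho> / (2 * real (Suc k))) * cmod ((z k - \<zeta>) / (1 - cnj \<zeta> * z k)))) \<longlonglongrightarrow> cmod (f \<zeta>)"
proof -
  define C where "C = ln (cmod (f \<zeta>)) + \<rho> / 2 * ln (1 - (cmod \<zeta>)\<^sup>2) + euler_mascheroni / 2"
  define Z where "Z = {w. cmod w < 1 \<and> f w = 0}"
  define m where "m = zero_mult f"
  have mpos: "m a > 0" if "a \<in> Z" for a using zero_mult_pos[OF f z] that by (auto simp: m_def Z_def)
  have mob0: "cmod (mob \<zeta> a) > 0" "cmod (mob \<zeta> a) < 1" if "a \<in> Z" for a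
  proof -
    have "a \<noteq> \<zeta>" "cmod a < 1" using that f by (auto simp: Z_def)
    then show "cmod (mob \<zeta> a) > 0" "cmod (mob \<zeta> a) < 1" using mob_lt_1[OF z] mob_denom[OF z, of a] by (auto simp: mob_def)
  qed
  have fin: "finite (hzeros f \<zeta> r)" if "r < 1" for r by (rule finite_hzeros[OF z that f z])
  have hz: "hzeros f \<zeta> r = {a \<in> Z. cmod (mob \<zeta> a) \<le> r}" for r by (auto simp: hzeros_def Z_def)
  \<comment> \<open>With finitely many zeros the potential would stay bounded, while
    \<open>\<rho> / 2 * ln (1 - r\<^sup>2)\<close> tends to minus infinity.\<close>
  have infZ: "infinite Z"
  proof
    assume finZ: "finite Z"
    define B where "B = (\<Sum>a\<in>Z. real (m a) * ln (1 / cmod (mob \<zeta> a)))"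
    have *: "(\<Sum>a\<in>hzeros f \<zeta> r. real (m a) * ln (r / cmod (mob \<zeta> a))) \<le> B" if r: "0 < r" "r < 1" for r
    proof -
      have "(\<Sum>a\<in>hzeros f \<zeta> r. real (m a) * ln (r / cmod (mob \<zeta> a))) \<le> (\<Sum>a\<in>hzeros f \<zeta> r. real (m a) * ln (1 / cmod (mob \<zeta> a)))"
        using r mob0 by (intro sum_mono mult_left_mono) (auto simp: hz divide_right_mono)
      also have "\<dots> \<le> B" unfolding B_def
      proof (rule sum_mono2[OF finZ])
        fix b assume "b \<in> Z - hzeros f \<zeta> r"
        then show "0 \<le> real (m b) * ln (1 / cmod (mob \<zeta> b))" using mob0[of b] by simp
      qed (auto simp: hz)
      finally show ?thesis .
    qed
    have "filterlim (\<lambda>j::nat. \<rho> / 2 * p * ln (real (j + 2))) at_top sequentially"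
      using rho p by real_asymp
    then have "\<forall>\<^sub>F j in sequentially. \<rho> / 2 * p * ln (real (j + 2)) > B + C + 1"
      unfolding filterlim_at_top_dense by (rule spec)
    moreover have "\<forall>\<^sub>F j in sequentially. (\<Sum>a\<in>hzeros f \<zeta> (sqrt (1 - real (j + 2) powr (-p))). real (m a) * ln (sqrt (1 - real (j + 2) powr (-p)) / cmod (mob \<zeta> a)))
        + \<rho> / 2 * ln (real (j + 2) powr (-p)) + C > -1"
      using lim unfolding m_def C_def by (intro order_tendstoD) auto
    ultimately have "\<forall>\<^sub>F j::nat in sequentially. False"
    proof eventually_elim
      case (elim j)
      define x where "x = real (j + 2) powr (-p)"
      have x: "0 < x" "x < 1" using p by (auto simp: x_def powr_less_one)
      have "ln x = - p * ln (real (j + 2))" unfolding x_def by (simp add: ln_powr)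
      moreover have "(\<Sum>a\<in>hzeros f \<zeta> (sqrt (1 - x)). real (m a) * ln (sqrt (1 - x) / cmod (mob \<zeta> a))) \<le> B"
        using x by (intro *) auto
      ultimately show False using elim unfolding x_def[symmetric] by (simp add: algebra_simps)
    qed
    then show False by simp
  qed
  show "\<exists>z. zero_enum f d z"
  proof -
    have "finite {b \<in> Z. d b \<le> d a}" if a: "a \<in> Z" for a
    proof (rule finite_subset)
      show "{b \<in> Z. d b \<le> d a} \<subseteq> hzeros f \<zeta> (cmod (mob \<zeta> a))" using a ord unfolding hz by (auto simp: Z_def)
      show "finite (hzeros f \<zeta> (cmod (mob \<zeta> a)))" using mob0[OF a] by (intro fin)
    qed
    from enumerate_with_multiplicity[of Z m d, OF infZ mpos this]
    show ?thesis unfolding zero_enum_def by (auto simp: Z_def m_def)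
  qed
  assume en: "zero_enum f d z"
  have zk: "z k \<in> Z" for k using en by (auto simp: zero_enum_def Z_def)
  have cz: "card {k. z k = a} = m a" if "a \<in> Z" for a using en that by (auto simp: zero_enum_def Z_def m_def)
  define u where "u = (\<lambda>k. cmod (mob \<zeta> (z k)))"
  have finz: "finite {k. z k = a}" if "a \<in> Z" for a
    using cz[OF that] mpos[OF that] by (metis card.infinite less_irrefl)
  have lev: "{k. u k \<le> r} = (\<Union>a\<in>hzeros f \<zeta> r. {k. z k = a})" for r
    using zk by (auto simp: hz u_def)
  have finu: "finite {k. u k \<le> r}" if "r < 1" for r
    unfolding lev using fin[OF that] finz by (auto simp: hz)
  interpret U: zero_moduli u \<rho> C p
  proof
    show "0 < u k \<and> u k < 1" for k using mob0[OF zk] by (simp add: u_def)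
    show "mono u" using en ord zk unfolding zero_enum_def mono_def u_def Z_def by blast
  qed (use finu rho p in auto)
  have PU: "U.P r = (\<Sum>a\<in>hzeros f \<zeta> r. real (m a) * ln (r / cmod (mob \<zeta> a)))" if "r < 1" for r
  proof -
    have "U.P r = (\<Sum>a\<in>hzeros f \<zeta> r. \<Sum>k\<in>{k. z k = a}. ln (r / u k))"
      unfolding U.P_def lev using fin[OF that] finz by (intro sum.UNION_disjoint) (auto simp: hz)
    also have "\<dots> = (\<Sum>a\<in>hzeros f \<zeta> r. \<Sum>k\<in>{k. z k = a}. ln (r / cmod (mob \<zeta> a)))"
      by (intro sum.cong refl) (auto simp: u_def)
    also have "\<dots> = (\<Sum>a\<in>hzeros f \<zeta> r. real (m a) * ln (r / cmod (mob \<zeta> a)))"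
      using cz by (intro sum.cong refl) (auto simp: hz)
    finally show ?thesis .
  qed
  \<comment> \<open>The radii in \<open>lim\<close> start at index 2, since index 1 would give
    radius 0; \<open>zero_moduli\<close> counts from 1, and the shift does not affect the
    limit.\<close>
  have "(\<lambda>n. U.Q (real (Suc (Suc n)) powr (-p))) \<longlonglongrightarrow> 0"
  proof -
    have "sqrt (1 - real (j + 2) powr (-p)) < 1" for j by simp
    then show ?thesis using lim unfolding U.Q_def by (simp add: PU m_def C_def add_ac)
  qed
  then have "(\<lambda>n. U.Q (real (Suc n) powr (-p))) \<longlonglongrightarrow> 0"
    by (subst (asm) filterlim_sequentially_Suc[of "\<lambda>n. U.Q (real (Suc n) powr (-p))"])
  then have L: "(\<lambda>n. exp (\<Sum>k<n. \<rho> / (2 * real (Suc k)) + ln (u k))) \<longlonglongrightarrow> exp (C + \<rho> * euler_mascheroni / 2 - \<rho> / 2 + \<rho> / 2 * ln \<rho>)"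
    by (intro tendsto_exp U.product_limit)
  have E: "exp (\<Sum>k<n. \<rho> / (2 * real (Suc k)) + ln (u k)) = (\<Prod>k<n. exp (\<rho> / (2 * real (Suc k))) * u k)" for n
    using U.u01 by (simp add: exp_sum exp_add)
  have "(\<lambda>n. c_rho \<rho> * (1 - (cmod \<zeta>)\<^sup>2) powr (- \<rho> / 2) * (\<Prod>k<n. exp (\<rho> / (2 * real (Suc k))) * u k))
     \<longlonglongrightarrow> c_rho \<rho> * (1 - (cmod \<zeta>)\<^sup>2) powr (- \<rho> / 2) * exp (C + \<rho> * euler_mascheroni / 2 - \<rho> / 2 + \<rho> / 2 * ln \<rho>)"
    using L unfolding E by (intro tendsto_mult tendsto_const)
  moreover have "c_rho \<rho> * (1 - (cmod \<zeta>)\<^sup>2) powr (- \<rho> / 2) * exp (C + \<rho> * euler_mascheroni / 2 - \<rho> / 2 + \<rho> / 2 * ln \<rho>) = cmod (f \<zeta>)"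
  proof -
    have k: "1 - (cmod \<zeta>)\<^sup>2 > 0" using z by (simp add: abs_square_less_1)
    have "c_rho \<rho> * (1 - (cmod \<zeta>)\<^sup>2) powr (- \<rho> / 2) * exp (C + \<rho> * euler_mascheroni / 2 - \<rho> / 2 + \<rho> / 2 * ln \<rho>)
        = exp ((\<rho> - euler_mascheroni - euler_mascheroni * \<rho>) / 2 + (- \<rho> / 2) * ln \<rho> + (- \<rho> / 2) * ln (1 - (cmod \<zeta>)\<^sup>2)
            + (C + \<rho> * euler_mascheroni / 2 - \<rho> / 2 + \<rho> / 2 * ln \<rho>))"
    proof -
      have 1: "c_rho \<rho> = exp ((\<rho> - euler_mascheroni - euler_mascheroni * \<rho>) / 2) * exp ((- \<rho> / 2) * ln \<rho>)"
        using rho by (simp add: c_rho_def powr_def)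
      have 2: "(1 - (cmod \<zeta>)\<^sup>2) powr (- \<rho> / 2) = exp ((- \<rho> / 2) * ln (1 - (cmod \<zeta>)\<^sup>2))"
        using k by (simp add: powr_def)
      show ?thesis unfolding 1 2 by (simp only: exp_add[symmetric])
    qed
    also have "(\<rho> - euler_mascheroni - euler_mascheroni * \<rho>) / 2 + (- \<rho> / 2) * ln \<rho> + (- \<rho> / 2) * ln (1 - (cmod \<zeta>)\<^sup>2)
            + (C + \<rho> * euler_mascheroni / 2 - \<rho> / 2 + \<rho> / 2 * ln \<rho>) = ln (cmod (f \<zeta>))"
      by (simp add: C_def field_simps)
    finally show ?thesis using f by simp
  qed
  ultimately show "(\<lambda>n. c_rho \<rho> * (1 - (cmod \<zeta>)\<^sup>2) powr (- \<rho> / 2) *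
           (\<Prod>k<n. exp (\<rho> / (2 * real (Suc k))) * cmod ((z k - \<zeta>) / (1 - cnj \<zeta> * z k)))) \<longlonglongrightarrow> cmod (f \<zeta>)"
    by (simp add: u_def mob_def)
qed

section \<open>The Gaussian analytic function\<close>

text \<open>With \<open>v = cnj (cpt r \<alpha>) * cpt r \<beta>\<close>, of modulus
  \<open>r\<^sup>2\<close>, the Poisson kernel
  \<open>(1 - r\<^sup>4) / \<bar>1 - v\<bar>\<^sup>2\<close> is the real part of
  \<open>(1 + v) / (1 - v)\<close>. This function is holomorphic in the point
  \<open>cpt r \<beta>\<close> with value 1 at 0.\<close>

lemma poisson_mean:
  assumes q: "0 < r" "r < 1"
  shows "(LINT \<beta>|circ. (1 - r^2)\<^sup>2 / (cmod (1 - cpt r \<alpha> * cnj (cpt r \<beta>)))\<^sup>2) = (1 - r^2) / (1 + r^2)"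
proof -
  define w where "w = cnj (cpt r \<alpha>)"
  have nw: "cmod w = r" using q by (simp add: w_def)
  define g where "g = (\<lambda>z. (1 + w * z) / (1 - w * z))"
  have nz: "1 - w * z \<noteq> 0" if "cmod z < 1" for z
  proof -
    have "cmod (w * z) < 1" using mult_strict_mono'[of r 1 "cmod z" 1] q that by (simp add: norm_mult nw)
    then show ?thesis by (metis eq_iff_diff_eq_0 less_irrefl norm_one)
  qed
  have g: "g holomorphic_on ball 0 1" unfolding g_def using nz by (intro holomorphic_intros) auto
  have i: "integrable circ (\<lambda>t. g (cpt r t))"
    by (intro circ_integrable_continuous holomorphic_cpt_continuous[OF g q])
  have m: "(LINT t|circ. Re (g (cpt r t))) = 1"
    using integral_Re[OF i] holomorphic_mean_value[OF g q] by (simp add: g_def)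
  have "(1 - r^2)\<^sup>2 / (cmod (1 - cpt r \<alpha> * cnj (cpt r \<beta>)))\<^sup>2 = (1 - r^2) / (1 + r^2) * Re (g (cpt r \<beta>))" for \<beta>
  proof -
    define v where "v = w * cpt r \<beta>"
    have "(1 + v) / (1 - v) = (1 + v) * cnj (1 - v) / (of_real ((cmod (1 - v))\<^sup>2))"
      by (rule complex_div_cnj)
    then have "Re ((1 + v) / (1 - v)) = Re ((1 + v) * cnj (1 - v)) / (cmod (1 - v))\<^sup>2"
      by (simp only: Re_divide_of_real)
    also have "Re ((1 + v) * cnj (1 - v)) = 1 - (cmod v)\<^sup>2"
      unfolding cmod_power2 by (simp add: algebra_simps power2_eq_square)
    also have "cmod v = r^2" using q by (simp add: v_def norm_mult nw power2_eq_square)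
    finally have "Re (g (cpt r \<beta>)) = (1 - (r^2)\<^sup>2) / (cmod (1 - v))\<^sup>2" by (simp add: g_def v_def)
    moreover have "cmod (1 - cpt r \<alpha> * cnj (cpt r \<beta>)) = cmod (1 - v)"
      by (subst complex_mod_cnj[symmetric]) (simp add: v_def w_def)
    moreover have "1 + r^2 > 0" by (simp add: add_pos_nonneg)
    moreover have "(1 - (r^2)\<^sup>2) = (1 - r^2) * (1 + r^2)" by (simp add: power2_eq_square algebra_simps)
    ultimately show ?thesis by (simp add: power2_eq_square)
  qed
  then show ?thesis using m by simp
qed

text \<open>The squared modulus of the correlation of the normalised field at two points of the
  circle. For \<open>0 < r < 1\<close> the base of the power is one minus the squared
  pseudohyperbolic distance of these points.\<close>

definition corr :: "real \<Rightarrow> real \<Rightarrow> real \<Rightarrow> real \<Rightarrow> real" where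
  "corr \<rho> r \<alpha> \<beta> = ((1 - r^2)\<^sup>2 / (cmod (1 - cpt r \<alpha> * cnj (cpt r \<beta>)))\<^sup>2) powr \<rho>"

lemma corr_base:
  assumes q: "0 < r" "r < 1"
  shows "0 < (1 - r^2)\<^sup>2 / (cmod (1 - cpt r \<alpha> * cnj (cpt r \<beta>)))\<^sup>2"
    and "(1 - r^2)\<^sup>2 / (cmod (1 - cpt r \<alpha> * cnj (cpt r \<beta>)))\<^sup>2 \<le> 1"
proof -
  have n: "cmod (cpt r \<alpha> * cnj (cpt r \<beta>)) = r^2" using q by (simp add: norm_mult power2_eq_square)
  have r2: "r^2 < 1" using q by (simp add: power_less_one_iff)
  have "1 - r^2 \<le> cmod (1 - cpt r \<alpha> * cnj (cpt r \<beta>))"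
    using norm_triangle_ineq2[of 1 "cpt r \<alpha> * cnj (cpt r \<beta>)"] by (simp only: n norm_one)
  moreover from this have "cmod (1 - cpt r \<alpha> * cnj (cpt r \<beta>)) > 0" using r2 by linarith
  ultimately show "0 < (1 - r^2)\<^sup>2 / (cmod (1 - cpt r \<alpha> * cnj (cpt r \<beta>)))\<^sup>2"
    "(1 - r^2)\<^sup>2 / (cmod (1 - cpt r \<alpha> * cnj (cpt r \<beta>)))\<^sup>2 \<le> 1"
    using r2 by (auto simp: divide_le_eq_1 intro!: power_mono divide_pos_pos)
qed

text \<open>The base \<open>Y\<close> lies in \<open>(0, 1]\<close>, so the exponent may be lowered
  to \<open>s = min \<rho> 1\<close>. Splitting at the level \<open>l = 1 - r\<^sup>2\<close> gives
  \<open>Y powr s \<le> l powr s + Y * l powr (s - 1)\<close>, and the mean of \<open>Y\<close> is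
  at most \<open>l\<close>; hence the factor 2.\<close>

lemma corr_mean:
  assumes q: "0 < r" "r < 1" and rho: "\<rho> > 0"
  shows "(LINT \<beta>|circ. corr \<rho> r \<alpha> \<beta>) \<le> 2 * (1 - r^2) powr (min \<rho> 1)"
proof -
  interpret C: prob_space circ by (rule prob_space_circ)
  define s where "s = min \<rho> 1"
  have s: "0 < s" "s \<le> 1" "s \<le> \<rho>" using rho by (auto simp: s_def)
  define l where "l = 1 - r^2"
  have l: "0 < l" "l < 1" using q by (auto simp: l_def power_less_one_iff)
  define Y where "Y = (\<lambda>\<beta>. (1 - r^2)\<^sup>2 / (cmod (1 - cpt r \<alpha> * cnj (cpt r \<beta>)))\<^sup>2)"
  have Y: "0 < Y \<beta>" "Y \<beta> \<le> 1" for \<beta> unfolding Y_def using corr_base[OF q] by auto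
  have Ym: "Y \<in> borel_measurable circ" unfolding Y_def
    by (simp add: measurable_cong_sets[OF sets_circ refl] cmod_power2)
  have Yi: "integrable circ Y" using Y Ym by (intro C.integrable_const_bound[of _ 1] AE_I2) (auto simp: abs_of_pos)
  have bd: "Y \<beta> powr \<rho> \<le> l powr s + Y \<beta> * l powr (s - 1)" for \<beta>
  proof -
    have "Y \<beta> powr \<rho> \<le> Y \<beta> powr s" using Y[of \<beta>] s by (intro powr_mono') auto
    also have "\<dots> \<le> l powr s + Y \<beta> * l powr (s - 1)"
    proof (cases "Y \<beta> \<le> l")
      case True
      then have "Y \<beta> powr s \<le> l powr s" using Y[of \<beta>] s by (intro powr_mono2) auto
      then show ?thesis using Y[of \<beta>] by (simp add: add_increasing2)
    next
      case False
      have "Y \<beta> powr s = Y \<beta> * Y \<beta> powr (s - 1)" using Y[of \<beta>] by (simp add: powr_diff)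
      also have "\<dots> \<le> Y \<beta> * l powr (s - 1)" using Y[of \<beta>] l s False by (intro mult_left_mono powr_mono2') auto
      finally show ?thesis by (simp add: add_increasing)
    qed
    finally show ?thesis .
  qed
  have pm: "(\<lambda>\<beta>. Y \<beta> powr \<rho>) \<in> borel_measurable circ" using Ym by measurable
  have "(LINT \<beta>|circ. Y \<beta> powr \<rho>) \<le> (LINT \<beta>|circ. l powr s + Y \<beta> * l powr (s - 1))"
  proof (rule integral_mono)
    have "Y \<beta> powr \<rho> \<le> 1" for \<beta> using Y[of \<beta>] rho by (intro powr_le1) auto
    then show "integrable circ (\<lambda>\<beta>. Y \<beta> powr \<rho>)"
      using pm by (intro C.integrable_const_bound[of _ 1] AE_I2) auto
  qed (use Yi bd in auto)
  also have "\<dots> = l powr s + (l / (1 + r^2)) * l powr (s - 1)"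
  proof -
    have "(LINT \<beta>|circ. Y \<beta>) = l / (1 + r^2)" unfolding Y_def l_def by (rule poisson_mean[OF q])
    then show ?thesis using Yi C.prob_space by simp
  qed
  also have "\<dots> \<le> l powr s + l * l powr (s - 1)"
  proof -
    have "l / (1 + r^2) \<le> l / 1" using l by (intro divide_left_mono) (auto simp: add_pos_nonneg)
    then have "l / (1 + r^2) * l powr (s - 1) \<le> l / 1 * l powr (s - 1)" by (rule mult_right_mono) simp
    then show ?thesis by simp
  qed
  also have "\<dots> = 2 * l powr s" using l by (simp add: powr_diff)
  finally show ?thesis by (simp add: corr_def Y_def l_def s_def)
qed

section \<open>Covariance and almost sure convergence of the power series\<close>

locale gaf_seq = gauss_seq M a for M :: "'w measure" and a +
  fixes s :: "nat \<Rightarrow> complex" and \<rho> :: real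
  assumes rho: "\<rho> > 0" and s: "\<And>n. s n ^ 2 = complex_of_real ((- \<rho>) gchoose n)"
begin

text \<open>The sign makes the right side \<open>pochhammer \<rho> n / fact n\<close>, which is
  nonnegative. Covariances see \<open>s n\<close> only through this modulus, so the choice of square
  root is immaterial.\<close>

lemma norm_s: "(cmod (s n))\<^sup>2 = (-1)^n * ((- \<rho>) gchoose n)"
proof -
  have "(cmod (s n))\<^sup>2 = cmod (s n ^ 2)" by (simp add: norm_power)
  also have "\<dots> = \<bar>(- \<rho>) gchoose n\<bar>" by (simp add: s)
  also have "(- \<rho>) gchoose n = (-1)^n * (pochhammer \<rho> n / fact n)" by (simp add: gbinomial_pochhammer)
  finally have "(cmod (s n))\<^sup>2 = \<bar>(-1)^n * (pochhammer \<rho> n / fact n)\<bar>" .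
  also have "\<dots> = pochhammer \<rho> n / fact n"
    using pochhammer_nonneg[OF rho, of n] by (simp add: abs_mult)
  also have "\<dots> = (-1)^n * ((- \<rho>) gchoose n)" by (simp add: gbinomial_pochhammer mult.assoc[symmetric] flip: power_add mult_2)
  finally show ?thesis .
qed

lemma cov_sums:
  assumes "cmod u < 1"
  shows "(\<lambda>n. of_real ((cmod (s n))\<^sup>2) * u ^ n) sums ((1 - u) powr (of_real (- \<rho>)))"
proof -
  have "(\<lambda>n. ((of_real (- \<rho>)) gchoose n) * (- u) ^ n) sums ((1 + - u) powr (of_real (- \<rho>)))"
    using assms by (intro gen_binomial_complex) simp
  moreover have "((of_real (- \<rho>)) gchoose n) * (- u) ^ n = of_real ((cmod (s n))\<^sup>2) * u ^ n" for n
  proof -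
    have "complex_of_real ((- \<rho>) gchoose n) = (of_real (- \<rho>)) gchoose n"
      by (simp add: gbinomial_pochhammer flip: pochhammer_of_real)
    then show ?thesis unfolding norm_s by (simp add: power_minus[of u] mult_ac)
  qed
  ultimately show ?thesis by simp
qed

lemma norm_cov: "cmod u < 1 \<Longrightarrow> cmod ((1 - u) powr (of_real (- \<rho>))) = cmod (1 - u) powr (- \<rho>)"
  by (subst norm_powr_real_powr') auto

lemma var_sums:
  assumes "cmod z < 1"
  shows "(\<lambda>n. (cmod (s n * z ^ n))\<^sup>2) sums ((1 - (cmod z)\<^sup>2) powr (- \<rho>))"
proof -
  have z2: "(cmod z)\<^sup>2 < 1" using assms by (simp add: power_less_one_iff)
  have "(\<lambda>n. Re (of_real ((cmod (s n))\<^sup>2) * (of_real ((cmod z)\<^sup>2)) ^ n)) sums Re ((1 - of_real ((cmod z)\<^sup>2)) powr (of_real (- \<rho>)))"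
    by (intro sums_Re cov_sums) (unfold norm_of_real, use z2 in simp)
  moreover have "Re (of_real ((cmod (s n))\<^sup>2) * (of_real ((cmod z)\<^sup>2)) ^ n) = (cmod (s n * z ^ n))\<^sup>2" for n
    by (simp add: norm_mult norm_power power_mult_distrib power_mult[symmetric] mult.commute flip: of_real_mult of_real_power)
  moreover have "(1 - complex_of_real ((cmod z)\<^sup>2)) powr (of_real (- \<rho>)) = of_real ((1 - (cmod z)\<^sup>2) powr (- \<rho>))"
    using z2 by (subst powr_of_real[symmetric]) auto
  ultimately show ?thesis by simp
qed

text \<open>Uniformly bounded first moments are enough for almost sure absolute convergence of the
  series.\<close>

lemma a_abs: "\<exists>B. \<forall>n. integrable M (\<lambda>w. cmod (a n w)) \<and> (LINT w|M. cmod (a n w)) \<le> B"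
proof -
  have i: "integrable cgauss (\<lambda>g. cmod g)"
  proof -
    have "integrable lborel (\<lambda>g. exp (- (1/2) * (cmod g)\<^sup>2 - 2 * Re (0 * cnj g)))"
      using cgauss_laplace[of "1/2" 0] by (auto simp: has_bochner_integral_iff)
    then have "integrable lborel (\<lambda>g. exp (- (1/2) * (cmod g)\<^sup>2))" by simp
    then have "integrable lborel (\<lambda>g. (exp (- ((cmod g)\<^sup>2)) / pi) *\<^sub>R cmod g)"
    proof (rule Bochner_Integration.integrable_bound)
      show "AE g::complex in lborel. norm ((exp (- ((cmod g)\<^sup>2)) / pi) *\<^sub>R cmod g) \<le> norm (exp (- (1/2) * (cmod g)\<^sup>2))"
      proof (rule AE_I2)
        fix g :: complex
        define x where "x = cmod g"
        have "x \<le> 1 + x\<^sup>2 / 2" using sum_squares_bound[of x 1] zero_le_power2[of x] by (simp add: power2_eq_square)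
        also have "\<dots> \<le> exp (x\<^sup>2 / 2)" using exp_ge_add_one_self[of "x\<^sup>2 / 2"] by simp
        finally have "exp (- (x\<^sup>2)) * x \<le> exp (- (x\<^sup>2)) * exp (x\<^sup>2 / 2)" by (intro mult_left_mono) auto
        also have "\<dots> = exp (- (1/2) * x\<^sup>2)" by (simp flip: exp_add)
        finally have "exp (- (x\<^sup>2)) * x \<le> exp (- (1/2) * x\<^sup>2)" .
        moreover have "exp (- (x\<^sup>2)) * x / pi \<le> exp (- (x\<^sup>2)) * x / 1"
          using pi_gt3 by (intro divide_left_mono) (auto simp: x_def)
        ultimately show "norm ((exp (- ((cmod g)\<^sup>2)) / pi) *\<^sub>R cmod g) \<le> norm (exp (- (1/2) * (cmod g)\<^sup>2))"
          by (simp add: x_def)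
      qed
    qed simp
    then show ?thesis unfolding cgauss_alt by (subst integrable_density) auto
  qed
  have "integrable M (\<lambda>w. cmod (a n w))" for n
  proof -
    have "integrable (distr M lborel (a n)) cmod" using i by (simp add: distributed_distr_eq_density[OF dist])
    then show ?thesis by (subst (asm) integrable_distr_eq) auto
  qed
  moreover have "(LINT w|M. cmod (a n w)) = (LINT g|cgauss. cmod g)" for n
    by (rule a_integral) simp
  ultimately show ?thesis by auto
qed

text \<open>For a fixed radius the expected sum of absolute values is finite. The radii
  \<open>1 - 1 / (k + 2)\<close> exhaust the disc, so one null set serves all
  \<open>z\<close>.\<close>

lemma AE_summable: "AE w in M. \<forall>z. cmod z < 1 \<longrightarrow> summable (\<lambda>n. norm (s n * a n w * z ^ n))"
proof -
  obtain B where B: "\<And>n. integrable M (\<lambda>w. cmod (a n w))" "\<And>n. (LINT w|M. cmod (a n w)) \<le> B" using a_abs by blast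
  have S: "AE w in M. summable (\<lambda>n. cmod (s n) * r ^ n * cmod (a n w))" if r: "0 < r" "r < 1" for r
  proof -
    have sr: "summable (\<lambda>n. cmod (s n) * r ^ n)"
    proof (rule summable_comparison_test')
      \<comment> \<open>With \<open>q\<^sup>2 = r\<close> and
        \<open>\<bar>s n\<bar> \<le> \<bar>s n\<bar>\<^sup>2 + 1\<close> the series is dominated by
        the variance series at \<open>q\<close> plus a geometric one.\<close>
      define q where "q = sqrt r"
      have q: "0 < q" "q < 1" "q^2 = r" using r by (auto simp: q_def)
      have "summable (\<lambda>n. (cmod (s n * (of_real q) ^ n))\<^sup>2)"
        using var_sums[of "of_real q"] q by (auto simp: sums_iff)
      moreover have "summable (\<lambda>n. r ^ n)" using r by (intro summable_geometric) auto
      ultimately show "summable (\<lambda>n. (cmod (s n * (of_real q) ^ n))\<^sup>2 + r ^ n)" by (rule summable_add)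
      fix n
      have "2 * cmod (s n) \<le> (cmod (s n))\<^sup>2 + 1" using sum_squares_bound[of "cmod (s n)" 1] by simp
      moreover have "0 \<le> (cmod (s n))\<^sup>2" by simp
      ultimately have "cmod (s n) \<le> (cmod (s n))\<^sup>2 + 1" by linarith
      then have "cmod (s n) * r ^ n \<le> ((cmod (s n))\<^sup>2 + 1) * r ^ n" using r by (intro mult_right_mono) auto
      also have "\<dots> = (cmod (s n * (of_real q) ^ n))\<^sup>2 + r ^ n"
        using q by (simp add: norm_mult norm_power power_mult_distrib algebra_simps flip: power_mult q(3))
      finally show "norm (cmod (s n) * r ^ n) \<le> (cmod (s n * (of_real q) ^ n))\<^sup>2 + r ^ n" using r by simp
    qed
    have "(\<integral>\<^sup>+ w. (\<Sum>n. ennreal (cmod (s n) * r ^ n * cmod (a n w))) \<partial>M) = (\<Sum>n. \<integral>\<^sup>+ w. ennreal (cmod (s n) * r ^ n * cmod (a n w)) \<partial>M)"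
      by (rule nn_integral_suminf) simp
    also have "\<dots> \<le> (\<Sum>n. ennreal (cmod (s n) * r ^ n * B))"
    proof (rule suminf_le)
      fix n
      have "(\<integral>\<^sup>+ w. ennreal (cmod (s n) * r ^ n * cmod (a n w)) \<partial>M) = ennreal (LINT w|M. cmod (s n) * r ^ n * cmod (a n w))"
        using B r by (intro nn_integral_eq_integral) auto
      also have "\<dots> \<le> ennreal (cmod (s n) * r ^ n * B)"
        using B r by (intro ennreal_leI) (auto intro!: mult_left_mono)
      finally show "(\<integral>\<^sup>+ w. ennreal (cmod (s n) * r ^ n * cmod (a n w)) \<partial>M) \<le> ennreal (cmod (s n) * r ^ n * B)" .
    qed auto
    also have "\<dots> < \<infinity>"
    proof -
      have "B \<ge> 0" using B(2)[of 0] by (meson Bochner_Integration.integral_nonneg norm_ge_zero order_trans)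
      then show ?thesis using r sr by (subst suminf_ennreal2) (auto intro!: summable_mult2)
    qed
    finally have "(\<integral>\<^sup>+ w. (\<Sum>n. ennreal (cmod (s n) * r ^ n * cmod (a n w))) \<partial>M) \<noteq> \<infinity>" by simp
    then have "AE w in M. (\<Sum>n. ennreal (cmod (s n) * r ^ n * cmod (a n w))) \<noteq> \<infinity>"
      by (intro nn_integral_noteq_infinite) auto
    then show ?thesis
      by eventually_elim (use r in \<open>auto intro!: summable_suminf_not_top\<close>)
  qed
  have "AE w in M. \<forall>k. summable (\<lambda>n. cmod (s n) * (1 - 1 / real (k + 2)) ^ n * cmod (a n w))"
    unfolding AE_all_countable by (intro allI S) (auto simp: field_simps)
  then show ?thesis
  proof eventually_elim
    case (elim w)
    show ?case
    proof (intro allI impI)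
      fix z :: complex assume z: "cmod z < 1"
      have "(\<lambda>k. 1 - 1 / real (k + 2)) \<longlonglongrightarrow> 1" by real_asymp
      then have "\<forall>\<^sub>F k in sequentially. cmod z < 1 - 1 / real (k + 2)" using z by (intro order_tendstoD)
      then obtain k where k: "cmod z < 1 - 1 / real (k + 2)" by (auto simp: eventually_sequentially)
      show "summable (\<lambda>n. norm (s n * a n w * z ^ n))"
      proof (rule summable_comparison_test')
        show "summable (\<lambda>n. cmod (s n) * (1 - 1 / real (k + 2)) ^ n * cmod (a n w))" using elim by blast
        fix n
        have "cmod (s n) * cmod z ^ n * cmod (a n w) \<le> cmod (s n) * (1 - 1 / real (k + 2)) ^ n * cmod (a n w)"
          using k by (intro mult_right_mono mult_left_mono power_mono) auto
        then show "norm (norm (s n * a n w * z ^ n)) \<le> cmod (s n) * (1 - 1 / real (k + 2)) ^ n * cmod (a n w)"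
          by (simp add: norm_mult norm_power mult_ac)
      qed
    qed
  qed
qed

lemma AE_gaf_sums: "AE w in M. \<forall>z. cmod z < 1 \<longrightarrow> (\<lambda>n. s n * a n w * z ^ n) sums gaf s a w z"
  using AE_summable by eventually_elim (auto simp: gaf_def intro: summable_sums summable_norm_cancel)

lemma AE_gaf_holomorphic: "AE w in M. gaf s a w holomorphic_on ball 0 1"
  using AE_gaf_sums
proof eventually_elim
  case (elim w)
  show ?case
    by (rule power_series_holomorphic[where a = "\<lambda>n. s n * a n w"]) (use elim in auto)
qed

lemma gaf_measurable: "(\<lambda>(w, z). gaf s a w z) \<in> borel_measurable (M \<Otimes>\<^sub>M borel)"
  unfolding gaf_def by measurable

end

section \<open>The normalised field and its circle means\<close>

context gaf_seq
begin

definition coef :: "complex \<Rightarrow> nat \<Rightarrow> complex" where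
  "coef z n = of_real ((1 - (cmod z)\<^sup>2) powr (\<rho> / 2)) * (s n * z ^ n)"

definition ngaf :: "complex \<Rightarrow> 'w \<Rightarrow> complex" where
  "ngaf z w = of_real ((1 - (cmod z)\<^sup>2) powr (\<rho> / 2)) * gaf s a w z"

definition ncov :: "complex \<Rightarrow> complex \<Rightarrow> complex" where
  "ncov z u = of_real ((1 - (cmod z)\<^sup>2) powr (\<rho> / 2)) * of_real ((1 - (cmod u)\<^sup>2) powr (\<rho> / 2)) * (1 - z * cnj u) powr (of_real (- \<rho>))"

lemma coef_sums:
  assumes z: "cmod z < 1" shows "(\<lambda>n. (cmod (coef z n))\<^sup>2) sums 1"
proof -
  have k: "1 - (cmod z)\<^sup>2 > 0" using z by (simp add: abs_square_less_1)
  have "((1 - (cmod z)\<^sup>2) powr (\<rho> / 2))\<^sup>2 * (1 - (cmod z)\<^sup>2) powr (- \<rho>) = 1"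
    using k by (simp add: powr_power powr_add[symmetric])
  moreover have "(cmod (coef z n))\<^sup>2 = ((1 - (cmod z)\<^sup>2) powr (\<rho> / 2))\<^sup>2 * (cmod (s n * z ^ n))\<^sup>2" for n
    unfolding coef_def norm_mult norm_of_real power_mult_distrib by simp
  ultimately show ?thesis using sums_mult[OF var_sums[OF z], of "((1 - (cmod z)\<^sup>2) powr (\<rho> / 2))\<^sup>2"] by simp
qed

lemma ncov_sums:
  assumes z: "cmod z < 1" and u: "cmod u < 1" shows "(\<lambda>n. coef z n * cnj (coef u n)) sums ncov z u"
proof -
  have zu: "cmod (z * cnj u) < 1" using mult_strict_mono'[OF z u] by (simp add: norm_mult)
  have "coef z n * cnj (coef u n) = of_real ((1 - (cmod z)\<^sup>2) powr (\<rho> / 2)) * of_real ((1 - (cmod u)\<^sup>2) powr (\<rho> / 2))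
      * (of_real ((cmod (s n))\<^sup>2) * (z * cnj u) ^ n)" for n
    unfolding coef_def complex_norm_square by (simp add: power_mult_distrib mult_ac)
  then show ?thesis unfolding ncov_def using sums_mult[OF cov_sums[OF zu]] by simp
qed

lemma ngaf_sums: "AE w in M. \<forall>z. cmod z < 1 \<longrightarrow> (\<lambda>n. coef z n * a n w) sums ngaf z w"
  using AE_gaf_sums
proof eventually_elim
  case (elim w)
  show ?case
  proof (intro allI impI)
    fix z assume "cmod z < 1"
    then have "(\<lambda>n. s n * a n w * z ^ n) sums gaf s a w z" using elim by blast
    from sums_mult[OF this, of "of_real ((1 - (cmod z)\<^sup>2) powr (\<rho> / 2))"]
    show "(\<lambda>n. coef z n * a n w) sums ngaf z w" by (simp add: coef_def ngaf_def mult_ac)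
  qed
qed

lemma gaf_point_measurable[measurable]: "(\<lambda>w. gaf s a w z) \<in> borel_measurable M"
  unfolding gaf_def by measurable

lemma ngaf_point_measurable[measurable]: "ngaf z \<in> borel_measurable M"
  unfolding ngaf_def[abs_def] by measurable

text \<open>By Markov's argument the probability of a zero is at most
  \<open>E (exp (- k * \<bar>X\<bar>\<^sup>2)) = 1 / (1 + k)\<close> for every \<open>k\<close>,
  where \<open>X\<close> is the normalised value at \<open>z\<close>.\<close>

lemma AE_gaf_nonzero:
  assumes z: "cmod z < 1" shows "AE w in M. gaf s a w z \<noteq> 0"
proof -
  have S: "AE w in M. (\<lambda>n. coef z n * a n w) sums ngaf z w" using ngaf_sums z by auto
  define p where "p = prob {w \<in> space M. gaf s a w z = 0}"
  have "p \<le> 1 / (1 + real k)" for k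
  proof -
    have E: "(LINT w|M. exp (- real k * (cmod (ngaf z w))\<^sup>2 - 0 * (cmod (ngaf z w))\<^sup>2)) = 1 / (1 + real k)"
      using laplace_limit(1)[OF _ _ coef_sums[OF z] coef_sums[OF z] ncov_sums[OF z z] S S, of "real k" 0] by simp
    have i: "integrable M (\<lambda>w. exp (- real k * (cmod (ngaf z w))\<^sup>2))"
      by (rule integrable_const_bound[of _ 1]) auto
    have "p = (LINT w|M. indicator {w \<in> space M. gaf s a w z = 0} w)"
      unfolding p_def by simp
    also have "\<dots> \<le> (LINT w|M. exp (- real k * (cmod (ngaf z w))\<^sup>2))"
    proof (rule integral_mono[OF _ i])
      show "integrable M (indicator {w \<in> space M. gaf s a w z = 0} :: _ \<Rightarrow> real)"
        by (intro integrable_real_indicator) (auto simp: emeasure_eq_measure)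
    qed (auto simp: indicator_def ngaf_def)
    finally show ?thesis using E by simp
  qed
  moreover have "(\<lambda>k. 1 / (1 + real k)) \<longlonglongrightarrow> 0" by real_asymp
  ultimately have "p \<le> 0" by (intro LIMSEQ_le_const[of _ 0 p]) auto
  then have "p = 0" unfolding p_def by (simp add: measure_le_0_iff)
  then show ?thesis unfolding p_def by (subst (asm) prob_eq_0) auto
qed

text \<open>Disc automorphisms preserve the modulus of the correlation: the factors
  \<open>k\<close>, \<open>dx\<close> and \<open>dy\<close> contributed by \<open>\<zeta>\<close>
  cancel. This makes the estimates on circles around 0 valid for every centre.\<close>

lemma ncov_mob:
  assumes z: "cmod \<zeta> < 1" and r: "0 < r" "r < 1"
  shows "(cmod (ncov (mob (- \<zeta>) (cpt r \<alpha>)) (mob (- \<zeta>) (cpt r \<beta>))))\<^sup>2 = corr \<rho> r \<alpha> \<beta>"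
proof -
  define x y where "x = cpt r \<alpha>" and "y = cpt r \<beta>"
  have xy: "cmod x = r" "cmod y = r" using r by (auto simp: x_def y_def)
  then have xy1: "cmod x < 1" "cmod y < 1" using r by auto
  define k where "k = 1 - (cmod \<zeta>)\<^sup>2"
  have k: "k > 0" using z by (simp add: k_def abs_square_less_1)
  define q where "q = 1 - r^2"
  have q: "q > 0" using r by (simp add: q_def power_less_one_iff)
  define dx dy N where "dx = cmod (1 + cnj \<zeta> * x)" and "dy = cmod (1 + cnj \<zeta> * y)" and "N = cmod (1 - x * cnj y)"
  have "(1 - r^2)\<^sup>2 / N\<^sup>2 > 0" using corr_base(1)[OF r, of \<alpha> \<beta>] by (simp add: N_def x_def y_def)
  then have N: "N > 0" by (auto simp: N_def)
  have d: "dx > 0" "dy > 0" using mob_denom[OF z] xy1 by (auto simp: dx_def dy_def)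
  have A: "1 - (cmod (mob (- \<zeta>) x))\<^sup>2 = k * q / dx\<^sup>2" "1 - (cmod (mob (- \<zeta>) y))\<^sup>2 = k * q / dy\<^sup>2"
    using mob_norm[OF z] xy xy1 by (auto simp: k_def q_def dx_def dy_def)
  have mx: "cmod (mob (- \<zeta>) x) < 1" "cmod (mob (- \<zeta>) y) < 1" using mob_lt_1[of "- \<zeta>"] z xy1 by auto
  have "cmod (mob (- \<zeta>) x * cnj (mob (- \<zeta>) y)) < 1" using mult_strict_mono'[OF mx] by (simp add: norm_mult)
  note nc = norm_cov[OF this]
  have C: "cmod (1 - mob (- \<zeta>) x * cnj (mob (- \<zeta>) y)) = k * N / (dx * dy)"
    unfolding mob_cross[OF z xy1] k_def[symmetric] norm_divide norm_mult complex_mod_cnj dx_def dy_def N_def norm_of_real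
    using k by simp
  have "cmod (ncov (mob (- \<zeta>) x) (mob (- \<zeta>) y))
      = (k * q / dx\<^sup>2) powr (\<rho> / 2) * (k * q / dy\<^sup>2) powr (\<rho> / 2) * (k * N / (dx * dy)) powr (- \<rho>)"
    unfolding ncov_def norm_mult nc C A norm_of_real by simp
  also have "\<dots> = (q / N) powr \<rho>"
  proof -
    have "ln ((k * q / dx\<^sup>2) powr (\<rho> / 2) * (k * q / dy\<^sup>2) powr (\<rho> / 2) * (k * N / (dx * dy)) powr (- \<rho>)) = ln ((q / N) powr \<rho>)"
      using k q d N by (simp add: ln_mult ln_div ln_powr ln_realpow algebra_simps)
    then show ?thesis using k q d N by (subst (asm) ln_inj_iff) auto
  qed
  finally have "(cmod (ncov (mob (- \<zeta>) x) (mob (- \<zeta>) y)))\<^sup>2 = ((q / N) powr \<rho>)\<^sup>2" by simp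
  also have "\<dots> = ((q / N)\<^sup>2) powr \<rho>" unfolding power2_eq_square using q N by (subst powr_mult) auto
  finally show ?thesis by (simp add: corr_def x_def y_def N_def q_def power_divide)
qed

definition cmean :: "complex \<Rightarrow> real \<Rightarrow> nat \<Rightarrow> 'w \<Rightarrow> real" where
  "cmean \<zeta> r n w = (LINT t|circ. logapp n ((cmod (ngaf (mob (- \<zeta>) (cpt r t)) w))\<^sup>2))"

lemma mob_cpt_lt_1: "cmod \<zeta> < 1 \<Longrightarrow> 0 < r \<Longrightarrow> r < 1 \<Longrightarrow> cmod (mob (- \<zeta>) (cpt r t)) < 1"
  using mob_lt_1[of "- \<zeta>"] by simp

text \<open>The constant is \<open>4 * 2\<close>, the factor 4 from the two parameter integrals and
  2 from \<open>corr_mean\<close>.\<close>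

lemma cmean_second_moment:
  assumes z: "cmod \<zeta> < 1" and r: "0 < r" "r < 1"
  shows "(\<integral>\<^sup>+ w. ennreal ((cmean \<zeta> r n w)\<^sup>2) \<partial>M) \<le> ennreal (8 * (1 - r^2) powr (min \<rho> 1))"
    and "cmean \<zeta> r n \<in> borel_measurable M"
proof -
  note t1 = mob_cpt_lt_1[OF z r]
  have mobm: "mob (- \<zeta>) \<in> borel_measurable borel" unfolding mob_def[abs_def] by measurable
  have m1: "(\<lambda>(w, t). ngaf (mob (- \<zeta>) (cpt r t)) w) \<in> borel_measurable (M \<Otimes>\<^sub>M borel)"
  proof -
    have [measurable]: "(\<lambda>x. mob (- \<zeta>) (cpt r (snd x))) \<in> borel_measurable (M \<Otimes>\<^sub>M (borel :: real measure))"
      by (rule measurable_compose[OF _ mobm]) measurable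
    have "(\<lambda>x. (fst x, mob (- \<zeta>) (cpt r (snd x)))) \<in> measurable (M \<Otimes>\<^sub>M borel) (M \<Otimes>\<^sub>M borel)" by measurable
    from measurable_compose[OF this gaf_measurable]
    have [measurable]: "(\<lambda>x. gaf s a (fst x) (mob (- \<zeta>) (cpt r (snd x)))) \<in> borel_measurable (M \<Otimes>\<^sub>M borel)" by simp
    show ?thesis unfolding ngaf_def case_prod_beta by measurable
  qed
  have m2: "(\<lambda>(\<alpha>, \<beta>). corr \<rho> r \<alpha> \<beta>) \<in> borel_measurable (borel \<Otimes>\<^sub>M borel)"
    unfolding corr_def case_prod_beta cmod_power2 by simp
  have c1: "corr \<rho> r \<alpha> \<beta> \<le> 1" for \<alpha> \<beta>
    unfolding corr_def using corr_base[OF r, of \<alpha> \<beta>] rho by (intro powr_le1) auto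
  have S: "AE w in M. (\<lambda>n. coef (mob (- \<zeta>) (cpt r t)) n * a n w) sums ngaf (mob (- \<zeta>) (cpt r t)) w" for t
    using ngaf_sums t1[of t] by auto
  note C = circle_second_moment[OF coef_sums[OF t1] ncov_sums[OF t1 t1] S m1 m2 eq_refl[OF ncov_mob[OF z r]] c1 corr_mean[OF r rho]]
  show "(\<integral>\<^sup>+ w. ennreal ((cmean \<zeta> r n w)\<^sup>2) \<partial>M) \<le> ennreal (8 * (1 - r^2) powr (min \<rho> 1))"
    using C(1)[of n] by (simp add: cmean_def mult.assoc[symmetric])
  show "cmean \<zeta> r n \<in> borel_measurable M"
    using C(2)[of n] unfolding cmean_def[abs_def] .
qed

text \<open>The centred circle mean of \<open>ln \<bar>ngaf\<bar>\<^sup>2\<close>, that is the mean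
  plus Euler's constant, rewritten through Jensen's formula. The factor 2 comes from the squared
  modulus.\<close>

definition jlim :: "complex \<Rightarrow> real \<Rightarrow> 'w \<Rightarrow> real" where
  "jlim \<zeta> r w = 2 * ((\<Sum>b\<in>hzeros (gaf s a w) \<zeta> r. real (zero_mult (gaf s a w) b) * ln (r / cmod (mob \<zeta> b)))
     + \<rho> / 2 * ln (1 - r^2) + (ln (cmod (gaf s a w \<zeta>)) + \<rho> / 2 * ln (1 - (cmod \<zeta>)\<^sup>2) + euler_mascheroni / 2))"

lemma cmean_tendsto:
  assumes z: "cmod \<zeta> < 1" and r: "0 < r" "r < 1"
    and f: "gaf s a w holomorphic_on ball 0 1" "gaf s a w \<zeta> \<noteq> 0"
  shows "(\<lambda>n. cmean \<zeta> r n w) \<longlonglongrightarrow> jlim \<zeta> r w"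
proof -
  interpret C: prob_space circ by (rule prob_space_circ)
  define T where "T = (\<lambda>t. mob (- \<zeta>) (cpt r t))"
  have T1: "cmod (T t) < 1" for t unfolding T_def by (rule mob_cpt_lt_1[OF z r])
  have Te: "mob (- \<zeta>) (cpt r t) = T t" for t by (simp add: T_def)
  note J = jensen_mob[OF z r f, unfolded Te]
  define Y where "Y = (\<lambda>t. (cmod (ngaf (T t) w))\<^sup>2)"
  have Y0: "AE t in circ. Y t > 0"
    using J(3)
  proof eventually_elim
    case (elim t)
    have "1 - (cmod (T t))\<^sup>2 > 0" using T1[of t] by (simp add: abs_square_less_1)
    then show ?case using elim by (simp add: Y_def ngaf_def)
  qed
  define k where "k = 1 - (cmod \<zeta>)\<^sup>2"
  have k: "k > 0" using z by (simp add: k_def abs_square_less_1)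
  define q where "q = 1 - r^2"
  have q: "q > 0" using r by (simp add: q_def power_less_one_iff)
  \<comment> \<open>By \<open>mob_norm\<close> the normalising factor contributes the constants
    \<open>ln k\<close> and \<open>ln q\<close> and a denominator whose log mean vanishes; Jensen's
    formula covers the rest.\<close>
  let ?G = "\<lambda>t. 2 * ln (cmod (gaf s a w (T t))) + \<rho> * (ln k + ln q - 2 * ln (cmod (1 + cnj \<zeta> * cpt r t)))"
  have lnY: "AE t in circ. ln (Y t) = ?G t"
    using J(3)
  proof eventually_elim
    case (elim t)
    have c: "cmod (cpt r t) < 1" using r by simp
    have d: "cmod (1 + cnj \<zeta> * cpt r t) > 0" using mob_denom[OF z c] by simp
    have A: "1 - (cmod (T t))\<^sup>2 = k * q / (cmod (1 + cnj \<zeta> * cpt r t))\<^sup>2"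
      using mob_norm[OF z c] r by (simp add: T_def k_def q_def)
    have "ln (k * q / (cmod (1 + cnj \<zeta> * cpt r t))\<^sup>2) = ln k + ln q - 2 * ln (cmod (1 + cnj \<zeta> * cpt r t))"
      using k q d by (simp add: ln_div ln_mult ln_realpow)
    moreover have "Y t = (1 - (cmod (T t))\<^sup>2) powr \<rho> * (cmod (gaf s a w (T t)))\<^sup>2"
      by (simp add: Y_def ngaf_def norm_mult power_mult_distrib) (simp add: power2_eq_square flip: powr_add)
    moreover have "1 - (cmod (T t))\<^sup>2 > 0" using T1[of t] by (simp add: abs_square_less_1)
    ultimately show ?case using elim A k q d by (simp add: ln_mult ln_powr ln_realpow)
  qed
  have iG: "integrable circ ?G"
    using J(1) log_mean_denom(1)[OF z r] by simp
  have "continuous_on UNIV T"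
    unfolding T_def using z r mob_holomorphic[of "- \<zeta>"] by (intro holomorphic_cpt_continuous[of _ 1]) auto
  then have Tm[measurable]: "T \<in> borel_measurable borel" by (rule borel_measurable_continuous_onI)
  have "continuous_on UNIV (\<lambda>t. gaf s a w (T t))"
    by (rule continuous_on_compose2[OF holomorphic_on_imp_continuous_on[OF f(1)] \<open>continuous_on UNIV T\<close>]) (use T1 in auto)
  then have [measurable]: "(\<lambda>t. gaf s a w (T t)) \<in> borel_measurable borel" by (rule borel_measurable_continuous_onI)
  have Ym[measurable]: "Y \<in> borel_measurable circ"
    unfolding Y_def ngaf_def by (simp add: measurable_cong_sets[OF sets_circ refl])
  have ilnY: "integrable circ (\<lambda>t. ln (Y t))"
    by (rule iffD2[OF integrable_cong_AE[OF _ borel_measurable_integrable[OF iG] lnY] iG]) measurable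
  have IlnY: "(LINT t|circ. ln (Y t)) = jlim \<zeta> r w - euler_mascheroni"
  proof -
    have "(LINT t|circ. ln (Y t)) = (LINT t|circ. ?G t)"
      by (intro integral_cong_AE lnY borel_measurable_integrable[OF iG]) measurable
    also have "\<dots> = 2 * (LINT t|circ. ln (cmod (gaf s a w (T t)))) + \<rho> * (ln k + ln q)"
      using J(1) log_mean_denom[OF z r] C.prob_space by simp
    finally show ?thesis unfolding J(2) by (simp add: jlim_def k_def q_def algebra_simps)
  qed
  obtain B where B: "\<And>n y. y > 0 \<Longrightarrow> \<bar>logapp n y\<bar> \<le> B + \<bar>ln y\<bar>" using logapp_bound by blast
  have "(\<lambda>n. LINT t|circ. logapp n (Y t)) \<longlonglongrightarrow> (LINT t|circ. ln (Y t) + euler_mascheroni)"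
  proof (rule integral_dominated_convergence)
    show "integrable circ (\<lambda>t. B + \<bar>ln (Y t)\<bar>)" using ilnY by auto
    show "AE t in circ. (\<lambda>n. logapp n (Y t)) \<longlonglongrightarrow> ln (Y t) + euler_mascheroni"
      using Y0 by eventually_elim (rule logapp_tendsto)
    show "AE t in circ. norm (logapp n (Y t)) \<le> B + \<bar>ln (Y t)\<bar>" for n
      using Y0 by eventually_elim (use B in auto)
    show "(\<lambda>t. logapp n (Y t)) \<in> borel_measurable circ" for n
    proof -
      interpret R: finite_measure "trunc n" by (rule finite_measure_trunc)
      have m[measurable]: "(\<lambda>t. t) \<in> borel_measurable (trunc n)" by (rule borel_measurable_trunc) simp
      show ?thesis unfolding logapp_def by measurable
    qed
  qed measurable
  also have "(LINT t|circ. ln (Y t) + euler_mascheroni) = jlim \<zeta> r w"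
    using ilnY IlnY C.prob_space by simp
  finally show ?thesis by (simp add: cmean_def[abs_def] Y_def T_def)
qed

text \<open>The exponent \<open>p\<close> is chosen so that the second moments along these radii are
  at most \<open>8 / (j + 2)\<^sup>2\<close>. Summability then makes the series of the squares of
  \<open>jlim\<close> finite almost surely, so its terms tend to 0.\<close>

theorem AE_jlim:
  assumes z: "cmod \<zeta> < 1"
  defines "p \<equiv> 2 / min \<rho> 1"
  shows "AE w in M. (\<lambda>j. jlim \<zeta> (sqrt (1 - real (j + 2) powr (-p))) w) \<longlonglongrightarrow> 0"
proof -
  have mp: "min \<rho> 1 > 0" using rho by simp
  have p: "p > 0" using mp by (simp add: p_def)
  define r where "r = (\<lambda>j. sqrt (1 - real (j + 2) powr (-p)))"
  have x01: "0 < real (j + 2) powr (-p)" "real (j + 2) powr (-p) < 1" for j using p by (auto simp: powr_less_one)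
  have r: "0 < r j" "r j < 1" "1 - (r j)\<^sup>2 = real (j + 2) powr (-p)" for j
    using x01[of j] by (auto simp: r_def)
  have bd: "(1 - (r j)\<^sup>2) powr (min \<rho> 1) = 1 / (real (j + 2))\<^sup>2" for j
  proof -
    have "(1 - (r j)\<^sup>2) powr (min \<rho> 1) = real (j + 2) powr (- p * min \<rho> 1)" unfolding r(3) powr_powr ..
    also have "- p * min \<rho> 1 = - 2" using mp by (simp add: p_def)
    also have "real (j + 2) powr (- 2) = 1 / (real (j + 2))\<^sup>2"
      by (simp add: powr_minus divide_inverse powr_realpow[of "real (j + 2)" 2, simplified])
    finally show ?thesis .
  qed
  have good: "AE w in M. gaf s a w holomorphic_on ball 0 1 \<and> gaf s a w \<zeta> \<noteq> 0"
    using AE_gaf_holomorphic AE_gaf_nonzero[OF z] by eventually_elim auto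
  have [measurable]: "cmean \<zeta> (r j) n \<in> borel_measurable M" for j n by (rule cmean_second_moment(2)[OF z r(1,2)])
  \<comment> \<open>\<open>jlim\<close> sums over random zero sets; the lower limit is visibly
    measurable, is controlled by Fatou's lemma, and agrees almost surely with the square of
    \<open>jlim\<close>.\<close>
  define V where "V = (\<lambda>j w. liminf (\<lambda>n. ennreal ((cmean \<zeta> (r j) n w)\<^sup>2)))"
  have Vm[measurable]: "V j \<in> borel_measurable M" for j unfolding V_def by measurable
  have Vle: "(\<integral>\<^sup>+ w. V j w \<partial>M) \<le> ennreal (8 * (1 / (real (j + 2))\<^sup>2))" for j
  proof -
    have "(\<integral>\<^sup>+ w. V j w \<partial>M) \<le> liminf (\<lambda>n. \<integral>\<^sup>+ w. ennreal ((cmean \<zeta> (r j) n w)\<^sup>2) \<partial>M)"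
      unfolding V_def by (rule nn_integral_liminf) measurable
    also have "\<dots> \<le> liminf (\<lambda>n::nat. ennreal (8 * (1 / (real (j + 2))\<^sup>2)))"
      using cmean_second_moment(1)[OF z r(1,2)] unfolding bd by (intro Liminf_mono always_eventually allI)
    finally show ?thesis by (simp add: Liminf_const)
  qed
  have "(\<integral>\<^sup>+ w. (\<Sum>j. V j w) \<partial>M) = (\<Sum>j. \<integral>\<^sup>+ w. V j w \<partial>M)"
    by (rule nn_integral_suminf) measurable
  also have "\<dots> \<le> (\<Sum>j. ennreal (8 * (1 / (real (j + 2))\<^sup>2)))" by (intro suminf_le Vle) auto
  also have "\<dots> < \<infinity>"
  proof -
    have "summable (\<lambda>j. 1 / (real (j + 2))\<^sup>2)"
      using summable_iff_shift[of "\<lambda>n. 1 / (real n)\<^sup>2" 2] inverse_power_summable[of 2, where 'a = real]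
      by (simp add: divide_inverse)
    then have "summable (\<lambda>j. 8 * (1 / (real (j + 2))\<^sup>2))" by (rule summable_mult)
    then show ?thesis by (subst suminf_ennreal2) auto
  qed
  finally have "(\<integral>\<^sup>+ w. (\<Sum>j. V j w) \<partial>M) \<noteq> \<infinity>" by simp
  then have "AE w in M. (\<Sum>j. V j w) \<noteq> \<infinity>" by (intro nn_integral_noteq_infinite) measurable
  with good show ?thesis
  proof eventually_elim
    case (elim w)
    have V: "V j w = ennreal ((jlim \<zeta> (r j) w)\<^sup>2)" for j
    proof -
      have "(\<lambda>n. ennreal ((cmean \<zeta> (r j) n w)\<^sup>2)) \<longlonglongrightarrow> ennreal ((jlim \<zeta> (r j) w)\<^sup>2)"
        using elim by (intro tendsto_ennrealI tendsto_power cmean_tendsto[OF z r(1,2)]) auto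
      then show ?thesis unfolding V_def using lim_imp_Liminf[OF sequentially_bot] by metis
    qed
    have "summable (\<lambda>j. (jlim \<zeta> (r j) w)\<^sup>2)"
      using elim by (intro summable_suminf_not_top) (auto simp: V)
    then have "(\<lambda>j. (jlim \<zeta> (r j) w)\<^sup>2) \<longlonglongrightarrow> 0" by (rule summable_LIMSEQ_zero)
    then have "(\<lambda>j. sqrt ((jlim \<zeta> (r j) w)\<^sup>2)) \<longlonglongrightarrow> sqrt 0" by (rule tendsto_real_sqrt)
    then have "(\<lambda>j. \<bar>jlim \<zeta> (r j) w\<bar>) \<longlonglongrightarrow> 0" by simp
    then show ?case unfolding r_def by (rule tendsto_rabs_zero_cancel)
  qed
qed

text \<open>The ordering function is quantified inside the almost sure statement, so the exceptional
  set depends on \<open>\<zeta>\<close> only.\<close>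

theorem AE_product:
  assumes z: "cmod \<zeta> < 1"
  shows "AE w in M. \<forall>d. (\<forall>v u. cmod v < 1 \<longrightarrow> cmod u < 1 \<longrightarrow> d v \<le> d u \<longleftrightarrow> cmod (mob \<zeta> v) \<le> cmod (mob \<zeta> u)) \<longrightarrow>
     (\<exists>z. zero_enum (gaf s a w) d z) \<and>
     (\<forall>z. zero_enum (gaf s a w) d z \<longrightarrow> (\<lambda>n. c_rho \<rho> * (1 - (cmod \<zeta>)\<^sup>2) powr (- \<rho> / 2) *
           (\<Prod>k<n. exp (\<rho> / (2 * real (Suc k))) * cmod ((z k - \<zeta>) / (1 - cnj \<zeta> * z k)))) \<longlonglongrightarrow> cmod (gaf s a w \<zeta>))"
  using AE_jlim[OF z] AE_gaf_holomorphic AE_gaf_nonzero[OF z]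
proof eventually_elim
  case (elim w)
  define p where "p = 2 / min \<rho> 1"
  have p: "p > 0" using rho by (simp add: p_def)
  have x1: "real (j + 2) powr (-p) < 1" for j using p by (auto simp: powr_less_one)
  have "(\<lambda>j. jlim \<zeta> (sqrt (1 - real (j + 2) powr (-p))) w / 2) \<longlonglongrightarrow> 0 / 2"
    using elim(1) unfolding p_def by (intro tendsto_intros) auto
  then have "(\<lambda>j. jlim \<zeta> (sqrt (1 - real (j + 2) powr (-p))) w / 2) \<longlonglongrightarrow> 0" by simp
  moreover have two: "(2::real) \<noteq> 0" by simp
  moreover have sq: "1 - (sqrt (1 - real (j + 2) powr (-p)))\<^sup>2 = real (j + 2) powr (-p)" for j
    using x1[of j] by simp
  ultimately have L: "(\<lambda>j. (\<Sum>b\<in>hzeros (gaf s a w) \<zeta> (sqrt (1 - real (j + 2) powr (-p))). real (zero_mult (gaf s a w) b) * ln (sqrt (1 - real (j + 2) powr (-p)) / cmod (mob \<zeta> b)))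
        + \<rho> / 2 * ln (real (j + 2) powr (-p))
        + (ln (cmod (gaf s a w \<zeta>)) + \<rho> / 2 * ln (1 - (cmod \<zeta>)\<^sup>2) + euler_mascheroni / 2)) \<longlonglongrightarrow> 0"
    unfolding jlim_def sq nonzero_mult_div_cancel_left[OF two] by - assumption
  show ?case
    using zeros_from_jensen[OF z elim(2,3) rho p _ L] by blast
qed

end

section \<open>Uniqueness up to a unimodular factor\<close>

lemma artanh_le_iff:
  fixes x y :: real
  assumes "0 \<le> x" "x < 1" "0 \<le> y" "y < 1"
  shows "artanh x \<le> artanh y \<longleftrightarrow> x \<le> y"
proof -
  have "artanh x \<le> artanh y \<longleftrightarrow> ln ((1 + x) / (1 - x)) \<le> ln ((1 + y) / (1 - y))"
    by (simp add: artanh_def)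
  also have "\<dots> \<longleftrightarrow> (1 + x) / (1 - x) \<le> (1 + y) / (1 - y)"
    using assms by (intro ln_le_cancel_iff) (auto intro!: divide_pos_pos)
  also have "\<dots> \<longleftrightarrow> (1 + x) * (1 - y) \<le> (1 + y) * (1 - x)"
    using assms by (simp add: divide_simps)
  also have "\<dots> \<longleftrightarrow> x \<le> y" by (simp add: algebra_simps)
  finally show ?thesis .
qed

lemma hyp_dist_le_iff:
  assumes z: "cmod \<zeta> < 1" and v: "cmod v < 1" and u: "cmod u < 1"
  shows "hyp_dist \<zeta> v \<le> hyp_dist \<zeta> u \<longleftrightarrow> cmod (mob \<zeta> v) \<le> cmod (mob \<zeta> u)"
proof -
  have "hyp_dist \<zeta> w = 2 * artanh (cmod (mob \<zeta> w))" for w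
    by (simp add: hyp_dist_def mob_def norm_divide norm_minus_commute)
  then show ?thesis using mob_lt_1[OF z v] mob_lt_1[OF z u] by (simp add: artanh_le_iff)
qed

lemma zorder_disc:
  assumes f: "f holomorphic_on ball 0 1" "f 0 \<noteq> 0" and z: "cmod z < 1"
  shows "f z = 0 \<longleftrightarrow> zero_mult f z > 0" "zorder f z = int (zero_mult f z)"
proof -
  have "\<exists>w\<in>ball 0 1. f w \<noteq> 0" using f(2) by (intro bexI[of _ 0]) auto
  then have "if f z = 0 then zorder f z > 0 else zorder f z = 0"
    using zorder_exist_zero[OF f(1), of z] z by simp
  then show "f z = 0 \<longleftrightarrow> zero_mult f z > 0" "zorder f z = int (zero_mult f z)"
    using z by (auto simp: zero_mult_def split: if_splits)
qed

lemma zero_enum_cong: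
  assumes f: "f holomorphic_on ball 0 1" "f 0 \<noteq> 0" and g: "g holomorphic_on ball 0 1" "g 0 \<noteq> 0"
    and m: "zero_mult f = zero_mult g"
  shows "zero_enum f d z \<longleftrightarrow> zero_enum g d z"
proof -
  have "cmod w < 1 \<and> f w = 0 \<longleftrightarrow> cmod w < 1 \<and> g w = 0" for w
    using zorder_disc(1)[OF f, of w] zorder_disc(1)[OF g, of w] m by auto
  then show ?thesis unfolding zero_enum_def m by simp
qed

text \<open>Equal zeros make the quotient \<open>h\<close> of \<open>f\<close> by \<open>g\<close>
  holomorphic and nonvanishing. Its modulus is 1 at the dense points where \<open>g\<close> does not
  vanish, hence by continuity on the open set \<open>U\<close> where \<open>g\<close> does not
  vanish, and the maximum modulus principle makes \<open>h\<close> constant.\<close>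

lemma eq_up_to_unimodular:
  assumes f: "f holomorphic_on ball 0 1" "f 0 \<noteq> 0" and g: "g holomorphic_on ball 0 1" "g 0 \<noteq> 0"
    and m: "zero_mult f = zero_mult g"
    and D: "\<And>X. open X \<Longrightarrow> X \<noteq> {} \<Longrightarrow> \<exists>d\<in>D. d \<in> X"
    and eq: "\<And>w. w \<in> D \<Longrightarrow> cmod w < 1 \<Longrightarrow> cmod (f w) = cmod (g w)"
  shows "\<exists>c. cmod c = 1 \<and> (\<forall>z. cmod z < 1 \<longrightarrow> f z = c * g z)"
proof -
  obtain h where h: "h holomorphic_on ball 0 1" "\<And>z. z \<in> ball 0 1 \<Longrightarrow> h z \<noteq> 0" "\<And>z. z \<in> ball 0 1 \<Longrightarrow> f z = h z * g z"
    by (rule holomorphic_zorder_factorization[OF f(1) _ _ g(1)])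
       (use zorder_disc[OF f] zorder_disc[OF g] m in auto)
  define U where "U = ball 0 1 \<inter> g -` (- {0})"
  have U: "open U" "0 \<in> U" "U \<subseteq> ball 0 1"
    unfolding U_def using g by (auto intro!: continuous_open_preimage holomorphic_on_imp_continuous_on)
  have h1: "cmod (h z) = 1" if z: "z \<in> U" for z
  proof (rule ccontr)
    assume ne: "cmod (h z) \<noteq> 1"
    define X where "X = U \<inter> h -` {v. cmod v \<noteq> 1}"
    have "open {v::complex. cmod v \<noteq> 1}" by (intro open_Collect_neq continuous_intros)
    then have "open X" unfolding X_def
      by (intro continuous_open_preimage U holomorphic_on_imp_continuous_on[OF holomorphic_on_subset[OF h(1)]])
    moreover have "X \<noteq> {}" using z ne by (auto simp: X_def)
    ultimately obtain d where d: "d \<in> D" "d \<in> X" using D by blast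
    then have "d \<in> ball 0 1" "g d \<noteq> 0" "cmod (h d) \<noteq> 1" by (auto simp: X_def U_def)
    moreover have "cmod (h d) * cmod (g d) = cmod (g d)"
      using h(3)[of d] eq[OF d(1)] \<open>d \<in> ball 0 1\<close> by (simp add: norm_mult[symmetric])
    ultimately show False by simp
  qed
  have "h constant_on ball 0 1"
    by (rule maximum_modulus_principle[OF h(1) _ _ U(1,3,2)]) (use h1 U in auto)
  then obtain c where c: "\<And>z. z \<in> ball 0 1 \<Longrightarrow> h z = c" unfolding constant_on_def by blast
  have "cmod c = 1" using c[of 0] h1[OF U(2)] by simp
  then show ?thesis using c h(3) by (intro exI[of _ c]) auto
qed

theorem theorem6:
  fixes M :: "'w measure" and a :: "nat \<Rightarrow> 'w \<Rightarrow> complex"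
    and s :: "nat \<Rightarrow> complex" and \<rho> :: real
  assumes "prob_space M"
    and "\<rho> > 0"
    and "\<And>n. s n ^ 2 = complex_of_real ((- \<rho>) gchoose n)"
    and "prob_space.indep_vars M (\<lambda>_. borel) a UNIV"
    and "\<And>n. distributed M lborel (a n) std_cgauss_density"
  shows
    "(AE \<omega> in M.
        (\<exists>z. zero_enum (gaf s a \<omega>) cmod z) \<and>
        (\<forall>z. zero_enum (gaf s a \<omega>) cmod z \<longrightarrow>
           (\<lambda>n. c_rho \<rho> * (\<Prod>k<n. exp (\<rho> / (2 * real (Suc k))) * cmod (z k)))
             \<longlonglongrightarrow> cmod (gaf s a \<omega> 0)))
   \<and> (\<forall>\<zeta>. cmod \<zeta> < 1 \<longrightarrow>
       (AE \<omega> in M.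
          (\<exists>z. zero_enum (gaf s a \<omega>) (hyp_dist \<zeta>) z) \<and>
          (\<forall>z. zero_enum (gaf s a \<omega>) (hyp_dist \<zeta>) z \<longrightarrow>
             (\<lambda>n. c_rho \<rho> * (1 - (cmod \<zeta>)^2) powr (- \<rho> / 2) *
                  (\<Prod>k<n. exp (\<rho> / (2 * real (Suc k))) *
                     cmod ((z k - \<zeta>) / (1 - cnj \<zeta> * z k))))
               \<longlonglongrightarrow> cmod (gaf s a \<omega> \<zeta>))))
   \<and> (\<exists>\<Phi> :: (complex \<Rightarrow> nat) \<Rightarrow> complex \<Rightarrow> complex.
        AE \<omega> in M. \<exists>c. cmod c = 1 \<and>
          (\<forall>z. cmod z < 1 \<longrightarrow> gaf s a \<omega> z = c * \<Phi> (zero_mult (gaf s a \<omega>)) z))"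
proof -
  interpret prob_space M by fact
  interpret gaf_seq M a s \<rho> by unfold_locales (use assms in auto)
  define good where "good = (\<lambda>\<zeta> \<omega>. (\<exists>z. zero_enum (gaf s a \<omega>) (hyp_dist \<zeta>) z) \<and>
          (\<forall>z. zero_enum (gaf s a \<omega>) (hyp_dist \<zeta>) z \<longrightarrow>
             (\<lambda>n. c_rho \<rho> * (1 - (cmod \<zeta>)^2) powr (- \<rho> / 2) *
                  (\<Prod>k<n. exp (\<rho> / (2 * real (Suc k))) *
                     cmod ((z k - \<zeta>) / (1 - cnj \<zeta> * z k))))
               \<longlonglongrightarrow> cmod (gaf s a \<omega> \<zeta>)))"
  have good: "AE \<omega> in M. good \<zeta> \<omega>" if z: "cmod \<zeta> < 1" for \<zeta>
    using AE_product[OF z] unfolding good_def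
    by eventually_elim (use hyp_dist_le_iff[OF z] in blast)
  have origin: "AE \<omega> in M.
        (\<exists>z. zero_enum (gaf s a \<omega>) cmod z) \<and>
        (\<forall>z. zero_enum (gaf s a \<omega>) cmod z \<longrightarrow>
           (\<lambda>n. c_rho \<rho> * (\<Prod>k<n. exp (\<rho> / (2 * real (Suc k))) * cmod (z k)))
             \<longlonglongrightarrow> cmod (gaf s a \<omega> 0))"
  proof -
    have "cmod 0 < 1" by simp
    from AE_product[OF this] show ?thesis
    proof eventually_elim
      case (elim \<omega>)
      from spec[OF elim, of cmod] show ?case by (simp add: mob_def)
    qed
  qed
  \<comment> \<open>The null set in \<open>good\<close> depends on \<open>\<zeta>\<close>, so only
    countably many centres can be used at once; moduli on a dense set are enough.\<close>
  obtain D :: "complex set" where D: "countable D" "\<And>X. open X \<Longrightarrow> X \<noteq> {} \<Longrightarrow> \<exists>d\<in>D. d \<in> X"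
    using countable_dense_exists by blast
  define E where "E = (\<lambda>\<omega>. gaf s a \<omega> holomorphic_on ball 0 1 \<and> gaf s a \<omega> 0 \<noteq> 0 \<and> (\<forall>\<zeta>\<in>{\<zeta>\<in>D. cmod \<zeta> < 1}. good \<zeta> \<omega>))"
  have "AE \<omega> in M. \<forall>\<zeta>\<in>{\<zeta>\<in>D. cmod \<zeta> < 1}. good \<zeta> \<omega>"
    using D(1) good by (subst AE_ball_countable) auto
  then have E: "AE \<omega> in M. E \<omega>"
    using AE_gaf_holomorphic AE_gaf_nonzero[of 0] unfolding E_def by auto
  have unique: "\<exists>c. cmod c = 1 \<and> (\<forall>z. cmod z < 1 \<longrightarrow> gaf s a \<omega> z = c * gaf s a \<omega>' z)"
    if E: "E \<omega>" "E \<omega>'" and m: "zero_mult (gaf s a \<omega>) = zero_mult (gaf s a \<omega>')" for \<omega> \<omega>'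
  proof (rule eq_up_to_unimodular[OF _ _ _ _ m D(2)])
    fix \<zeta> assume \<zeta>: "\<zeta> \<in> D" "cmod \<zeta> < 1"
    have gd: "good \<zeta> \<omega>" "good \<zeta> \<omega>'" using E \<zeta> by (auto simp: E_def)
    \<comment> \<open>One enumeration is valid for both functions, so the same partial products
      converge to both moduli.\<close>
    obtain z where z: "zero_enum (gaf s a \<omega>) (hyp_dist \<zeta>) z" using gd by (auto simp: good_def)
    moreover have "zero_enum (gaf s a \<omega>') (hyp_dist \<zeta>) z"
      using z zero_enum_cong[OF _ _ _ _ m] E by (auto simp: E_def)
    ultimately show "cmod (gaf s a \<omega> \<zeta>) = cmod (gaf s a \<omega>' \<zeta>)"
      using gd unfolding good_def by (blast intro: LIMSEQ_unique)
  qed (use E in \<open>auto simp: E_def\<close>)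
  \<comment> \<open>No measurability of \<open>\<Phi>\<close> is claimed, so a choice of representative with the given zeros suffices.\<close>
  define \<Phi> where "\<Phi> = (\<lambda>m. gaf s a (SOME \<omega>. E \<omega> \<and> zero_mult (gaf s a \<omega>) = m))"
  have "AE \<omega> in M. \<exists>c. cmod c = 1 \<and> (\<forall>z. cmod z < 1 \<longrightarrow> gaf s a \<omega> z = c * \<Phi> (zero_mult (gaf s a \<omega>)) z)"
    using E
  proof eventually_elim
    case (elim \<omega>)
    define \<omega>' where "\<omega>' = (SOME \<omega>'. E \<omega>' \<and> zero_mult (gaf s a \<omega>') = zero_mult (gaf s a \<omega>))"
    have "E \<omega>' \<and> zero_mult (gaf s a \<omega>') = zero_mult (gaf s a \<omega>)"
      unfolding \<omega>'_def by (rule someI[of _ \<omega>]) (use elim in simp)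
    then show ?case unfolding \<Phi>_def \<omega>'_def[symmetric] using elim by (intro unique) auto
  qed
  then show ?thesis using origin good unfolding good_def by blast
qed

end
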